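(* Let $(\Omega,\mathcal F,P)$ be a probability space, let $S$ be a $\mathcal T_{\varepsilon,\lambda}$-complete random normed module over $K$ ($K=\mathbb R$ or $\mathbb C$) with base $(\Omega,\mathcal F,P)$, and let $h_1,h_2:[0,\infty)\to(S,\mathcal T_{\varepsilon,\lambda})$ be continuous functions such that, for some $M_1,M_2\in L^0_+(\mathcal F)$ and $\xi_1,\xi_2\in L^0(\mathcal F,\mathbb R)$, $\|h_1(s)\|\le M_1e^{\xi_1 s}$ and $\|h_2(s)\|\le M_2e^{\xi_2 s}$ for all $s\ge0$. If $$\int_0^\infty e^{-\eta s}h_1(s)\,ds=\int_0^\infty e^{-\eta s}h_2(s)\,ds$$ for every $\eta\in L^0(\mathcal F,\mathbb R)$ with $\eta>\xi_1\vee\xi_2$ on $\Omega$, then $h_1=h_2$.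
   Context: $L^0(\mathcal F,K)$ is the algebra of ($P$-a.s.) equivalence classes of $K$-valued $\mathcal F$-measurable random variables on $\Omega$. For $f,g\in L^0(\mathcal F,\mathbb R)$, $f\le g$ means a.s. inequality, "$f>g$ on $\Omega$" means $f(\omega)>g(\omega)$ for almost all $\omega$, and $f\vee g$ is the supremum in this order. $L^0_+(\mathcal F)=\{\xi\in L^0(\mathcal F,\mathbb R):\xi\ge 0\}$. A random normed module over $K$ with base $(\Omega,\mathcal F,P)$ is a left $L^0(\mathcal F,K)$-module $S$ with a map $\|\cdot\|:S\to L^0_+(\mathcal F)$ (the $L^0$-norm) such that $\|x\|=0\Rightarrow x=\theta$ (the zero of $S$), $\|\zeta x\|=|\zeta|\,\|x\|$ and $\|x+y\|\le\|x\|+\|y\|$ for $\zeta\in L^0(\mathcal F,K)$, $x,y\in S$. The $(\varepsilon,\lambda)$-topology $\mathcal T_{\varepsilon,\lambda}$ on $S$ is the metrizable linear topology with local base at $\theta$ the sets $\{z: P(\|z\|<\varepsilon)>1-\lambda\}$, $\varepsilon>0$, $0<\lambda<1$; thus $z_n\to z$ iff $\|z_n-z\|\to0$ in probability. Integrals over compact intervals are Riemann integrals ($\mathcal T_{\varepsilon,\lambda}$-limits of Riemann sums; a $\mathcal T_{\varepsilon,\lambda}$-continuous $g:[a,b]\to S$ with $\bigvee_{u\in[a,b]}\|g(u)\|\in L^0_+(\mathcal F)$ is Riemann integrable), and $\int_0^\infty$ is the $\mathcal T_{\varepsilon,\lambda}$-limit of $\int_0^L$ as $L\to\infty$. *)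

theory Defs
  imports "HOL-Probability.Probability_Measure" "HOL-Algebra.Module"
begin

section \<open>The algebra of classes of random variables\<close>

definition ae_rel :: "'w measure \<Rightarrow> (('w \<Rightarrow> 'b::topological_space) \<times> ('w \<Rightarrow> 'b)) set" where
  "ae_rel P = {(f, g). f \<in> borel_measurable P \<and> g \<in> borel_measurable P \<and> (AE w in P. f w = g w)}"

definition L0_class :: "'w measure \<Rightarrow> ('w \<Rightarrow> 'b::topological_space) \<Rightarrow> ('w \<Rightarrow> 'b) set" where
  "L0_class P f = ae_rel P `` {f}"

definition L0_rep :: "('w \<Rightarrow> 'b) set \<Rightarrow> 'w \<Rightarrow> 'b" where
  "L0_rep X = (SOME f. f \<in> X)"

definition L0_map :: "'w measure \<Rightarrow> ('b \<Rightarrow> 'c) \<Rightarrow> ('w \<Rightarrow> 'b) set \<Rightarrow> ('w \<Rightarrow> 'c::topological_space) set" where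
  "L0_map P \<phi> X = L0_class P (\<lambda>w. \<phi> (L0_rep X w))"

definition L0_map2 :: "'w measure \<Rightarrow> ('b \<Rightarrow> 'c \<Rightarrow> 'd) \<Rightarrow> ('w \<Rightarrow> 'b) set \<Rightarrow> ('w \<Rightarrow> 'c) set
    \<Rightarrow> ('w \<Rightarrow> 'd::topological_space) set" where
  "L0_map2 P \<phi> X Y = L0_class P (\<lambda>w. \<phi> (L0_rep X w) (L0_rep Y w))"

definition L0 :: "'w measure \<Rightarrow> ('w \<Rightarrow> 'k::real_normed_field) set ring" where
  "L0 P = \<lparr>carrier = borel_measurable P // ae_rel P,
           mult = L0_map2 P (*), one = L0_class P (\<lambda>_. 1),
           zero = L0_class P (\<lambda>_. 0), add = L0_map2 P (+)\<rparr>"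

definition L0_order :: "'w measure \<Rightarrow> ('w \<Rightarrow> real) set gorder" where
  "L0_order P = \<lparr>carrier = carrier (L0 P), eq = (=),
                 le = (\<lambda>X Y. AE w in P. L0_rep X w \<le> L0_rep Y w)\<rparr>"

definition L0_less :: "'w measure \<Rightarrow> ('w \<Rightarrow> real) set \<Rightarrow> ('w \<Rightarrow> real) set \<Rightarrow> bool" where
  "L0_less P X Y \<longleftrightarrow> (AE w in P. L0_rep X w < L0_rep Y w)"

definition L0_plus :: "'w measure \<Rightarrow> ('w \<Rightarrow> real) set set" where
  "L0_plus P = {X \<in> carrier (L0 P). \<zero>\<^bsub>L0 P\<^esub> \<sqsubseteq>\<^bsub>L0_order P\<^esub> X}"

text \<open>The relations and operations above are stated through chosen representatives; on classes of
  measurable functions they do not depend on the choice.\<close>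

lemma equiv_ae_rel: "equiv (borel_measurable P) (ae_rel P)"
proof (rule equivI)
  show "ae_rel P \<subseteq> borel_measurable P \<times> borel_measurable P"
    by (auto simp: ae_rel_def)
  show "refl_on (borel_measurable P) (ae_rel P)"
    by (auto simp: refl_on_def ae_rel_def)
  show "sym (ae_rel P)"
    by (auto simp: sym_def ae_rel_def elim: eventually_mono)
  show "trans (ae_rel P)"
    by (auto simp: trans_def ae_rel_def elim: eventually_elim2)
qed

lemma L0_rep_measurable:
  assumes "X \<in> carrier (L0 P)"
  shows "L0_rep X \<in> X" "L0_rep X \<in> borel_measurable P"
proof -
  have X: "X \<in> borel_measurable P // ae_rel P"
    using assms by (simp add: L0_def)
  then have "X \<noteq> {}"
    using in_quotient_imp_non_empty[OF equiv_ae_rel] by blast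
  then show "L0_rep X \<in> X"
    unfolding L0_rep_def by (simp add: some_in_eq)
  then show "L0_rep X \<in> borel_measurable P"
    using in_quotient_imp_subset[OF equiv_ae_rel X] by blast
qed

lemma L0_rep_class:
  fixes f :: "'w \<Rightarrow> 'k::real_normed_field"
  assumes "f \<in> borel_measurable P"
  shows "L0_class P f \<in> carrier (L0 P)" "AE w in P. L0_rep (L0_class P f) w = f w"
proof -
  show c: "L0_class P f \<in> carrier (L0 P)"
    using assms by (auto simp: L0_def L0_class_def quotient_def)
  show "AE w in P. L0_rep (L0_class P f) w = f w"
    using L0_rep_measurable(1)[OF c] by (auto simp: L0_class_def ae_rel_def elim: eventually_mono)
qed

lemma L0_eqI:
  assumes "X \<in> carrier (L0 P)" "Y \<in> carrier (L0 P)" "AE w in P. L0_rep X w = L0_rep Y w"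
  shows "X = Y"
proof -
  have "(L0_rep X, L0_rep Y) \<in> ae_rel P"
    using assms L0_rep_measurable(2) by (auto simp: ae_rel_def)
  moreover have "X \<in> borel_measurable P // ae_rel P" "Y \<in> borel_measurable P // ae_rel P"
    using assms(1,2) by (simp_all add: L0_def)
  ultimately show ?thesis
    using quotient_eqI[OF equiv_ae_rel] L0_rep_measurable(1)[OF assms(1)]
      L0_rep_measurable(1)[OF assms(2)] by metis
qed

section \<open>Random normed modules\<close>

text \<open>The field \<open>K\<close> is the type \<open>'k\<close>. Up to isometric isomorphism, the types
  of class \<open>{real_normed_field, euclidean_space}\<close> are exactly \<open>real\<close> and \<open>complex\<close>
  (Frobenius: a finite-dimensional commutative division algebra over the reals is one of the two,
  and the class forces a multiplicative norm).\<close>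

locale random_normed_module = prob_space P + Module.module "L0 P" S
  for P :: "'w measure"
    and S :: "(('w \<Rightarrow> 'k::{real_normed_field, euclidean_space}) set, 's) module"
    and nrm :: "'s \<Rightarrow> ('w \<Rightarrow> real) set" +
  assumes nrm_in: "x \<in> carrier S \<Longrightarrow> nrm x \<in> L0_plus P"
    and nrm_zero: "x \<in> carrier S \<Longrightarrow> nrm x = \<zero>\<^bsub>L0 P\<^esub> \<Longrightarrow> x = \<zero>\<^bsub>S\<^esub>"
    and nrm_smult: "\<zeta> \<in> carrier (L0 P) \<Longrightarrow> x \<in> carrier S
           \<Longrightarrow> nrm (\<zeta> \<odot>\<^bsub>S\<^esub> x) = L0_map P norm \<zeta> \<otimes>\<^bsub>L0 P\<^esub> nrm x"
    and nrm_triangle: "x \<in> carrier S \<Longrightarrow> y \<in> carrier S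
           \<Longrightarrow> nrm (x \<oplus>\<^bsub>S\<^esub> y) \<sqsubseteq>\<^bsub>L0_order P\<^esub> nrm x \<oplus>\<^bsub>L0 P\<^esub> nrm y"

definition eps_lambda_nbhd ::
    "'w measure \<Rightarrow> ('c, 's) module \<Rightarrow> ('s \<Rightarrow> ('w \<Rightarrow> real) set) \<Rightarrow> real \<Rightarrow> real \<Rightarrow> 's set" where
  "eps_lambda_nbhd P S nrm \<epsilon> \<delta> = {z \<in> carrier S. \<P>(w in P. L0_rep (nrm z) w < \<epsilon>) > 1 - \<delta>}"

definition eps_lambda_topology ::
    "'w measure \<Rightarrow> ('c, 's) module \<Rightarrow> ('s \<Rightarrow> ('w \<Rightarrow> real) set) \<Rightarrow> 's topology" where
  "eps_lambda_topology P S nrm = topology (\<lambda>U. U \<subseteq> carrier S \<and>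
     (\<forall>x\<in>U. \<exists>\<epsilon>>0. \<exists>\<delta>>0. \<delta> < 1 \<and>
        (\<forall>z\<in>eps_lambda_nbhd P S nrm \<epsilon> \<delta>. x \<oplus>\<^bsub>S\<^esub> z \<in> U)))"

text \<open>The topology is metrizable by a translation invariant metric, so Cauchy sequences suffice.\<close>

definition eps_lambda_complete ::
    "'w measure \<Rightarrow> ('c, 's) module \<Rightarrow> ('s \<Rightarrow> ('w \<Rightarrow> real) set) \<Rightarrow> bool" where
  "eps_lambda_complete P S nrm \<longleftrightarrow> (\<forall>x::nat \<Rightarrow> 's. range x \<subseteq> carrier S \<longrightarrow>
     (\<forall>\<epsilon>>0. \<forall>\<delta>>0. \<delta> < 1 \<longrightarrow>
        (\<exists>N. \<forall>m\<ge>N. \<forall>n\<ge>N. x m \<ominus>\<^bsub>S\<^esub> x n \<in> eps_lambda_nbhd P S nrm \<epsilon> \<delta>)) \<longrightarrow>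
     (\<exists>l. limitin (eps_lambda_topology P S nrm) x l sequentially))"

context random_normed_module
begin

lemma eps_lambda_nbhd_mono:
  assumes "\<epsilon> \<le> \<epsilon>'" "\<delta> \<le> \<delta>'"
  shows "eps_lambda_nbhd P S nrm \<epsilon> \<delta> \<subseteq> eps_lambda_nbhd P S nrm \<epsilon>' \<delta>'"
proof
  fix z assume z: "z \<in> eps_lambda_nbhd P S nrm \<epsilon> \<delta>"
  then have "nrm z \<in> carrier (L0 P)"
    using nrm_in by (auto simp: eps_lambda_nbhd_def L0_plus_def)
  note [measurable] = L0_rep_measurable(2)[OF this]
  have "\<P>(w in P. L0_rep (nrm z) w < \<epsilon>) \<le> \<P>(w in P. L0_rep (nrm z) w < \<epsilon>')"
    using assms(1) by (intro finite_measure_mono) auto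
  then show "z \<in> eps_lambda_nbhd P S nrm \<epsilon>' \<delta>'"
    using z assms(2) by (auto simp: eps_lambda_nbhd_def)
qed

lemma openin_eps_lambda_topology:
  "openin (eps_lambda_topology P S nrm) U \<longleftrightarrow> U \<subseteq> carrier S \<and>
     (\<forall>x\<in>U. \<exists>\<epsilon>>0. \<exists>\<delta>>0. \<delta> < 1 \<and>
        (\<forall>z\<in>eps_lambda_nbhd P S nrm \<epsilon> \<delta>. x \<oplus>\<^bsub>S\<^esub> z \<in> U))"
proof -
  let ?N = "eps_lambda_nbhd P S nrm"
  define Q where "Q U x \<longleftrightarrow> (\<exists>\<epsilon>>0. \<exists>\<delta>>0. \<delta> < 1 \<and> (\<forall>z\<in>?N \<epsilon> \<delta>. x \<oplus>\<^bsub>S\<^esub> z \<in> U))"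
    for U x
  have mono: "Q V x" if "Q U x" "U \<subseteq> V" for U V x
  proof -
    from that(1) obtain e l where 1: "e > 0" "l > 0" "l < 1" "\<forall>z\<in>?N e l. x \<oplus>\<^bsub>S\<^esub> z \<in> U"
      unfolding Q_def by blast
    then show ?thesis
      unfolding Q_def using that(2) by blast
  qed
  have int: "Q (U \<inter> V) x" if "Q U x" "Q V x" for U V x
  proof -
    obtain e l where 1: "e > 0" "l > 0" "l < 1" "\<forall>z\<in>?N e l. x \<oplus>\<^bsub>S\<^esub> z \<in> U"
      using \<open>Q U x\<close> Q_def by auto
    obtain e' l' where 2: "e' > 0" "l' > 0" "l' < 1" "\<forall>z\<in>?N e' l'. x \<oplus>\<^bsub>S\<^esub> z \<in> V"
      using \<open>Q V x\<close> Q_def by auto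
    have "?N (min e e') (min l l') \<subseteq> ?N e l" "?N (min e e') (min l l') \<subseteq> ?N e' l'"
      by (simp_all add: eps_lambda_nbhd_mono)
    then have "\<forall>z\<in>?N (min e e') (min l l'). x \<oplus>\<^bsub>S\<^esub> z \<in> U \<inter> V"
      using 1(4) 2(4) by blast
    moreover have "min e e' > 0" "min l l' > 0" "min l l' < 1"
      using 1(1-3) 2(1-3) by auto
    ultimately show ?thesis
      unfolding Q_def by blast
  qed
  have "istopology (\<lambda>U. U \<subseteq> carrier S \<and> (\<forall>x\<in>U. Q U x))"
    unfolding istopology_def
  proof (intro conjI allI impI)
    fix \<U> assume *: "\<forall>U\<in>\<U>. U \<subseteq> carrier S \<and> (\<forall>x\<in>U. Q U x)"
    then show "\<Union>\<U> \<subseteq> carrier S"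
      by blast
    show "\<forall>x\<in>\<Union>\<U>. Q (\<Union>\<U>) x"
      using * mono[OF _ Union_upper] by blast
  qed (use int in blast)+
  from topology_inverse'[OF this] show ?thesis
    unfolding eps_lambda_topology_def Q_def by simp
qed

end

section \<open>Riemann and improper integrals\<close>

definition riemann_filter :: "real \<Rightarrow> real \<Rightarrow> (real \<times> real set) set filter" where
  "riemann_filter a b = (INF \<delta>\<in>{0<..}.
     principal {p. p tagged_division_of {a..b} \<and> (\<forall>(u, k)\<in>p. measure lborel k < \<delta>)})"

definition riemann_sum ::
    "'w measure \<Rightarrow> (('w \<Rightarrow> 'k::real_normed_field) set, 's) module \<Rightarrow> (real \<Rightarrow> 's)
      \<Rightarrow> (real \<times> real set) set \<Rightarrow> 's" where
  "riemann_sum P S g p =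
     finsum S (\<lambda>(u, k). L0_class P (\<lambda>_. of_real (measure lborel k)) \<odot>\<^bsub>S\<^esub> g u) p"

definition riemann_integral ::
    "'w measure \<Rightarrow> (('w \<Rightarrow> 'k::real_normed_field) set, 's) module \<Rightarrow> ('s \<Rightarrow> ('w \<Rightarrow> real) set)
      \<Rightarrow> (real \<Rightarrow> 's) \<Rightarrow> real \<Rightarrow> real \<Rightarrow> 's" where
  "riemann_integral P S nrm g a b =
     (THE I. limitin (eps_lambda_topology P S nrm) (riemann_sum P S g) I (riemann_filter a b))"

definition improper_integral ::
    "'w measure \<Rightarrow> (('w \<Rightarrow> 'k::real_normed_field) set, 's) module \<Rightarrow> ('s \<Rightarrow> ('w \<Rightarrow> real) set)
      \<Rightarrow> (real \<Rightarrow> 's) \<Rightarrow> 's" where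
  "improper_integral P S nrm g =
     (THE I. limitin (eps_lambda_topology P S nrm) (\<lambda>L. riemann_integral P S nrm g 0 L) I at_top)"

definition L0_exp :: "'w measure \<Rightarrow> real \<Rightarrow> ('w \<Rightarrow> real) set \<Rightarrow> ('w \<Rightarrow> 'k::real_normed_field) set" where
  "L0_exp P s \<xi> = L0_map P (\<lambda>x. of_real (exp (s * x))) \<xi>"

definition laplace_transform ::
    "'w measure \<Rightarrow> (('w \<Rightarrow> 'k::real_normed_field) set, 's) module \<Rightarrow> ('s \<Rightarrow> ('w \<Rightarrow> real) set)
      \<Rightarrow> (real \<Rightarrow> 's) \<Rightarrow> ('w \<Rightarrow> real) set \<Rightarrow> 's" where
  "laplace_transform P S nrm h \<eta> = improper_integral P S nrm (\<lambda>s. L0_exp P (- s) \<eta> \<odot>\<^bsub>S\<^esub> h s)"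

end

(* Put xi = xi1 v xi2 and use only the points eta = xi + n, n >= 1. Then e^(-eta s) h(s) =
   e^(-n s) g(s), where g(s) = e^(-xi s) h(s) is dominated by M1 + M2 and still continuous, and the
   factor e^(-n s) is deterministic. Weighting the L0-norm by w = 1 / (1 + M1 + M2) and integrating
   over the probability space turns the elements in question into a normed space, in which the
   Riemann sums of e^(-n s) g(s) are Cauchy. For v = g1 - g2 the hypothesis says that
   e^(-s) q(e^(-s)) v(s) integrates to 0 for every polynomial q, hence by Weierstrass' theorem for
   every continuous q on [0,1]. Tents q concentrated near e^(-t) give v(t) = 0. *)
theory Submission
  imports Defs "HOL-Analysis.Analysis" "HOL-Real_Asymp.Real_Asymp"
begin

section \<open>Pointwise calculus of classes\<close>

text \<open>Convergence in probability is in general not given by a norm, while a Riemann sum is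
  estimated term by term only with a homogeneous one. Hence two gauges: the truncated
  \<open>fnorm\<close> metrizes the topology and carries limits and completeness, the weighted
  L1-norm \<open>wnorm\<close> controls sums. Where the weighted random norm is bounded they are
  comparable, and the weight is chosen to make this so for the discounted functions. A second
  obstacle is that e^(-xi s) is an unbounded random multiplier. Continuity of h survives it because
  every positive weight yields the same topology, so the multiplier can be moved into another
  weight. Both integrals are definite descriptions, so the hypothesis has content only once the
  limits are shown to exist. It is then traded at once for a statement on Riemann sums, and the
  passage to polynomials, continuous kernels and tents forms no further integral. The condition n >=
  1 serves twice: it makes eta strictly larger than xi, and it leaves a factor e^(-s), without which
  the uniform error of a polynomial approximation would not be summable over the half-line.\<close>

lemma L0_rep_zero: "AE w in P. L0_rep (\<zero>\<^bsub>L0 P\<^esub> :: ('w \<Rightarrow> 'k::real_normed_field) set) w = 0"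
  by (simp add: L0_def L0_rep_class(2))

lemma L0_rep_add:
  fixes X Y :: "('w \<Rightarrow> 'k::{real_normed_field, second_countable_topology}) set"
  assumes "X \<in> carrier (L0 P)" "Y \<in> carrier (L0 P)"
  shows "AE w in P. L0_rep (X \<oplus>\<^bsub>L0 P\<^esub> Y) w = L0_rep X w + L0_rep Y w"
proof -
  note [measurable] = L0_rep_measurable(2)[OF assms(1)] L0_rep_measurable(2)[OF assms(2)]
  have "(\<lambda>w. L0_rep X w + L0_rep Y w) \<in> borel_measurable P" by simp
  from L0_rep_class(2)[OF this] show ?thesis by (simp add: L0_def L0_map2_def)
qed

lemma L0_rep_mult:
  fixes X Y :: "('w \<Rightarrow> 'k::{real_normed_field, second_countable_topology}) set"
  assumes "X \<in> carrier (L0 P)" "Y \<in> carrier (L0 P)"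
  shows "AE w in P. L0_rep (X \<otimes>\<^bsub>L0 P\<^esub> Y) w = L0_rep X w * L0_rep Y w"
proof -
  note [measurable] = L0_rep_measurable(2)[OF assms(1)] L0_rep_measurable(2)[OF assms(2)]
  have "(\<lambda>w. L0_rep X w * L0_rep Y w) \<in> borel_measurable P" by simp
  from L0_rep_class(2)[OF this] show ?thesis by (simp add: L0_def L0_map2_def)
qed

lemma L0_map_norm:
  fixes X :: "('w \<Rightarrow> 'k::real_normed_field) set"
  assumes "X \<in> carrier (L0 P)"
  shows "L0_map P norm X \<in> carrier (L0 P)"
    and "AE w in P. L0_rep (L0_map P norm X) w = norm (L0_rep X w)"
proof -
  note [measurable] = L0_rep_measurable(2)[OF assms(1)]
  have *: "(\<lambda>w. norm (L0_rep X w)) \<in> borel_measurable P" by simp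
  show "L0_map P norm X \<in> carrier (L0 P)"
    and "AE w in P. L0_rep (L0_map P norm X) w = norm (L0_rep X w)"
    using L0_rep_class[OF *] by (simp_all add: L0_map_def)
qed

lemma L0_exp:
  fixes X :: "('w \<Rightarrow> real) set"
  assumes "X \<in> carrier (L0 P)"
  shows "(L0_exp P s X :: ('w \<Rightarrow> 'k::real_normed_field) set) \<in> carrier (L0 P)"
    and "AE w in P. L0_rep (L0_exp P s X :: ('w \<Rightarrow> 'k) set) w = of_real (exp (s * L0_rep X w))"
proof -
  note [measurable] = L0_rep_measurable(2)[OF assms(1)]
  have *: "(\<lambda>w. of_real (exp (s * L0_rep X w)) :: 'k) \<in> borel_measurable P"
    by (rule measurable_compose[OF _ borel_measurable_of_real]) simp
  show "(L0_exp P s X :: ('w \<Rightarrow> 'k) set) \<in> carrier (L0 P)"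
    and "AE w in P. L0_rep (L0_exp P s X :: ('w \<Rightarrow> 'k) set) w = of_real (exp (s * L0_rep X w))"
    using L0_rep_class[OF *] by (simp_all add: L0_exp_def L0_map_def)
qed

definition L0_const :: "'w measure \<Rightarrow> real \<Rightarrow> ('w \<Rightarrow> 'k::real_normed_field) set" where
  "L0_const P r = L0_class P (\<lambda>_. of_real r)"

lemma L0_const_carrier [simp]: "L0_const P r \<in> carrier (L0 P)"
  by (simp add: L0_const_def L0_rep_class(1))

lemma L0_rep_const: "AE w in P. L0_rep (L0_const P r :: ('w \<Rightarrow> 'k::real_normed_field) set) w = of_real r"
  by (simp add: L0_const_def L0_rep_class(2))

lemma L0_const_0: "L0_const P 0 = \<zero>\<^bsub>L0 P\<^esub>"
  and L0_const_1: "L0_const P 1 = \<one>\<^bsub>L0 P\<^esub>"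
  by (simp_all add: L0_const_def L0_def)

text \<open>The events that \<open>X\<close> exceeds n decrease to the empty set, so continuity from
  above applies. It is applied to the weight and to its reciprocal, either of which may be
  unbounded.\<close>

lemma (in prob_space) prob_tail_lessE:
  fixes X :: "'a \<Rightarrow> real"
  assumes [measurable]: "X \<in> borel_measurable M" and "\<delta> > 0"
  obtains C where "C > 0" "\<P>(w in M. X w > C) < \<delta>"
proof -
  let ?A = "\<lambda>n. {w\<in>space M. X w > real n}"
  have "(\<lambda>n. measure M (?A n)) \<longlonglongrightarrow> measure M (\<Inter>n. ?A n)"
    by (rule finite_Lim_measure_decseq) (auto simp: decseq_def)
  moreover have "(\<Inter>n. ?A n) = {}"
  proof -
    have "\<exists>n. \<not> real n < X w" for w
      using reals_Archimedean2[of "X w"] by (auto simp: not_less intro: less_imp_le)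
    then show ?thesis by auto
  qed
  ultimately have "(\<lambda>n. measure M (?A n)) \<longlonglongrightarrow> 0" by simp
  then have "eventually (\<lambda>n. measure M (?A n) < \<delta> \<and> n > 0) sequentially"
    using assms(2) by (intro eventually_conj order_tendstoD eventually_gt_at_top)
  then obtain n where "measure M (?A n) < \<delta>" "n > 0"
    by (auto simp: eventually_sequentially)
  then show ?thesis using that[of "real n"] by simp
qed

section \<open>The random norm at sample points and deterministic scalars\<close>

context random_normed_module
begin

text \<open>Fixing one measurable representative makes the norm an integrand; its sign, triangle
  inequality and homogeneity then hold only almost everywhere.\<close>

definition rnorm :: "'s \<Rightarrow> 'w \<Rightarrow> real" where "rnorm x = L0_rep (nrm x)"

abbreviation cst :: "real \<Rightarrow> ('w \<Rightarrow> 'k) set" where "cst r \<equiv> L0_const P r"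

lemma rnorm_measurable [measurable]: "x \<in> carrier S \<Longrightarrow> rnorm x \<in> borel_measurable P"
  using nrm_in[of x] L0_rep_measurable(2)[of "nrm x" P] by (simp add: rnorm_def L0_plus_def)

lemma nrm_carrier: "x \<in> carrier S \<Longrightarrow> nrm x \<in> carrier (L0 P)"
  using nrm_in[of x] by (simp add: L0_plus_def)

lemma rnorm_nonneg: "x \<in> carrier S \<Longrightarrow> AE w in P. 0 \<le> rnorm x w"
  using nrm_in[of x] L0_rep_zero[of P, where 'k=real] 
  by (auto simp: rnorm_def L0_plus_def L0_order_def elim: eventually_elim2)

lemma rnorm_triangle:
  assumes "x \<in> carrier S" "y \<in> carrier S"
  shows "AE w in P. rnorm (x \<oplus>\<^bsub>S\<^esub> y) w \<le> rnorm x w + rnorm y w"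
  using nrm_triangle[OF assms] L0_rep_add[OF nrm_carrier[OF assms(1)] nrm_carrier[OF assms(2)]]
  by (auto simp: rnorm_def L0_order_def elim: eventually_elim2)

lemma rnorm_smult:
  assumes "\<zeta> \<in> carrier (L0 P)" "x \<in> carrier S"
  shows "AE w in P. rnorm (\<zeta> \<odot>\<^bsub>S\<^esub> x) w = norm (L0_rep \<zeta> w) * rnorm x w"
  using L0_rep_mult[OF L0_map_norm(1)[OF assms(1)] nrm_carrier[OF assms(2)]]
    L0_map_norm(2)[OF assms(1)]
  by (auto simp: rnorm_def nrm_smult[OF assms] elim: eventually_elim2)

lemma rnorm_eq_0_imp: "x \<in> carrier S \<Longrightarrow> AE w in P. rnorm x w = 0 \<Longrightarrow> x = \<zero>\<^bsub>S\<^esub>"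
proof -
  assume x: "x \<in> carrier S" and *: "AE w in P. rnorm x w = 0"
  have "nrm x = \<zero>\<^bsub>L0 P\<^esub>"
  proof (rule L0_eqI[OF nrm_carrier[OF x]])
    show "\<zero>\<^bsub>L0 P\<^esub> \<in> carrier (L0 P)" by (metis L0_const_0 L0_const_carrier)
    show "AE w in P. L0_rep (nrm x) w = L0_rep \<zero>\<^bsub>L0 P\<^esub> w"
      using * L0_rep_zero[of P, where 'k=real] by (auto simp: rnorm_def elim: eventually_elim2)
  qed
  then show ?thesis by (rule nrm_zero[OF x])
qed

text \<open>Together with \<open>cst_mult\<close>: the deterministic scalars are a copy of the reals
  inside \<open>L0 P\<close>, so \<open>S\<close> is also an ordinary real vector space, in which
  Riemann sums are formed.\<close>

lemma cst_add: "cst (r + s) = cst r \<oplus>\<^bsub>L0 P\<^esub> cst s"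
proof (rule L0_eqI)
  show "AE w in P. L0_rep (cst (r + s)) w = L0_rep (cst r \<oplus>\<^bsub>L0 P\<^esub> cst s) w"
    using L0_rep_const[of P "r + s", where 'k='k] L0_rep_const[of P r, where 'k='k] L0_rep_const[of P s, where 'k='k]
      L0_rep_add[OF L0_const_carrier[of P r, where 'b='k] L0_const_carrier[of P s, where 'b='k]]
    by eventually_elim simp
qed simp_all

lemma cst_mult: "cst (r * s) = cst r \<otimes>\<^bsub>L0 P\<^esub> cst s"
proof (rule L0_eqI)
  show "AE w in P. L0_rep (cst (r * s)) w = L0_rep (cst r \<otimes>\<^bsub>L0 P\<^esub> cst s) w"
    using L0_rep_const[of P "r * s", where 'k='k] L0_rep_const[of P r, where 'k='k] L0_rep_const[of P s, where 'k='k]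
      L0_rep_mult[OF L0_const_carrier[of P r, where 'b='k] L0_const_carrier[of P s, where 'b='k]]
    by eventually_elim simp
qed simp_all

lemma rnorm_cst:
  assumes "x \<in> carrier S"
  shows "AE w in P. rnorm (cst r \<odot>\<^bsub>S\<^esub> x) w = \<bar>r\<bar> * rnorm x w"
  using rnorm_smult[OF L0_const_carrier assms, of r] L0_rep_const[of P r, where 'k='k]
  by eventually_elim simp

lemma cst_zero_smult: "x \<in> carrier S \<Longrightarrow> cst 0 \<odot>\<^bsub>S\<^esub> x = \<zero>\<^bsub>S\<^esub>"
  by (simp add: L0_const_0)

lemma cst_one_smult: "x \<in> carrier S \<Longrightarrow> cst 1 \<odot>\<^bsub>S\<^esub> x = x"
  by (simp add: L0_const_1)

lemma cst_minus_one_smult: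
  assumes "x \<in> carrier S"
  shows "cst (- 1) \<odot>\<^bsub>S\<^esub> x = \<ominus>\<^bsub>S\<^esub> x"
proof -
  have "cst (- 1) \<odot>\<^bsub>S\<^esub> x \<oplus>\<^bsub>S\<^esub> x = cst (- 1 + 1) \<odot>\<^bsub>S\<^esub> x"
    using assms by (simp only: cst_add smult_l_distr L0_const_carrier cst_one_smult)
  also have "\<dots> = \<zero>\<^bsub>S\<^esub>" using assms cst_zero_smult by simp
  finally show ?thesis using assms by (metis M.minus_equality smult_closed L0_const_carrier)
qed

lemma rnorm_minus:
  assumes "x \<in> carrier S"
  shows "AE w in P. rnorm (\<ominus>\<^bsub>S\<^esub> x) w = rnorm x w"
  using rnorm_cst[OF assms, of "-1"] cst_minus_one_smult[OF assms] by simp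

lemma rnorm_zero: "AE w in P. rnorm \<zero>\<^bsub>S\<^esub> w = 0"
  using rnorm_cst[of "\<zero>\<^bsub>S\<^esub>" 0] cst_zero_smult[of "\<zero>\<^bsub>S\<^esub>"] by simp

end

section \<open>A weighted F-norm and a weighted L1-norm\<close>

text \<open>For each positive weight, \<open>fnorm\<close> below induces the \<open>(\<epsilon>, \<lambda>)\<close>-topology; this freedom
  absorbs multiplication by a random factor. The homogeneous \<open>wnorm\<close> controls Riemann sums, and
  dominates \<open>fnorm\<close>.\<close>

locale weighted_random_normed_module = random_normed_module P S nrm
  for P :: "'w measure"
    and S :: "(('w \<Rightarrow> 'k::{real_normed_field, euclidean_space}) set, 's) module"
    and nrm :: "'s \<Rightarrow> ('w \<Rightarrow> real) set" +
  fixes wt :: "'w \<Rightarrow> real"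
  assumes wt_measurable [measurable]: "wt \<in> borel_measurable P"
    and wt_pos: "\<And>w. 0 < wt w"
begin

text \<open>The cut at 1 makes the value finite on all of \<open>S\<close>; the price is
  homogeneity, for which \<open>fnorm_cst_le\<close> and \<open>fnorm_cst_ge\<close> are
  substitutes.\<close>

definition fnorm :: "'s \<Rightarrow> real" where
  "fnorm x = (\<integral>w. min 1 (wt w * rnorm x w) \<partial>P)"

definition wnorm :: "'s \<Rightarrow> real" where
  "wnorm x = (\<integral>w. wt w * rnorm x w \<partial>P)"

text \<open>A non-integrable function has Bochner integral 0 by convention, so \<open>wnorm\<close>
  carries information only on this set.\<close>

definition wL1 :: "'s set" where
  "wL1 = {x \<in> carrier S. integrable P (\<lambda>w. wt w * rnorm x w)}"

lemma wL1_carrier: "x \<in> wL1 \<Longrightarrow> x \<in> carrier S"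
  by (simp add: wL1_def)

lemma wt_rnorm_nonneg: "x \<in> carrier S \<Longrightarrow> AE w in P. 0 \<le> wt w * rnorm x w"
  using rnorm_nonneg[of x] wt_pos by (auto simp: less_imp_le elim: eventually_mono)

section \<open>The truncated gauge as a metric for the topology\<close>

lemma integrable_fnorm:
  assumes "x \<in> carrier S"
  shows "integrable P (\<lambda>w. min 1 (wt w * rnorm x w))"
proof (rule integrable_const_bound[where B=1])
  show "AE w in P. norm (min 1 (wt w * rnorm x w)) \<le> 1"
    using wt_rnorm_nonneg[OF assms] by eventually_elim auto
qed (use assms in measurable)

lemma fnorm_nonneg: "x \<in> carrier S \<Longrightarrow> 0 \<le> fnorm x"
  unfolding fnorm_def using wt_rnorm_nonneg[of x] by (intro integral_nonneg_AE) (auto elim: eventually_mono)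

lemma fnorm_triangle:
  assumes "x \<in> carrier S" "y \<in> carrier S"
  shows "fnorm (x \<oplus>\<^bsub>S\<^esub> y) \<le> fnorm x + fnorm y"
proof -
  have "AE w in P. min 1 (wt w * rnorm (x \<oplus>\<^bsub>S\<^esub> y) w) \<le> min 1 (wt w * rnorm x w) + min 1 (wt w * rnorm y w)"
    using rnorm_triangle[OF assms] wt_rnorm_nonneg[OF assms(1)] wt_rnorm_nonneg[OF assms(2)]
  proof eventually_elim
    case (elim w)
    have "wt w * rnorm (x \<oplus>\<^bsub>S\<^esub> y) w \<le> wt w * rnorm x w + wt w * rnorm y w"
      using mult_left_mono[OF elim(1) less_imp_le[OF wt_pos[of w]]] by (simp add: algebra_simps)
    then show ?case using elim(2,3) by auto
  qed
  then have "fnorm (x \<oplus>\<^bsub>S\<^esub> y) \<le> (\<integral>w. min 1 (wt w * rnorm x w) + min 1 (wt w * rnorm y w) \<partial>P)"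
    unfolding fnorm_def using assms
    by (intro integral_mono_AE integrable_fnorm Bochner_Integration.integrable_add) auto
  then show ?thesis
    unfolding fnorm_def by (simp add: Bochner_Integration.integral_add integrable_fnorm assms)
qed

lemma fnorm_minus: "x \<in> carrier S \<Longrightarrow> fnorm (\<ominus>\<^bsub>S\<^esub> x) = fnorm x"
  unfolding fnorm_def using rnorm_minus[of x]
  by (intro integral_cong_AE) (auto elim: eventually_mono)

lemma fnorm_zero: "fnorm \<zero>\<^bsub>S\<^esub> = 0"
proof -
  have "fnorm \<zero>\<^bsub>S\<^esub> = (\<integral>w. 0 \<partial>P)"
    unfolding fnorm_def using rnorm_zero by (intro integral_cong_AE) (auto elim: eventually_mono)
  then show ?thesis by simp
qed

lemma fnorm_eq_0_imp:
  assumes x: "x \<in> carrier S" and "fnorm x = 0"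
  shows "x = \<zero>\<^bsub>S\<^esub>"
proof -
  have "AE w in P. min 1 (wt w * rnorm x w) = 0"
    using assms(2) wt_rnorm_nonneg[OF x] unfolding fnorm_def
    by (subst (asm) integral_nonneg_eq_0_iff_AE[OF integrable_fnorm[OF x]]) (auto elim: eventually_mono)
  then have "AE w in P. rnorm x w = 0"
  proof eventually_elim
    case (elim w)
    then have "wt w * rnorm x w = 0" by (auto simp: min_def split: if_splits)
    then show ?case using wt_pos[of w] by simp
  qed
  then show ?thesis by (rule rnorm_eq_0_imp[OF x])
qed

lemma fnorm_minus_commute:
  assumes "x \<in> carrier S" "y \<in> carrier S"
  shows "fnorm (x \<ominus>\<^bsub>S\<^esub> y) = fnorm (y \<ominus>\<^bsub>S\<^esub> x)"
proof -
  have "y \<ominus>\<^bsub>S\<^esub> x = \<ominus>\<^bsub>S\<^esub> (x \<ominus>\<^bsub>S\<^esub> y)"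
    using assms by (simp add: M.minus_add M.minus_eq M.a_comm)
  then show ?thesis using assms by (simp add: fnorm_minus)
qed

lemma minus_split:
  assumes "x \<in> carrier S" "y \<in> carrier S" "z \<in> carrier S"
  shows "x \<ominus>\<^bsub>S\<^esub> z = (x \<ominus>\<^bsub>S\<^esub> y) \<oplus>\<^bsub>S\<^esub> (y \<ominus>\<^bsub>S\<^esub> z)"
  using assms by (simp add: M.minus_eq M.a_assoc M.r_neg1)

lemma fnorm_triangle_minus:
  assumes "x \<in> carrier S" "y \<in> carrier S" "z \<in> carrier S"
  shows "fnorm (x \<ominus>\<^bsub>S\<^esub> z) \<le> fnorm (x \<ominus>\<^bsub>S\<^esub> y) + fnorm (y \<ominus>\<^bsub>S\<^esub> z)"
  using fnorm_triangle[of "x \<ominus>\<^bsub>S\<^esub> y" "y \<ominus>\<^bsub>S\<^esub> z"] assms minus_split[OF assms] by simp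

text \<open>\<open>Metric_space\<close> demands nonnegativity and symmetry for all arguments, hence
  the default 0 outside the carrier.\<close>

definition fdist :: "'s \<Rightarrow> 's \<Rightarrow> real" where
  "fdist x y = (if x \<in> carrier S \<and> y \<in> carrier S then fnorm (x \<ominus>\<^bsub>S\<^esub> y) else 0)"

sublocale metr: Metric_space "carrier S" fdist
proof
  show "0 \<le> fdist x y" for x y by (auto simp: fdist_def intro: fnorm_nonneg)
  show "fdist x y = fdist y x" for x y by (auto simp: fdist_def fnorm_minus_commute)
  show "(fdist x y = 0) = (x = y)" if "x \<in> carrier S" "y \<in> carrier S" for x y
  proof
    assume "fdist x y = 0"
    then have "x \<oplus>\<^bsub>S\<^esub> \<ominus>\<^bsub>S\<^esub> y = \<zero>\<^bsub>S\<^esub>"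
      using that fnorm_eq_0_imp[of "x \<ominus>\<^bsub>S\<^esub> y"] by (simp add: fdist_def M.minus_eq)
    then show "x = y" using that by (metis M.minus_equality M.minus_minus M.a_inv_closed)
  next
    assume "x = y"
    then show "fdist x y = 0" using that by (simp add: fdist_def M.minus_eq M.r_neg fnorm_zero)
  qed
  show "fdist x z \<le> fdist x y + fdist y z" if "x \<in> carrier S" "y \<in> carrier S" "z \<in> carrier S" for x y z
    using that fnorm_triangle_minus by (auto simp: fdist_def)
qed

text \<open>The sample space is split: where the weight exceeds \<open>C\<close> or the norm reaches
  \<open>e\<close>, the truncated integrand is at most 1 on an event of small probability; elsewhere
  it is at most \<open>C * e\<close>.\<close>

lemma eps_lambda_nbhd_subset_fnorm:
  assumes "\<epsilon> > 0"
  obtains e l where "e > 0" "l > 0" "l < 1" "\<And>z. z \<in> eps_lambda_nbhd P S nrm e l \<Longrightarrow> fnorm z < \<epsilon>"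
proof -
  obtain C where C: "C > 0" "\<P>(w in P. wt w > C) < \<epsilon> / 3"
    using prob_tail_lessE[OF wt_measurable, of "\<epsilon> / 3"] assms by auto
  \<comment> \<open>Three thirds of \<open>\<epsilon>\<close>: one for a large weight, one
    (\<open>l\<close>) for a large norm, one for \<open>C * e\<close>. The cap 1 / 2 keeps
    \<open>l\<close> below 1.\<close>
  define e l where "e = \<epsilon> / (3 * C)" and "l = min (\<epsilon> / 3) (1 / 2)"
  have "fnorm z < \<epsilon>" if z: "z \<in> eps_lambda_nbhd P S nrm e l" for z
  proof -
    have zc: "z \<in> carrier S" and p: "\<P>(w in P. rnorm z w < e) > 1 - l"
      using z by (auto simp: eps_lambda_nbhd_def rnorm_def)
    note [measurable] = rnorm_measurable[OF zc]
    let ?A = "{w\<in>space P. wt w > C}" and ?B = "{w\<in>space P. rnorm z w \<ge> e}"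
    have "?B = space P - {w\<in>space P. rnorm z w < e}" by auto
    then have "prob ?B = 1 - \<P>(w in P. rnorm z w < e)" by (simp add: prob_compl)
    then have B: "prob ?B < l" using p by simp
    have int: "integrable P (indicator ?A :: 'w \<Rightarrow> real)" "integrable P (indicator ?B :: 'w \<Rightarrow> real)"
      by (intro integrable_real_indicator; simp add: emeasure_eq_measure)+
    have "fnorm z \<le> (\<integral>w. indicator ?A w + indicator ?B w + \<epsilon> / 3 \<partial>P)"
      unfolding fnorm_def
    proof (rule integral_mono_AE[OF integrable_fnorm[OF zc]])
      show "AE w in P. min 1 (wt w * rnorm z w) \<le> indicator ?A w + indicator ?B w + \<epsilon> / 3"
        using rnorm_nonneg[OF zc] AE_space
      proof (eventually_elim, goal_cases)
        case (1 w)
        show ?case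
        proof (cases "w \<in> ?A \<or> w \<in> ?B")
          case True then show ?thesis using assms by (auto simp: indicator_def)
        next
          case False
          then have "wt w * rnorm z w \<le> C * e"
            using 1 C wt_pos[of w] by (intro mult_mono) auto
          also have "\<dots> = \<epsilon> / 3" using C by (simp add: e_def)
          finally show ?thesis by (simp add: indicator_def min_le_iff_disj)
        qed
      qed
    qed (use int in auto)
    also have "\<dots> = prob ?A + prob ?B + \<epsilon> / 3"
      using int by (simp add: Bochner_Integration.integral_add prob_space Int_absorb2 sets.sets_into_space)
    also have "\<dots> < \<epsilon>" using C B by (auto simp: l_def)
    finally show ?thesis .
  qed
  then show ?thesis using that[of e l] C assms by (auto simp: e_def l_def)
qed

text \<open>Markov's inequality for the truncated weighted norm. Where the weight is not too small,
  a norm of at least \<open>e\<close> forces that variable up to the threshold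
  \<open>a\<close>.\<close>

lemma fnorm_subset_eps_lambda_nbhd:
  assumes "e > 0" "l > 0"
  obtains \<epsilon> where "\<epsilon> > 0" "\<And>z. z \<in> carrier S \<Longrightarrow> fnorm z < \<epsilon> \<Longrightarrow> z \<in> eps_lambda_nbhd P S nrm e l"
proof -
  obtain C where C: "C > 0" "\<P>(w in P. 1 / wt w > C) < l / 2"
    using prob_tail_lessE[of "\<lambda>w. 1 / wt w" "l / 2"] assms by auto
  \<comment> \<open>If 1 / \<open>wt\<close> is at most \<open>C\<close>, a norm of at least
    \<open>e\<close> has weighted value at least e / C. The threshold may not exceed 1, the largest
    value of the truncated variable.\<close>
  define a where "a = min 1 (e / C)"
  have a: "a > 0" using assms C by (simp add: a_def)
  have "z \<in> eps_lambda_nbhd P S nrm e l" if zc: "z \<in> carrier S" and z: "fnorm z < a * l / 2" for z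
  proof -
    note [measurable] = rnorm_measurable[OF zc]
    let ?A = "{w\<in>space P. 1 / wt w > C}" and ?B = "{w\<in>space P. min 1 (wt w * rnorm z w) \<ge> a}"
    have "prob ?B \<le> fnorm z / a"
      unfolding fnorm_def using a wt_rnorm_nonneg[OF zc]
      by (intro integral_Markov_inequality_measure[where A="{}"] integrable_fnorm zc) (auto elim: eventually_mono)
    also have "\<dots> < l / 2" using z a by (simp add: field_simps)
    finally have B: "prob ?B < l / 2" .
    have sub: "space P - {w\<in>space P. rnorm z w < e} \<subseteq> ?A \<union> ?B"
    proof
      fix w assume "w \<in> space P - {w\<in>space P. rnorm z w < e}"
      then have w: "w \<in> space P" "\<not> rnorm z w < e" by auto
      show "w \<in> ?A \<union> ?B"
      proof (cases "C < 1 / wt w")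
        case False
        then have "1 / C \<le> wt w" using C wt_pos[of w] by (simp add: field_simps)
        then have "1 / C * e \<le> wt w * rnorm z w" using w assms wt_pos[of w] C
          by (intro mult_mono) auto
        then show ?thesis using w by (auto simp: a_def min_le_iff_disj)
      qed (use w in simp)
    qed
    have "1 - \<P>(w in P. rnorm z w < e) = prob (space P - {w\<in>space P. rnorm z w < e})"
      by (simp add: prob_compl)
    also have "\<dots> \<le> prob (?A \<union> ?B)" by (intro finite_measure_mono sub) auto
    also have "\<dots> \<le> prob ?A + prob ?B" by (intro measure_subadditive) (auto simp: emeasure_eq_measure)
    also have "\<dots> < l" using B C by simp
    finally show ?thesis using zc by (simp add: eps_lambda_nbhd_def rnorm_def)
  qed
  then show ?thesis using that[of "a * l / 2"] a assms by simp
qed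

text \<open>The two neighbourhood comparisons above, translated to an arbitrary point. The left side
  does not mention \<open>wt\<close>, so all positive weights induce the same topology; this permits
  a change of weight later on.\<close>

lemma eps_lambda_topology_eq: "eps_lambda_topology P S nrm = metr.mtopology"
proof (rule topology_eq[THEN iffD2], intro allI)
  fix U
  have "(\<exists>\<epsilon>>0. \<exists>\<delta>>0. \<delta> < 1 \<and> (\<forall>z\<in>eps_lambda_nbhd P S nrm \<epsilon> \<delta>. x \<oplus>\<^bsub>S\<^esub> z \<in> U))
      \<longleftrightarrow> (\<exists>r>0. metr.mball x r \<subseteq> U)" if "U \<subseteq> carrier S" "x \<in> U" for x
  proof
    have x: "x \<in> carrier S" using that by auto
    {
      assume "\<exists>\<epsilon>>0. \<exists>\<delta>>0. \<delta> < 1 \<and> (\<forall>z\<in>eps_lambda_nbhd P S nrm \<epsilon> \<delta>. x \<oplus>\<^bsub>S\<^esub> z \<in> U)"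
      then obtain e l where el: "e > 0" "l > 0" "\<forall>z\<in>eps_lambda_nbhd P S nrm e l. x \<oplus>\<^bsub>S\<^esub> z \<in> U"
        by blast
      obtain r where r: "r > 0" "\<And>z. z \<in> carrier S \<Longrightarrow> fnorm z < r \<Longrightarrow> z \<in> eps_lambda_nbhd P S nrm e l"
        using fnorm_subset_eps_lambda_nbhd[OF el(1,2)] by blast
      have "metr.mball x r \<subseteq> U"
      proof
        fix y assume "y \<in> metr.mball x r"
        then have y: "y \<in> carrier S" "fnorm (y \<ominus>\<^bsub>S\<^esub> x) < r"
          using fnorm_minus_commute[of x y] x by (auto simp: metr.in_mball fdist_def)
        then have "x \<oplus>\<^bsub>S\<^esub> (y \<ominus>\<^bsub>S\<^esub> x) \<in> U" using el(3) r(2)[of "y \<ominus>\<^bsub>S\<^esub> x"] x by auto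
        then show "y \<in> U" using x y(1)
          by (metis M.a_comm M.minus_closed M.minus_eq M.a_assoc M.l_neg M.r_zero M.a_inv_closed)
      qed
      then show "\<exists>r>0. metr.mball x r \<subseteq> U" using r(1) by blast
    next
      assume "\<exists>r>0. metr.mball x r \<subseteq> U"
      then obtain r where r: "r > 0" "metr.mball x r \<subseteq> U" by blast
      obtain e l where el: "e > 0" "l > 0" "l < 1" "\<And>z. z \<in> eps_lambda_nbhd P S nrm e l \<Longrightarrow> fnorm z < r"
        using eps_lambda_nbhd_subset_fnorm[OF r(1)] by blast
      have "x \<oplus>\<^bsub>S\<^esub> z \<in> U" if z: "z \<in> eps_lambda_nbhd P S nrm e l" for z
      proof -
        have zc: "z \<in> carrier S" using z by (simp add: eps_lambda_nbhd_def)
        have "(x \<oplus>\<^bsub>S\<^esub> z) \<ominus>\<^bsub>S\<^esub> x = z"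
          using x zc by (metis M.add.m_comm M.add.inv_solve_right' M.minus_eq M.add.m_closed)
        then have "fdist x (x \<oplus>\<^bsub>S\<^esub> z) = fnorm z"
          using x zc fnorm_minus_commute[of x "x \<oplus>\<^bsub>S\<^esub> z"] by (simp add: fdist_def)
        then have "x \<oplus>\<^bsub>S\<^esub> z \<in> metr.mball x r" using x zc el(4)[OF z] by (simp add: metr.in_mball)
        then show ?thesis using r by blast
      qed
      then show "\<exists>\<epsilon>>0. \<exists>\<delta>>0. \<delta> < 1 \<and> (\<forall>z\<in>eps_lambda_nbhd P S nrm \<epsilon> \<delta>. x \<oplus>\<^bsub>S\<^esub> z \<in> U)"
        using el by blast
    }
  qed
  then show "openin (eps_lambda_topology P S nrm) U = openin metr.mtopology U"
    unfolding openin_eps_lambda_topology metr.openin_mtopology by blast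
qed

lemma limitin_eps_lambda:
  "limitin (eps_lambda_topology P S nrm) f l F \<longleftrightarrow>
     l \<in> carrier S \<and> (\<forall>\<epsilon>>0. eventually (\<lambda>x. f x \<in> carrier S \<and> fnorm (f x \<ominus>\<^bsub>S\<^esub> l) < \<epsilon>) F)"
  unfolding eps_lambda_topology_eq metr.limitin_metric
  by (auto simp: fdist_def intro!: eventually_cong cong: conj_cong)

lemma fnorm_CauchyE:
  assumes "eps_lambda_complete P S nrm"
    and x: "\<And>n. x n \<in> carrier S"
    and Cauchy: "\<And>\<epsilon>. \<epsilon> > 0 \<Longrightarrow> \<exists>N::nat. \<forall>m\<ge>N. \<forall>n\<ge>N. fnorm (x m \<ominus>\<^bsub>S\<^esub> x n) < \<epsilon>"
  obtains l where "limitin (eps_lambda_topology P S nrm) x l sequentially"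
proof -
  have "\<exists>N. \<forall>m\<ge>N. \<forall>n\<ge>N. x m \<ominus>\<^bsub>S\<^esub> x n \<in> eps_lambda_nbhd P S nrm e l" if "e > 0" "l > 0" for e l
  proof -
    obtain r where r: "r > 0" "\<And>z. z \<in> carrier S \<Longrightarrow> fnorm z < r \<Longrightarrow> z \<in> eps_lambda_nbhd P S nrm e l"
      using fnorm_subset_eps_lambda_nbhd[OF \<open>e > 0\<close> \<open>l > 0\<close>] by blast
    then show ?thesis using Cauchy x by (meson M.minus_closed)
  qed
  then show ?thesis using assms(1) x that unfolding eps_lambda_complete_def
    by (metis (no_types, lifting) image_subsetI)
qed

lemma limitin_unique:
  assumes "limitin (eps_lambda_topology P S nrm) f a F" "limitin (eps_lambda_topology P S nrm) f b F"
    "F \<noteq> bot"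
  shows "a = b"
  using assms metr.limitin_metric_unique unfolding eps_lambda_topology_eq by blast

lemma continuous_map_eps_lambda:
  assumes "continuous_map (top_of_set A) (eps_lambda_topology P S nrm) h" "s \<in> A" "\<epsilon> > 0"
  obtains \<delta> where "\<delta> > 0" "\<And>t. t \<in> A \<Longrightarrow> \<bar>t - s :: real\<bar> < \<delta> \<Longrightarrow> fnorm (h t \<ominus>\<^bsub>S\<^esub> h s) < \<epsilon>"
proof -
  from assms(1) have hc: "h t \<in> carrier S" if "t \<in> A" for t
    using that by (auto simp: continuous_map_def eps_lambda_topology_eq)
  have "openin (eps_lambda_topology P S nrm) (metr.mball (h s) \<epsilon>)"
    by (simp add: eps_lambda_topology_eq)
  then have "openin (top_of_set A) {x \<in> A. h x \<in> metr.mball (h s) \<epsilon>}"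
    using assms(1) by (auto simp: continuous_map_def)
  moreover have "s \<in> {x \<in> A. h x \<in> metr.mball (h s) \<epsilon>}"
    using assms(2,3) hc by simp
  ultimately obtain \<delta> where "\<delta> > 0" "\<And>t. t \<in> A \<Longrightarrow> dist t s < \<delta> \<Longrightarrow> h t \<in> metr.mball (h s) \<epsilon>"
    unfolding openin_euclidean_subtopology_iff by blast
  then show ?thesis using that[of \<delta>] hc assms(2) fnorm_minus_commute
    by (auto simp: dist_real_def metr.in_mball fdist_def)
qed

section \<open>The homogeneous weighted norm and its comparison with the truncated gauge\<close>

lemma wt_rnorm_triangle:
  assumes "x \<in> carrier S" "y \<in> carrier S"
  shows "AE w in P. wt w * rnorm (x \<oplus>\<^bsub>S\<^esub> y) w \<le> wt w * rnorm x w + wt w * rnorm y w"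
  using rnorm_triangle[OF assms]
  by eventually_elim (simp flip: distrib_left add: wt_pos)

lemma wt_rnorm_cst:
  assumes "x \<in> carrier S"
  shows "AE w in P. wt w * rnorm (cst r \<odot>\<^bsub>S\<^esub> x) w = \<bar>r\<bar> * (wt w * rnorm x w)"
  using rnorm_cst[OF assms, of r] by eventually_elim simp

lemma wL1_add [simp]: assumes "x \<in> wL1" "y \<in> wL1" shows "x \<oplus>\<^bsub>S\<^esub> y \<in> wL1"
proof -
  have xc [simp]: "x \<in> carrier S" and yc [simp]: "y \<in> carrier S" using assms by (auto simp: wL1_def)
  have "integrable P (\<lambda>w. wt w * rnorm (x \<oplus>\<^bsub>S\<^esub> y) w)"
  proof (rule Bochner_Integration.integrable_bound)
    show "integrable P (\<lambda>w. wt w * rnorm x w + wt w * rnorm y w)"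
      using assms by (auto simp: wL1_def)
    show "AE w in P. norm (wt w * rnorm (x \<oplus>\<^bsub>S\<^esub> y) w) \<le> norm (wt w * rnorm x w + wt w * rnorm y w)"
      using wt_rnorm_triangle[OF xc yc] wt_rnorm_nonneg[OF M.a_closed[OF xc yc]] wt_rnorm_nonneg[OF xc] wt_rnorm_nonneg[OF yc] 
      by eventually_elim simp
  qed measurable
  then show ?thesis by (simp add: wL1_def)
qed

lemma wL1_cst [simp]: assumes "x \<in> wL1" shows "cst r \<odot>\<^bsub>S\<^esub> x \<in> wL1"
proof -
  have [simp]: "x \<in> carrier S" using assms by (auto simp: wL1_def)
  have "integrable P (\<lambda>w. wt w * rnorm (cst r \<odot>\<^bsub>S\<^esub> x) w) \<longleftrightarrow> integrable P (\<lambda>w. \<bar>r\<bar> * (wt w * rnorm x w))"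
    by (intro integrable_cong_AE wt_rnorm_cst) measurable
  then show ?thesis using assms by (auto simp: wL1_def)
qed

lemma wL1_minus [simp]: assumes "x \<in> wL1" "y \<in> wL1" shows "x \<ominus>\<^bsub>S\<^esub> y \<in> wL1"
  using wL1_add[OF assms(1) wL1_cst[OF assms(2), of "-1"]] assms
  by (simp add: cst_minus_one_smult wL1_carrier M.minus_eq)

lemma wL1_zero [simp]: "\<zero>\<^bsub>S\<^esub> \<in> wL1"
proof -
  have "integrable P (\<lambda>w. wt w * rnorm \<zero>\<^bsub>S\<^esub> w) \<longleftrightarrow> integrable P (\<lambda>w. 0 :: real)"
    using rnorm_zero by (intro integrable_cong_AE) (auto elim: eventually_mono)
  then show ?thesis by (simp add: wL1_def)
qed

lemma wnorm_nonneg: "x \<in> carrier S \<Longrightarrow> 0 \<le> wnorm x"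
  unfolding wnorm_def by (intro integral_nonneg_AE wt_rnorm_nonneg)

lemma wnorm_triangle:
  assumes "x \<in> wL1" "y \<in> wL1"
  shows "wnorm (x \<oplus>\<^bsub>S\<^esub> y) \<le> wnorm x + wnorm y"
proof -
  have "wnorm (x \<oplus>\<^bsub>S\<^esub> y) \<le> (\<integral>w. wt w * rnorm x w + wt w * rnorm y w \<partial>P)"
    unfolding wnorm_def using assms wL1_add[OF assms]
    by (intro integral_mono_AE wt_rnorm_triangle) (auto simp: wL1_def)
  also have "\<dots> = wnorm x + wnorm y"
    unfolding wnorm_def using assms by (intro Bochner_Integration.integral_add) (auto simp: wL1_def)
  finally show ?thesis .
qed

lemma wnorm_cst:
  assumes "x \<in> carrier S"
  shows "wnorm (cst r \<odot>\<^bsub>S\<^esub> x) = \<bar>r\<bar> * wnorm x"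
proof -
  have "wnorm (cst r \<odot>\<^bsub>S\<^esub> x) = (\<integral>w. \<bar>r\<bar> * (wt w * rnorm x w) \<partial>P)"
    unfolding wnorm_def using assms by (intro integral_cong_AE wt_rnorm_cst) measurable
  then show ?thesis by (simp add: wnorm_def)
qed

lemma wnorm_minus_commute:
  assumes "x \<in> carrier S" "y \<in> carrier S"
  shows "wnorm (x \<ominus>\<^bsub>S\<^esub> y) = wnorm (y \<ominus>\<^bsub>S\<^esub> x)"
proof -
  have "y \<ominus>\<^bsub>S\<^esub> x = \<ominus>\<^bsub>S\<^esub> (x \<ominus>\<^bsub>S\<^esub> y)"
    using assms by (simp add: M.minus_add M.minus_eq M.a_comm)
  then show ?thesis using assms wnorm_cst[of "x \<ominus>\<^bsub>S\<^esub> y" "-1"] by (simp add: cst_minus_one_smult)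
qed

lemma wnorm_triangle_minus:
  assumes "x \<in> wL1" "y \<in> wL1" "z \<in> wL1"
  shows "wnorm (x \<ominus>\<^bsub>S\<^esub> z) \<le> wnorm (x \<ominus>\<^bsub>S\<^esub> y) + wnorm (y \<ominus>\<^bsub>S\<^esub> z)"
  using wnorm_triangle[of "x \<ominus>\<^bsub>S\<^esub> y" "y \<ominus>\<^bsub>S\<^esub> z"] assms minus_split[of x y z] by (simp add: wL1_carrier)

lemma fnorm_le_wnorm: "x \<in> wL1 \<Longrightarrow> fnorm x \<le> wnorm x"
  unfolding fnorm_def wnorm_def by (intro integral_mono_AE integrable_fnorm) (auto simp: wL1_def)

lemma bounded_wL1:
  assumes x: "x \<in> carrier S" and "AE w in P. wt w * rnorm x w \<le> C"
  shows "x \<in> wL1" "wnorm x \<le> C"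
proof -
  have *: "integrable P (\<lambda>w. wt w * rnorm x w)"
  proof (rule integrable_const_bound[where B=C])
    show "AE w in P. norm (wt w * rnorm x w) \<le> C"
      using wt_rnorm_nonneg[OF x] assms(2) by eventually_elim auto
  qed (use x in measurable)
  then show "x \<in> wL1" using x by (simp add: wL1_def)
  have "wnorm x \<le> (\<integral>w. C \<partial>P)" unfolding wnorm_def by (intro integral_mono_AE * assms) auto
  then show "wnorm x \<le> C" by (simp add: prob_space)
qed

text \<open>For 0 \<le> u \<le> 2 one has u \<le> 2 * min 1 u. On bounded elements smallness in the
  topology thus becomes smallness in \<open>wnorm\<close>; the bound 2 suits differences of two
  elements bounded by 1.\<close>

lemma wnorm_le_2_fnorm:
  assumes x: "x \<in> carrier S" and b: "AE w in P. wt w * rnorm x w \<le> 2"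
  shows "wnorm x \<le> 2 * fnorm x"
proof -
  have "wnorm x \<le> (\<integral>w. 2 * min 1 (wt w * rnorm x w) \<partial>P)"
    unfolding wnorm_def
  proof (rule integral_mono_AE)
    show "AE w in P. wt w * rnorm x w \<le> 2 * min 1 (wt w * rnorm x w)"
      using b wt_rnorm_nonneg[OF x] by eventually_elim (auto simp: min_def)
  qed (use bounded_wL1(1)[OF assms] integrable_fnorm[OF x] in \<open>auto simp: wL1_def\<close>)
  then show ?thesis by (simp add: fnorm_def)
qed

text \<open>The factor \<bar>r\<bar> alone fails for small r, since a large norm remains truncated
  at 1 after scaling; adding 1 covers this case.\<close>

lemma fnorm_cst_le:
  assumes x: "x \<in> carrier S"
  shows "fnorm (cst r \<odot>\<^bsub>S\<^esub> x) \<le> (1 + \<bar>r\<bar>) * fnorm x"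
proof -
  have "fnorm (cst r \<odot>\<^bsub>S\<^esub> x) \<le> (\<integral>w. (1 + \<bar>r\<bar>) * min 1 (wt w * rnorm x w) \<partial>P)"
    unfolding fnorm_def
  proof (rule integral_mono_AE)
    show "AE w in P. min 1 (wt w * rnorm (cst r \<odot>\<^bsub>S\<^esub> x) w) \<le> (1 + \<bar>r\<bar>) * min 1 (wt w * rnorm x w)"
      using wt_rnorm_cst[OF x, of r] wt_rnorm_nonneg[OF x]
      by eventually_elim (auto simp: min_def algebra_simps)
  qed (use integrable_fnorm x in auto)
  then show ?thesis by (simp add: fnorm_def)
qed

text \<open>With R / 3 \<le> 1 the left integrand stays below the truncation level. The number 3 is
  the later bound for the total mass of a kernel.\<close>

lemma fnorm_cst_ge:
  assumes x: "x \<in> carrier S" and R: "0 \<le> R" "R \<le> 3"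
  shows "R / 3 * fnorm x \<le> fnorm (cst R \<odot>\<^bsub>S\<^esub> x)"
proof -
  have "(\<integral>w. R / 3 * min 1 (wt w * rnorm x w) \<partial>P) \<le> fnorm (cst R \<odot>\<^bsub>S\<^esub> x)"
    unfolding fnorm_def
  proof (rule integral_mono_AE)
    show "AE w in P. R / 3 * min 1 (wt w * rnorm x w) \<le> min 1 (wt w * rnorm (cst R \<odot>\<^bsub>S\<^esub> x) w)"
      using wt_rnorm_cst[OF x, of R] wt_rnorm_nonneg[OF x]
    proof eventually_elim
      case (elim w)
      have "R / 3 * min 1 (wt w * rnorm x w) \<le> 1 * 1" using R elim by (intro mult_mono) auto
      moreover have "R / 3 * min 1 (wt w * rnorm x w) \<le> R * (wt w * rnorm x w)"
        using R elim by (intro mult_mono) auto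
      ultimately show ?case using elim R by (auto simp: mult_ac)
    qed
  qed (use integrable_fnorm x in auto)
  then show ?thesis by (simp add: fnorm_def)
qed

text \<open>Membership and estimate are proved together, because the triangle inequality for
  \<open>wnorm\<close> needs membership at each step of the induction.\<close>

lemma finsum_wL1:
  assumes "finite A" "f \<in> A \<rightarrow> wL1"
  shows "finsum S f A \<in> wL1 \<and> wnorm (finsum S f A) \<le> (\<Sum>a\<in>A. wnorm (f a))"
  using assms
proof (induction rule: finite_induct)
  case empty
  show ?case using wnorm_cst[of "\<zero>\<^bsub>S\<^esub>" 0] by (simp add: cst_zero_smult)
next
  case (insert a A)
  then have *: "f \<in> A \<rightarrow> carrier S" "f a \<in> carrier S" "f a \<in> wL1" "f \<in> A \<rightarrow> wL1" using wL1_carrier by auto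
  then show ?case using insert wnorm_triangle[of "f a" "finsum S f A"] by (auto simp: M.finsum_insert)
qed

end

section \<open>Tagged divisions of an interval\<close>

lemma tagged_division_realE:
  fixes a b :: real
  assumes "p tagged_division_of {a..b}" "(x, K) \<in> p"
  obtains u v where "K = {u..v}" "a \<le> u" "u \<le> x" "x \<le> v" "v \<le> b"
proof -
  obtain u v where "K = cbox u v" using tagged_division_ofD(4)[OF assms] by blast
  moreover have "x \<in> K" "K \<subseteq> {a..b}" using tagged_division_ofD(2,3)[OF assms] by auto
  ultimately show ?thesis using that[of u v] by auto
qed

text \<open>The part of {u..v} inside {c..d} has as length the increment from u to v of the clamp to
  {c..d}, so the sum over the division telescopes.\<close>

lemma sum_measure_Int_tagged_division:
  fixes a b :: real
  assumes p: "p tagged_division_of {a..b}" and "a \<le> c" "c \<le> d" "d \<le> b"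
  shows "(\<Sum>(x, K)\<in>p. measure lborel (K \<inter> {c..d})) = d - c"
proof -
  let ?f = "\<lambda>s. max c (min d s)"
  have "(\<Sum>(x, K)\<in>p. measure lborel (K \<inter> {c..d})) = (\<Sum>(x, K)\<in>p. ?f (Sup K) - ?f (Inf K))"
  proof (rule sum.cong[OF refl], clarify)
    fix x K assume "(x, K) \<in> p"
    then obtain u v where K: "K = {u..v}" "u \<le> x" "x \<le> v" using tagged_division_realE[OF p] by metis
    then have "K \<inter> {c..d} = {max u c..min v d}" "Sup K = v" "Inf K = u" by auto
    then show "measure lborel (K \<inter> {c..d}) = ?f (Sup K) - ?f (Inf K)"
      using K assms by (auto simp: content_real_if)
  qed
  also have "\<dots> = ?f b - ?f a" using assms by (intro additive_tagged_division_1) auto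
  also have "\<dots> = d - c" using assms by auto
  finally show ?thesis .
qed

text \<open>The sum is compared with the telescoping sum of \<open>exp (- max c s)\<close>; a tag differs from the
  right end of its interval by at most 1, which costs a factor \<open>exp 1 \<le> 3\<close>.\<close>

lemma tagged_division_exp_tail:
  assumes p: "p tagged_division_of {0..L}" and c: "0 \<le> c" "c \<le> L"
    and mesh: "\<And>x K. (x, K) \<in> p \<Longrightarrow> measure lborel K \<le> 1"
  shows "(\<Sum>(x, K)\<in>p. measure lborel (K \<inter> {c..L}) * exp (- x)) \<le> 3 * (exp (- c) - exp (- L))"
proof -
  let ?f = "\<lambda>s. - 3 * exp (- max c s)"
  have "(\<Sum>(x, K)\<in>p. measure lborel (K \<inter> {c..L}) * exp (- x)) \<le> (\<Sum>(x, K)\<in>p. ?f (Sup K) - ?f (Inf K))"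
  proof (rule sum_mono, clarify)
    fix x K assume xK: "(x, K) \<in> p"
    then obtain u v where K: "K = {u..v}" "u \<le> x" "x \<le> v" "v \<le> L"
      using tagged_division_realE[OF p] by metis
    then have *: "K \<inter> {c..L} = {max u c..v}" "Sup K = v" "Inf K = u" by auto
    have vu: "v - u \<le> 1" using mesh[OF xK] K by simp
    let ?u = "max c u" and ?v = "max c v"
    have "measure lborel (K \<inter> {c..L}) * exp (- x) \<le> (?v - ?u) * (3 * exp (- ?v))"
    proof (cases "v \<le> c")
      case True
      then show ?thesis using K unfolding * by (auto simp: content_real_if)
    next
      case False
      have "exp (- x) \<le> exp (1 + - v)" using K vu by simp
      also have "\<dots> \<le> 3 * exp (- v)" unfolding exp_add by (intro mult_right_mono exp_le) simp
      finally show ?thesis using False K unfolding * by (auto simp: content_real_if max_def intro!: mult_left_mono)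
    qed
    \<comment> \<open>Convexity in the form 1 + y \<le> exp y, at y =
      \<open>?v - ?u\<close>.\<close>
    also have "\<dots> \<le> 3 * (exp (- ?u) - exp (- ?v))"
    proof -
      have "1 + (?v - ?u) \<le> exp (?v - ?u)" by (rule exp_ge_add_one_self)
      then have "(1 + (?v - ?u)) * exp (- ?v) \<le> exp (?v - ?u) * exp (- ?v)" by (intro mult_right_mono) auto
      also have "\<dots> = exp (- ?u)" by (simp flip: exp_add)
      finally show ?thesis by (simp add: algebra_simps)
    qed
    finally show "measure lborel (K \<inter> {c..L}) * exp (- x) \<le> ?f (Sup K) - ?f (Inf K)"
      by (simp add: *)
  qed
  also have "\<dots> = ?f L - ?f 0" using p c by (intro additive_tagged_division_1) auto
  also have "\<dots> = 3 * (exp (- c) - exp (- L))" using c by simp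
  finally show ?thesis .
qed

text \<open>The sets of divisions below a given mesh are directed downwards (take the minimum of two
  meshes), so a single mesh witnesses each eventual property.\<close>

lemma eventually_riemann_filter:
  "eventually Q (riemann_filter a b) \<longleftrightarrow>
     (\<exists>\<delta>>0. \<forall>p. p tagged_division_of {a..b} \<longrightarrow> (\<forall>(u, k)\<in>p. measure lborel k < \<delta>) \<longrightarrow> Q p)"
proof -
  let ?F = "\<lambda>\<delta>. {p. p tagged_division_of {a..b} \<and> (\<forall>(u, k)\<in>p. measure lborel k < \<delta>)}"
  have mono: "?F (min x y) \<subseteq> ?F x \<inter> ?F y" for x y by fastforce
  have "eventually Q (riemann_filter a b) \<longleftrightarrow> (\<exists>\<delta>\<in>{0<..}. eventually Q (principal (?F \<delta>)))"
    unfolding riemann_filter_def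
  proof (rule eventually_INF_base)
    fix x y :: real assume "x \<in> {0<..}" "y \<in> {0<..}"
    then show "\<exists>z\<in>{0<..}. principal (?F z) \<le> inf (principal (?F x)) (principal (?F y))"
      using mono[of x y] by (intro bexI[of _ "min x y"]) auto
  qed auto
  then show ?thesis unfolding eventually_principal Bex_def mem_Collect_eq greaterThan_iff by (simp add: imp_conjL)
qed

text \<open>Cousin's lemma for a constant gauge: a cell inside a ball of radius \<delta> / 3 is
  shorter than 2 \<delta> / 3.\<close>

lemma tagged_division_fine_exists:
  assumes "\<delta> > 0"
  obtains p where "p tagged_division_of {a..b::real}" "\<And>u k. (u, k) \<in> p \<Longrightarrow> measure lborel k < \<delta>"
proof -
  have "gauge (\<lambda>x::real. ball x (\<delta> / 3))" using assms by (intro gauge_ball) auto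
  then obtain p where p: "p tagged_division_of {a..b}" "(\<lambda>x. ball x (\<delta> / 3)) fine p"
    by (rule fine_division_exists_real)
  have "measure lborel k < \<delta>" if uk: "(u, k) \<in> p" for u k
  proof -
    obtain c d where K: "k = {c..d}" "c \<le> u" "u \<le> d" using tagged_division_realE[OF p(1) uk] by metis
    moreover have "k \<subseteq> ball u (\<delta> / 3)" using fineD[OF p(2) uk] .
    ultimately have "c \<in> ball u (\<delta> / 3)" "d \<in> ball u (\<delta> / 3)" by (metis atLeastAtMost_iff order_refl order_trans subsetD)+
    then show ?thesis using K by (auto simp: dist_real_def simp del: mem_ball) (auto simp: dist_real_def)
  qed
  then show ?thesis using that p(1) by blast
qed

text \<open>Limits along the filter are unique only because of this, so it is what gives the
  \<open>THE\<close> in \<open>riemann_integral\<close> a meaning.\<close>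

lemma riemann_filter_neq_bot: "riemann_filter a b \<noteq> bot"
proof -
  have "\<not> eventually (\<lambda>_. False) (riemann_filter a b)"
    unfolding eventually_riemann_filter
    using tagged_division_fine_exists by (metis (no_types, lifting) case_prodI2)
  then show ?thesis by (simp add: trivial_limit_def)
qed

section \<open>Riemann sums\<close>

context random_normed_module
begin

lemma finsum_swap:
  assumes "finite A" "finite B" "\<And>a b. a \<in> A \<Longrightarrow> b \<in> B \<Longrightarrow> g a b \<in> carrier S"
  shows "finsum S (\<lambda>a. finsum S (g a) B) A = finsum S (\<lambda>b. finsum S (\<lambda>a. g a b) A) B"
  using assms(1,3)
proof (induction rule: finite_induct)
  case empty
  show ?case by (simp add: M.finsum_zero)
next
  case (insert a A)
  have *: "(\<lambda>b. g a b) \<in> B \<rightarrow> carrier S" "(\<lambda>b. finsum S (\<lambda>a. g a b) A) \<in> B \<rightarrow> carrier S"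
    "(\<lambda>a. finsum S (g a) B) \<in> A \<rightarrow> carrier S" "finsum S (g a) B \<in> carrier S"
    using insert.prems by (auto intro!: M.finsum_closed)
  have "finsum S (\<lambda>b. finsum S (\<lambda>a. g a b) (insert a A)) B
      = finsum S (\<lambda>b. g a b \<oplus>\<^bsub>S\<^esub> finsum S (\<lambda>a. g a b) A) B"
    using insert by (intro M.finsum_cong' refl) (auto simp: M.finsum_insert Pi_def intro!: M.finsum_closed)
  also have "\<dots> = finsum S (g a) B \<oplus>\<^bsub>S\<^esub> finsum S (\<lambda>b. finsum S (\<lambda>a. g a b) A) B"
    using * by (intro M.finsum_addf) auto
  also have "\<dots> = finsum S (\<lambda>a. finsum S (g a) B) (insert a A)"
    using insert * by (simp add: M.finsum_insert)
  finally show ?case by simp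
qed

lemma add_minus_cancel:
  assumes "x \<in> carrier S" "y \<in> carrier S"
  shows "(x \<oplus>\<^bsub>S\<^esub> y) \<ominus>\<^bsub>S\<^esub> y = x"
  using assms by (simp add: M.minus_eq M.a_assoc M.r_neg)

lemma finsum_minus:
  assumes "finite A" "f \<in> A \<rightarrow> carrier S" "g \<in> A \<rightarrow> carrier S"
  shows "finsum S (\<lambda>a. f a \<ominus>\<^bsub>S\<^esub> g a) A = finsum S f A \<ominus>\<^bsub>S\<^esub> finsum S g A"
proof -
  have "finsum S f A = finsum S (\<lambda>a. (f a \<ominus>\<^bsub>S\<^esub> g a) \<oplus>\<^bsub>S\<^esub> g a) A"
    using assms by (intro M.finsum_cong' refl) (auto simp: Pi_def M.minus_eq M.a_assoc M.l_neg)
  also have "\<dots> = finsum S (\<lambda>a. f a \<ominus>\<^bsub>S\<^esub> g a) A \<oplus>\<^bsub>S\<^esub> finsum S g A"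
    using assms by (intro M.finsum_addf) (auto simp: Pi_def)
  finally have eq: "finsum S f A = finsum S (\<lambda>a. f a \<ominus>\<^bsub>S\<^esub> g a) A \<oplus>\<^bsub>S\<^esub> finsum S g A" .
  have "finsum S (\<lambda>a. f a \<ominus>\<^bsub>S\<^esub> g a) A \<in> carrier S" "finsum S g A \<in> carrier S"
    using assms by (auto intro!: M.finsum_closed simp: Pi_def)
  then show ?thesis
    unfolding eq by (rule add_minus_cancel[symmetric])
qed

lemma cst_sum_smult:
  assumes "finite A" "x \<in> carrier S"
  shows "cst (\<Sum>a\<in>A. c a) \<odot>\<^bsub>S\<^esub> x = finsum S (\<lambda>a. cst (c a) \<odot>\<^bsub>S\<^esub> x) A"
  using assms(1)
proof (induction rule: finite_induct)
  case empty
  show ?case using cst_zero_smult[OF assms(2)] by simp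
next
  case (insert a A)
  then show ?case using assms(2) by (simp add: cst_add smult_l_distr M.finsum_insert Pi_def)
qed

lemma cst_smult_minus:
  assumes "x \<in> carrier S" "y \<in> carrier S"
  shows "cst r \<odot>\<^bsub>S\<^esub> (x \<ominus>\<^bsub>S\<^esub> y) = cst r \<odot>\<^bsub>S\<^esub> x \<ominus>\<^bsub>S\<^esub> cst r \<odot>\<^bsub>S\<^esub> y"
  using assms by (simp add: M.minus_eq smult_r_distr smult_r_minus)

lemma riemann_sum_cst:
  "riemann_sum P S f p = finsum S (\<lambda>(u, k). cst (measure lborel k) \<odot>\<^bsub>S\<^esub> f u) p"
  by (simp add: riemann_sum_def L0_const_def)

lemma riemann_sum_closed:
  assumes "p tagged_division_of {0..L}" "\<And>t. t \<in> {0..L} \<Longrightarrow> f t \<in> carrier S"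
  shows "riemann_sum P S f p \<in> carrier S"
proof -
  have "f u \<in> carrier S" if "(u, k) \<in> p" for u k
    using tagged_division_ofD(2,3)[OF assms(1) that] assms(2) by blast
  then show ?thesis unfolding riemann_sum_cst by (intro M.finsum_closed) auto
qed

end

section \<open>Comparison of Riemann sums over a common refinement\<close>

context weighted_random_normed_module
begin

text \<open>Both sums are rewritten over the common refinement by the intersections \<open>K \<inter> K'\<close>; the part of
  \<open>{0..L'}\<close> beyond \<open>L\<close> remains.\<close>

lemma wnorm_riemann_sum_diff:
  assumes p: "p tagged_division_of {0..L}" and q: "q tagged_division_of {0..L'}"
    and L: "0 \<le> L" "L \<le> L'"
    and f: "\<And>t. t \<in> {0..L'} \<Longrightarrow> f t \<in> wL1"
  shows "riemann_sum P S f q \<ominus>\<^bsub>S\<^esub> riemann_sum P S f p \<in> wL1"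
    and "wnorm (riemann_sum P S f q \<ominus>\<^bsub>S\<^esub> riemann_sum P S f p) \<le>
      (\<Sum>(t', K')\<in>q. (\<Sum>(t, K)\<in>p. measure lborel (K \<inter> K') * wnorm (f t' \<ominus>\<^bsub>S\<^esub> f t))
         + measure lborel (K' \<inter> {L..L'}) * wnorm (f t'))"
proof -
  have fin: "finite p" "finite q" using p q by auto
  have fp: "f t \<in> wL1" "f t \<in> carrier S" if "(t, K) \<in> p" for t K
    proof -
    have "t \<in> {0..L'}" using tagged_division_ofD(2,3)[OF p that] L by (meson atLeastAtMost_iff order_trans subsetD)
    then show "f t \<in> wL1" "f t \<in> carrier S" using f wL1_carrier by blast+
  qed
  have fq: "f t \<in> wL1" "f t \<in> carrier S" if "(t, K) \<in> q" for t K
    proof -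
    have "t \<in> {0..L'}" using tagged_division_ofD(2,3)[OF q that] L by (meson atLeastAtMost_iff order_trans subsetD)
    then show "f t \<in> wL1" "f t \<in> carrier S" using f wL1_carrier by blast+
  qed
  let ?m = "measure lborel :: real set \<Rightarrow> real"
  have mp: "?m K = (\<Sum>(t', K')\<in>q. ?m (K \<inter> K'))" if tK: "(t, K) \<in> p" for t K
  proof -
    obtain u v where "K = {u..v}" "0 \<le> u" "u \<le> v" "v \<le> L" using tagged_division_realE[OF p tK] by (metis order_trans)
    then show ?thesis using sum_measure_Int_tagged_division[OF q, of u v] L by (simp add: Int_commute)
  qed
  \<comment> \<open>The division \<open>p\<close> reaches only up to \<open>L\<close>; what it
    misses of \<open>K'\<close> is the overhang in {L..L'}. A cell lying beyond \<open>L\<close> is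
    entirely overhang.\<close>
  have mq: "?m K' = (\<Sum>(t, K)\<in>p. ?m (K \<inter> K')) + ?m (K' \<inter> {L..L'})" if tK: "(t', K') \<in> q" for t' K'
  proof -
    obtain u v where K': "K' = {u..v}" "0 \<le> u" "u \<le> v" "v \<le> L'" using tagged_division_realE[OF q tK] by (metis order_trans)
    show ?thesis
    proof (cases "u \<le> L")
      case True
      have "(\<Sum>(t, K)\<in>p. ?m (K \<inter> K')) = (\<Sum>(t, K)\<in>p. ?m (K \<inter> {u..min v L}))"
      proof (rule sum.cong[OF refl], clarify)
        fix t K assume "(t, K) \<in> p"
        then have "K \<subseteq> {0..L}" using tagged_division_ofD(3)[OF p] by blast
        then have "K \<inter> K' = K \<inter> {u..min v L}" using K' by auto
        then show "?m (K \<inter> K') = ?m (K \<inter> {u..min v L})" by simp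
      qed
      also have "\<dots> = min v L - u" using K' True L by (intro sum_measure_Int_tagged_division[OF p]) auto
      finally have "(\<Sum>(t, K)\<in>p. ?m (K \<inter> K')) = min v L - u" .
      moreover have "K' \<inter> {L..L'} = {L..v}" using K' True L by auto
      ultimately show ?thesis using K' by (auto simp: content_real_if)
    next
      case False
      have "(\<Sum>(t, K)\<in>p. ?m (K \<inter> K')) = (\<Sum>(t, K)\<in>p. 0)"
      proof (rule sum.cong[OF refl], clarify)
        fix t K assume "(t, K) \<in> p"
        then have "K \<subseteq> {0..L}" using tagged_division_ofD(3)[OF p] by blast
        then have "K \<inter> K' = {}" using K' False by auto
        then show "?m (K \<inter> K') = 0" by simp
      qed
      moreover have "K' \<inter> {L..L'} = K'" using K' False by auto
      ultimately show ?thesis by simp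
    qed
  qed
  \<comment> \<open>\<open>D\<close> gathers, for one cell of \<open>q\<close>, the differences of
    values over its pieces cut out by \<open>p\<close>; \<open>E\<close> is the contribution of its
    overhang.\<close>
  define D where "D = (\<lambda>(t', K'). finsum S (\<lambda>(t, K). cst (?m (K \<inter> K')) \<odot>\<^bsub>S\<^esub> (f t' \<ominus>\<^bsub>S\<^esub> f t)) p)"
  define E where "E = (\<lambda>(t', K'). cst (?m (K' \<inter> {L..L'})) \<odot>\<^bsub>S\<^esub> f t')"
  have DV: "D b \<in> wL1 \<and> wnorm (D b) \<le> (\<Sum>(t, K)\<in>p. ?m (K \<inter> snd b) * wnorm (f (fst b) \<ominus>\<^bsub>S\<^esub> f t))" if "b \<in> q" for b
  proof -
    obtain t' K' where b: "b = (t', K')" by force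
    have t': "f t' \<in> wL1" "f t' \<in> carrier S" using fq that b by auto
    have "D b \<in> wL1 \<and> wnorm (D b) \<le> (\<Sum>a\<in>p. wnorm ((\<lambda>(t, K). cst (?m (K \<inter> K')) \<odot>\<^bsub>S\<^esub> (f t' \<ominus>\<^bsub>S\<^esub> f t)) a))"
      unfolding D_def b prod.case using fp t' by (intro finsum_wL1 fin) auto
    moreover have "(\<Sum>a\<in>p. wnorm ((\<lambda>(t, K). cst (?m (K \<inter> K')) \<odot>\<^bsub>S\<^esub> (f t' \<ominus>\<^bsub>S\<^esub> f t)) a))
        = (\<Sum>(t, K)\<in>p. ?m (K \<inter> K') * wnorm (f t' \<ominus>\<^bsub>S\<^esub> f t))"
      using fp t' by (intro sum.cong refl) (auto simp: wnorm_cst)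
    ultimately show ?thesis by (simp add: b)
  qed
  have EV: "E b \<in> wL1" "wnorm (E b) = ?m (snd b \<inter> {L..L'}) * wnorm (f (fst b))" if "b \<in> q" for b
    using fq that by (auto simp: E_def wnorm_cst split: prod.splits)
  have c1: "D b \<in> carrier S" "E b \<in> carrier S" if "b \<in> q" for b
    using DV EV that wL1_carrier by auto
  have D: "D b = finsum S (\<lambda>(t, K). cst (?m (K \<inter> snd b)) \<odot>\<^bsub>S\<^esub> f (fst b)) p
      \<ominus>\<^bsub>S\<^esub> finsum S (\<lambda>(t, K). cst (?m (K \<inter> snd b)) \<odot>\<^bsub>S\<^esub> f t) p" if "b \<in> q" for b
  proof -
    have t': "f (fst b) \<in> carrier S" using fq that by (metis prod.collapse)
    have "D b = finsum S (\<lambda>a. (\<lambda>(t, K). cst (?m (K \<inter> snd b)) \<odot>\<^bsub>S\<^esub> f (fst b)) a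
      \<ominus>\<^bsub>S\<^esub> (\<lambda>(t, K). cst (?m (K \<inter> snd b)) \<odot>\<^bsub>S\<^esub> f t) a) p"
      unfolding D_def using fp t'
      by (cases b, simp, intro M.finsum_cong' refl) (auto simp: cst_smult_minus)
    also have "\<dots> = finsum S (\<lambda>(t, K). cst (?m (K \<inter> snd b)) \<odot>\<^bsub>S\<^esub> f (fst b)) p
      \<ominus>\<^bsub>S\<^esub> finsum S (\<lambda>(t, K). cst (?m (K \<inter> snd b)) \<odot>\<^bsub>S\<^esub> f t) p"
      using fp t' by (intro finsum_minus fin) auto
    finally show ?thesis .
  qed
  define X where "X = (\<lambda>b. finsum S (\<lambda>(t, K). cst (?m (K \<inter> snd b)) \<odot>\<^bsub>S\<^esub> f (fst b)) p)"
  define Y :: "real \<times> real set \<Rightarrow> 's" where "Y = (\<lambda>b. finsum S (\<lambda>(t, K). cst (?m (K \<inter> snd b)) \<odot>\<^bsub>S\<^esub> f t) p)"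
  have XY: "X b \<in> carrier S" "Y b \<in> carrier S" if "b \<in> q" for b
  proof -
    have "f (fst b) \<in> carrier S" using fq that by (metis prod.collapse)
    then show "X b \<in> carrier S" "Y b \<in> carrier S"
      using fp unfolding X_def Y_def by (auto intro!: M.finsum_closed)
  qed
  have "riemann_sum P S f q = finsum S (\<lambda>b. X b \<oplus>\<^bsub>S\<^esub> E b) q"
    unfolding riemann_sum_cst
  proof (intro M.finsum_cong' refl)
    show "(\<lambda>b. X b \<oplus>\<^bsub>S\<^esub> E b) \<in> q \<rightarrow> carrier S" using XY c1 by auto
    fix b assume b: "b \<in> q"
    then have t': "f (fst b) \<in> carrier S" using fq by (metis prod.collapse)
    have "X b = cst (\<Sum>(t, K)\<in>p. ?m (K \<inter> snd b)) \<odot>\<^bsub>S\<^esub> f (fst b)"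
      unfolding X_def using cst_sum_smult[OF fin(1) t', of "\<lambda>(t, K). ?m (K \<inter> snd b)"]
      by (simp add: case_prod_unfold)
    then show "(case b of (u, k) \<Rightarrow> cst (?m k) \<odot>\<^bsub>S\<^esub> f u) = X b \<oplus>\<^bsub>S\<^esub> E b"
      using mq[of "fst b" "snd b"] b t' by (simp add: E_def case_prod_unfold cst_add smult_l_distr)
  qed
  also have "\<dots> = finsum S X q \<oplus>\<^bsub>S\<^esub> finsum S E q"
    using XY c1 by (intro M.finsum_addf) auto
  finally have Rq: "riemann_sum P S f q = finsum S X q \<oplus>\<^bsub>S\<^esub> finsum S E q" .
  have "riemann_sum P S f p = finsum S (\<lambda>a. finsum S (\<lambda>b. cst (?m (snd a \<inter> snd b)) \<odot>\<^bsub>S\<^esub> f (fst a)) q) p"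
    unfolding riemann_sum_cst
  proof (intro M.finsum_cong' refl)
    show "(\<lambda>a. finsum S (\<lambda>b. cst (?m (snd a \<inter> snd b)) \<odot>\<^bsub>S\<^esub> f (fst a)) q) \<in> p \<rightarrow> carrier S"
      using fp by (auto intro!: M.finsum_closed)
    fix a assume a: "a \<in> p"
    then have t: "f (fst a) \<in> carrier S" using fp by (metis prod.collapse)
    then show "(case a of (u, k) \<Rightarrow> cst (?m k) \<odot>\<^bsub>S\<^esub> f u) = finsum S (\<lambda>b. cst (?m (snd a \<inter> snd b)) \<odot>\<^bsub>S\<^esub> f (fst a)) q"
      using mp[of "fst a" "snd a"] a by (simp add: case_prod_unfold cst_sum_smult[OF fin(2) t])
  qed
  \<comment> \<open>After the exchange both Riemann sums are indexed by \<open>q\<close>, so they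
    can be subtracted cell by cell.\<close>
  also have "\<dots> = finsum S (\<lambda>b. finsum S (\<lambda>a. cst (?m (snd a \<inter> snd b)) \<odot>\<^bsub>S\<^esub> f (fst a)) p) q"
    using fp by (intro finsum_swap fin) auto
  also have "\<dots> = finsum S Y q" by (simp add: Y_def case_prod_unfold)
  finally have Rp: "riemann_sum P S f p = finsum S Y q" .
  have c2: "finsum S X q \<in> carrier S" "finsum S Y q \<in> carrier S" "finsum S E q \<in> carrier S"
    using XY c1 by (auto intro!: M.finsum_closed)
  have "finsum S D q = finsum S (\<lambda>b. X b \<ominus>\<^bsub>S\<^esub> Y b) q"
    using D XY unfolding X_def Y_def by (intro M.finsum_cong' refl) auto
  also have "\<dots> = finsum S X q \<ominus>\<^bsub>S\<^esub> finsum S Y q"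
    using XY by (intro finsum_minus fin) auto
  finally have Dq: "finsum S D q = finsum S X q \<ominus>\<^bsub>S\<^esub> finsum S Y q" .
  have "riemann_sum P S f q \<ominus>\<^bsub>S\<^esub> riemann_sum P S f p = finsum S D q \<oplus>\<^bsub>S\<^esub> finsum S E q"
    unfolding Rq Rp Dq using c2 by (simp add: M.minus_eq M.a_ac)
  also have "\<dots> = finsum S (\<lambda>b. D b \<oplus>\<^bsub>S\<^esub> E b) q"
    using c1 by (intro M.finsum_addf[symmetric]) auto
  finally have *: "riemann_sum P S f q \<ominus>\<^bsub>S\<^esub> riemann_sum P S f p = finsum S (\<lambda>b. D b \<oplus>\<^bsub>S\<^esub> E b) q" .
  have **: "finsum S (\<lambda>b. D b \<oplus>\<^bsub>S\<^esub> E b) q \<in> wL1 \<and> wnorm (finsum S (\<lambda>b. D b \<oplus>\<^bsub>S\<^esub> E b) q) \<le> (\<Sum>b\<in>q. wnorm (D b \<oplus>\<^bsub>S\<^esub> E b))"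
    using DV EV by (intro finsum_wL1 fin) auto
  then show "riemann_sum P S f q \<ominus>\<^bsub>S\<^esub> riemann_sum P S f p \<in> wL1" by (simp add: *)
  have "(\<Sum>b\<in>q. wnorm (D b \<oplus>\<^bsub>S\<^esub> E b)) \<le>
      (\<Sum>b\<in>q. (\<Sum>(t, K)\<in>p. ?m (K \<inter> snd b) * wnorm (f (fst b) \<ominus>\<^bsub>S\<^esub> f t)) + ?m (snd b \<inter> {L..L'}) * wnorm (f (fst b)))"
    using DV EV wnorm_triangle by (intro sum_mono) (smt (verit))
  then show "wnorm (riemann_sum P S f q \<ominus>\<^bsub>S\<^esub> riemann_sum P S f p) \<le>
      (\<Sum>(t', K')\<in>q. (\<Sum>(t, K)\<in>p. ?m (K \<inter> K') * wnorm (f t' \<ominus>\<^bsub>S\<^esub> f t)) + ?m (K' \<inter> {L..L'}) * wnorm (f t'))"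
    using ** unfolding * by (simp add: case_prod_unfold)
qed

text \<open>The oscillation \<epsilon> is weighted by the total overlap of the two divisions, which
  is \<open>L\<close>; the overhang is a Riemann sum of exp (- t) over {L..L'}.\<close>

lemma wnorm_riemann_sum_diff_le:
  assumes p: "p tagged_division_of {0..L}" and q: "q tagged_division_of {0..L'}"
    and L: "0 \<le> L" "L \<le> L'"
    and f: "\<And>t. t \<in> {0..L'} \<Longrightarrow> f t \<in> wL1"
    and bound: "\<And>t. t \<in> {0..L'} \<Longrightarrow> wnorm (f t) \<le> exp (- t)"
    and mesh: "\<And>x K. (x, K) \<in> p \<Longrightarrow> measure lborel K < \<delta>" "\<And>x K. (x, K) \<in> q \<Longrightarrow> measure lborel K < \<delta>"
    and "\<delta> \<le> 1"
    and unif: "\<And>s t. s \<in> {0..L'} \<Longrightarrow> t \<in> {0..L'} \<Longrightarrow> \<bar>s - t\<bar> < 2 * \<delta> \<Longrightarrow> wnorm (f s \<ominus>\<^bsub>S\<^esub> f t) \<le> \<epsilon>"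
  shows "wnorm (riemann_sum P S f q \<ominus>\<^bsub>S\<^esub> riemann_sum P S f p) \<le> \<epsilon> * L + 3 * (exp (- L) - exp (- L'))"
proof -
  let ?m = "measure lborel :: real set \<Rightarrow> real"
  have fin: "finite p" "finite q" using p q by auto
  \<comment> \<open>Two cells shorter than \<delta> with a common point have tags less than 2
    \<delta> apart; disjoint cells contribute 0.\<close>
  have tm: "?m (K \<inter> K') * wnorm (f t' \<ominus>\<^bsub>S\<^esub> f t) \<le> ?m (K \<inter> K') * \<epsilon>"
    if tK: "(t, K) \<in> p" "(t', K') \<in> q" for t K t' K'
  proof (cases "K \<inter> K' = {}")
    case False
    obtain u v where K: "K = {u..v}" "0 \<le> u" "u \<le> t" "t \<le> v" "v \<le> L" by (rule tagged_division_realE[OF p tK(1)])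
    obtain u' v' where K': "K' = {u'..v'}" "0 \<le> u'" "u' \<le> t'" "t' \<le> v'" "v' \<le> L'" by (rule tagged_division_realE[OF q tK(2)])
    have "v - u < \<delta>" "v' - u' < \<delta>" using mesh(1)[OF tK(1)] mesh(2)[OF tK(2)] K K' by auto
    moreover obtain z where "z \<in> K" "z \<in> K'" using False by auto
    ultimately have "\<bar>t' - t\<bar> < 2 * \<delta>" using K K' by auto
    then show ?thesis using K K' L by (intro mult_left_mono unif) auto
  qed simp
  have "wnorm (riemann_sum P S f q \<ominus>\<^bsub>S\<^esub> riemann_sum P S f p) \<le>
      (\<Sum>(t', K')\<in>q. (\<Sum>(t, K)\<in>p. ?m (K \<inter> K') * wnorm (f t' \<ominus>\<^bsub>S\<^esub> f t)) + ?m (K' \<inter> {L..L'}) * wnorm (f t'))"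
    by (rule wnorm_riemann_sum_diff(2)[OF p q L f])
  also have "\<dots> \<le> (\<Sum>(t', K')\<in>q. (\<Sum>(t, K)\<in>p. ?m (K \<inter> K') * \<epsilon>) + ?m (K' \<inter> {L..L'}) * exp (- t'))"
  proof (rule sum_mono, clarify)
    fix t' K' assume tK: "(t', K') \<in> q"
    then have "t' \<in> {0..L'}" using tagged_division_ofD(2,3)[OF q tK] by blast
    then show "(\<Sum>(t, K)\<in>p. ?m (K \<inter> K') * wnorm (f t' \<ominus>\<^bsub>S\<^esub> f t)) + ?m (K' \<inter> {L..L'}) * wnorm (f t')
       \<le> (\<Sum>(t, K)\<in>p. ?m (K \<inter> K') * \<epsilon>) + ?m (K' \<inter> {L..L'}) * exp (- t')"
      using tK by (intro add_mono sum_mono mult_left_mono bound) (auto intro: tm)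
  qed
  also have "\<dots> = \<epsilon> * (\<Sum>(t', K')\<in>q. \<Sum>(t, K)\<in>p. ?m (K \<inter> K')) + (\<Sum>(t', K')\<in>q. ?m (K' \<inter> {L..L'}) * exp (- t'))"
    by (simp add: case_prod_unfold sum.distrib sum_distrib_left mult.commute)
  \<comment> \<open>With the sum over \<open>q\<close> inside, each cell of \<open>p\<close> is
    fully covered and contributes its own length, in total \<open>L\<close>.\<close>
  also have "(\<Sum>(t', K')\<in>q. \<Sum>(t, K)\<in>p. ?m (K \<inter> K')) = (\<Sum>(t, K)\<in>p. \<Sum>(t', K')\<in>q. ?m (K \<inter> K'))"
    by (simp add: case_prod_unfold) (rule sum.swap)
  also have "\<dots> = (\<Sum>(t, K)\<in>p. ?m (K \<inter> {0..L}))"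
  proof (rule sum.cong[OF refl], clarify)
    fix t K assume "(t, K) \<in> p"
    then obtain u v where "K = {u..v}" "0 \<le> u" "u \<le> v" "v \<le> L" using tagged_division_realE[OF p] by (metis order_trans)
    then show "(\<Sum>(t', K')\<in>q. ?m (K \<inter> K')) = ?m (K \<inter> {0..L})"
      using sum_measure_Int_tagged_division[OF q, of u v] L by (simp add: Int_commute)
  qed
  also have "\<dots> = L" using sum_measure_Int_tagged_division[OF p, of 0 L] L by simp
  also have "\<epsilon> * L + (\<Sum>(t', K')\<in>q. ?m (K' \<inter> {L..L'}) * exp (- t')) \<le> \<epsilon> * L + 3 * (exp (- L) - exp (- L'))"
    using mesh(2) \<open>\<delta> \<le> 1\<close> L by (intro add_left_mono tagged_division_exp_tail[OF q]) (auto intro: less_imp_le less_le_trans)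
  finally show ?thesis .
qed

end

lemma tagged_division_tag:
  fixes L :: real
  assumes "p tagged_division_of {0..L}" "(u, k) \<in> p"
  shows "0 \<le> u" "u \<le> L"
  using tagged_division_ofD(2,3)[OF assms] by auto

section \<open>Linearity of Riemann sums in the integrand\<close>

context random_normed_module
begin

lemma riemann_sum_cong:
  assumes p: "p tagged_division_of {0..L}"
    and "\<And>t. 0 \<le> t \<Longrightarrow> g t \<in> carrier S" "\<And>t. 0 \<le> t \<Longrightarrow> f t = g t"
  shows "riemann_sum P S f p = riemann_sum P S g p"
  unfolding riemann_sum_cst using assms(2,3) tagged_division_tag[OF p]
  by (intro M.finsum_cong' refl) auto

lemma riemann_sum_add:
  assumes p: "p tagged_division_of {0..L}"
    and f: "\<And>t. 0 \<le> t \<Longrightarrow> f t \<in> carrier S" and g: "\<And>t. 0 \<le> t \<Longrightarrow> g t \<in> carrier S"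
  shows "riemann_sum P S (\<lambda>t. f t \<oplus>\<^bsub>S\<^esub> g t) p = riemann_sum P S f p \<oplus>\<^bsub>S\<^esub> riemann_sum P S g p"
proof -
  have "riemann_sum P S (\<lambda>t. f t \<oplus>\<^bsub>S\<^esub> g t) p = finsum S (\<lambda>a.
      (\<lambda>(u, k). cst (measure lborel k) \<odot>\<^bsub>S\<^esub> f u) a \<oplus>\<^bsub>S\<^esub> (\<lambda>(u, k). cst (measure lborel k) \<odot>\<^bsub>S\<^esub> g u) a) p"
    unfolding riemann_sum_cst using tagged_division_tag[OF p] f g
    by (intro M.finsum_cong' refl) (auto simp: smult_r_distr)
  also have "\<dots> = riemann_sum P S f p \<oplus>\<^bsub>S\<^esub> riemann_sum P S g p"
    unfolding riemann_sum_cst using tagged_division_tag[OF p] f g by (intro M.finsum_addf) auto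
  finally show ?thesis .
qed

lemma riemann_sum_minus:
  assumes p: "p tagged_division_of {0..L}"
    and f: "\<And>t. 0 \<le> t \<Longrightarrow> f t \<in> carrier S" and g: "\<And>t. 0 \<le> t \<Longrightarrow> g t \<in> carrier S"
  shows "riemann_sum P S (\<lambda>t. f t \<ominus>\<^bsub>S\<^esub> g t) p = riemann_sum P S f p \<ominus>\<^bsub>S\<^esub> riemann_sum P S g p"
proof -
  have "riemann_sum P S (\<lambda>t. f t \<ominus>\<^bsub>S\<^esub> g t) p = finsum S (\<lambda>a.
      (\<lambda>(u, k). cst (measure lborel k) \<odot>\<^bsub>S\<^esub> f u) a \<ominus>\<^bsub>S\<^esub> (\<lambda>(u, k). cst (measure lborel k) \<odot>\<^bsub>S\<^esub> g u) a) p"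
    unfolding riemann_sum_cst using tagged_division_tag[OF p] f g
    by (intro M.finsum_cong' refl) (auto simp: cst_smult_minus)
  also have "\<dots> = riemann_sum P S f p \<ominus>\<^bsub>S\<^esub> riemann_sum P S g p"
    unfolding riemann_sum_cst using tagged_division_tag[OF p] f g p by (intro finsum_minus) auto
  finally show ?thesis .
qed

lemma riemann_sum_smult:
  assumes p: "p tagged_division_of {0..L}"
    and f: "\<And>t. 0 \<le> t \<Longrightarrow> f t \<in> carrier S"
  shows "riemann_sum P S (\<lambda>t. cst r \<odot>\<^bsub>S\<^esub> f t) p = cst r \<odot>\<^bsub>S\<^esub> riemann_sum P S f p"
proof -
  have "cst r \<odot>\<^bsub>S\<^esub> riemann_sum P S f p
      = finsum S (\<lambda>a. cst r \<odot>\<^bsub>S\<^esub> (\<lambda>(u, k). cst (measure lborel k) \<odot>\<^bsub>S\<^esub> f u) a) p"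
    unfolding riemann_sum_cst using tagged_division_tag[OF p] f p by (intro finsum_smult_ldistr) auto
  also have "\<dots> = riemann_sum P S (\<lambda>t. cst r \<odot>\<^bsub>S\<^esub> f t) p"
    unfolding riemann_sum_cst using tagged_division_tag[OF p] f
    by (intro M.finsum_cong' refl) (auto simp flip: smult_assoc1 cst_mult simp: mult.commute)
  finally show ?thesis by simp
qed

text \<open>Reduces the comparison of a kernel with a fixed element to a scalar Riemann sum, the
  mass \<open>R\<close> of the kernel below.\<close>

lemma riemann_sum_const:
  assumes p: "p tagged_division_of {0..L}" and x: "x \<in> carrier S"
  shows "riemann_sum P S (\<lambda>t. cst (\<phi> t) \<odot>\<^bsub>S\<^esub> x) p
    = cst (\<Sum>(t, k)\<in>p. measure lborel k * \<phi> t) \<odot>\<^bsub>S\<^esub> x"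
proof -
  have "riemann_sum P S (\<lambda>t. cst (\<phi> t) \<odot>\<^bsub>S\<^esub> x) p
      = finsum S (\<lambda>a. cst ((\<lambda>(t, k). measure lborel k * \<phi> t) a) \<odot>\<^bsub>S\<^esub> x) p"
    unfolding riemann_sum_cst using x
    by (intro M.finsum_cong' refl) (auto simp flip: smult_assoc1 cst_mult)
  also have "\<dots> = cst (\<Sum>(t, k)\<in>p. measure lborel k * \<phi> t) \<odot>\<^bsub>S\<^esub> x"
    using p x by (intro cst_sum_smult[symmetric]) auto
  finally show ?thesis .
qed

end

section \<open>Continuity in the weighted norm and existence of the integrals\<close>

context weighted_random_normed_module
begin

lemma wnorm_riemann_sum_le:
  assumes p: "p tagged_division_of {0..L}"
    and f: "\<And>t. 0 \<le> t \<Longrightarrow> f t \<in> wL1"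
  shows "riemann_sum P S f p \<in> wL1"
    and "wnorm (riemann_sum P S f p) \<le> (\<Sum>(t, k)\<in>p. measure lborel k * wnorm (f t))"
proof -
  have *: "riemann_sum P S f p \<in> wL1 \<and> wnorm (riemann_sum P S f p)
      \<le> (\<Sum>a\<in>p. wnorm ((\<lambda>(u, k). cst (measure lborel k) \<odot>\<^bsub>S\<^esub> f u) a))"
    unfolding riemann_sum_cst using p f tagged_division_tag[OF p] by (intro finsum_wL1) auto
  have "(\<Sum>a\<in>p. wnorm ((\<lambda>(u, k). cst (measure lborel k) \<odot>\<^bsub>S\<^esub> f u) a)) = (\<Sum>(t, k)\<in>p. measure lborel k * wnorm (f t))"
    using f tagged_division_tag[OF p] wL1_carrier by (intro sum.cong refl) (auto simp: wnorm_cst)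
  then show "riemann_sum P S f p \<in> wL1" "wnorm (riemann_sum P S f p) \<le> (\<Sum>(t, k)\<in>p. measure lborel k * wnorm (f t))"
    using * by auto
qed

lemma eventually_fnorm_less:
  assumes "limitin (eps_lambda_topology P S nrm) f l F" "\<epsilon> > 0"
  shows "eventually (\<lambda>x. fnorm (f x \<ominus>\<^bsub>S\<^esub> l) < \<epsilon>) F"
  using assms by (auto simp: limitin_eps_lambda elim: allE[of _ \<epsilon>] eventually_mono)

definition wnorm_continuous :: "(real \<Rightarrow> 's) \<Rightarrow> bool" where
  "wnorm_continuous f \<longleftrightarrow> (\<forall>t\<ge>0. f t \<in> wL1) \<and>
     (\<forall>t\<ge>0. \<forall>\<epsilon>>0. \<exists>\<delta>>0. \<forall>s\<ge>0. \<bar>s - t\<bar> < \<delta> \<longrightarrow> wnorm (f s \<ominus>\<^bsub>S\<^esub> f t) < \<epsilon>)"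

lemma wnorm_continuousD:
  assumes "wnorm_continuous f"
  shows "0 \<le> t \<Longrightarrow> f t \<in> wL1" "0 \<le> t \<Longrightarrow> f t \<in> carrier S"
    and "0 \<le> t \<Longrightarrow> \<epsilon> > 0 \<Longrightarrow> \<exists>\<delta>>0. \<forall>s\<ge>0. \<bar>s - t\<bar> < \<delta> \<longrightarrow> wnorm (f s \<ominus>\<^bsub>S\<^esub> f t) < \<epsilon>"
  using assms wL1_carrier by (auto simp: wnorm_continuous_def)

text \<open>The Heine-Cantor theorem: a Lebesgue number of the cover by balls of continuity puts
  \<open>s\<close> and \<open>t\<close> into one such ball, whose centre is compared with
  both.\<close>

lemma wnorm_uniformly_continuous:
  assumes f: "wnorm_continuous f" and "\<epsilon> > 0"
  obtains \<delta> where "\<delta> > 0"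
    "\<And>s t. s \<in> {0..L} \<Longrightarrow> t \<in> {0..L} \<Longrightarrow> \<bar>s - t\<bar> < \<delta> \<Longrightarrow> wnorm (f s \<ominus>\<^bsub>S\<^esub> f t) \<le> \<epsilon>"
proof -
  have "\<forall>z\<in>{0..L}. \<exists>\<delta>>0. \<forall>s\<ge>0. \<bar>s - z\<bar> < \<delta> \<longrightarrow> wnorm (f s \<ominus>\<^bsub>S\<^esub> f z) < \<epsilon> / 2"
    using wnorm_continuousD(3)[OF f, of _ "\<epsilon> / 2"] assms(2) by auto
  then obtain d where d: "\<And>z. z \<in> {0..L} \<Longrightarrow> d z > 0"
    "\<And>z s. z \<in> {0..L} \<Longrightarrow> 0 \<le> s \<Longrightarrow> \<bar>s - z\<bar> < d z \<Longrightarrow> wnorm (f s \<ominus>\<^bsub>S\<^esub> f z) < \<epsilon> / 2"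
    by metis
  have "{0..L} \<subseteq> \<Union> ((\<lambda>z. ball z (d z)) ` {0..L})" using d(1) by force
  then obtain e where e: "e > 0" "\<And>x. x \<in> {0..L} \<Longrightarrow> \<exists>G\<in>(\<lambda>z. ball z (d z)) ` {0..L}. ball x e \<subseteq> G"
    using Heine_Borel_lemma[of "{0..L}" "(\<lambda>z. ball z (d z)) ` {0..L}"] by (metis (no_types, lifting) compact_Icc image_iff open_ball)
  have "wnorm (f s \<ominus>\<^bsub>S\<^esub> f t) \<le> \<epsilon>" if st: "s \<in> {0..L}" "t \<in> {0..L}" "\<bar>s - t\<bar> < e" for s t
  proof -
    obtain z where z: "z \<in> {0..L}" "ball s e \<subseteq> ball z (d z)" using e(2)[OF st(1)] by auto
    have "s \<in> ball z (d z)" "t \<in> ball z (d z)" using z(2) st e(1) by (auto simp: dist_real_def subset_iff)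
    then have 1: "wnorm (f s \<ominus>\<^bsub>S\<^esub> f z) < \<epsilon> / 2" "wnorm (f t \<ominus>\<^bsub>S\<^esub> f z) < \<epsilon> / 2"
      using d(2)[OF z(1)] st by (auto simp: dist_real_def abs_minus_commute)
    have wL1: "f s \<in> wL1" "f t \<in> wL1" "f z \<in> wL1" using st z wnorm_continuousD(1)[OF f] by auto
    show ?thesis using wnorm_triangle_minus[OF wL1(1,3,2)] wnorm_minus_commute[of "f z" "f t"] wL1 wL1_carrier 1 by auto
  qed
  then show ?thesis using that e(1) by blast
qed

text \<open>Rate 1 and constant 1 suffice for all integrands that occur, since exp (- (n * t)) \<le>
  exp (- t) for n \<ge> 1.\<close>

definition damped :: "(real \<Rightarrow> 's) \<Rightarrow> bool" where
  "damped f \<longleftrightarrow> wnorm_continuous f \<and> (\<forall>t\<ge>0. wnorm (f t) \<le> exp (- t))"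

lemma riemann_sums_close:
  assumes f: "damped f" and L: "0 \<le> L" "L \<le> L'" and "\<epsilon> > 0"
  obtains \<delta> where "\<delta> > 0"
    "\<And>p q. p tagged_division_of {0..L} \<Longrightarrow> q tagged_division_of {0..L'} \<Longrightarrow>
       (\<forall>(x, K)\<in>p. measure lborel K < \<delta>) \<Longrightarrow> (\<forall>(x, K)\<in>q. measure lborel K < \<delta>) \<Longrightarrow>
       fnorm (riemann_sum P S f q \<ominus>\<^bsub>S\<^esub> riemann_sum P S f p) \<le> \<epsilon> + 3 * (exp (- L) - exp (- L'))"
proof -
  have fc: "wnorm_continuous f" and fb: "\<And>t. 0 \<le> t \<Longrightarrow> wnorm (f t) \<le> exp (- t)"
    using f by (auto simp: damped_def)
  \<comment> \<open>The oscillation is multiplied by \<open>L\<close>; dividing by L + 1 also covers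
    L = 0.\<close>
  have e: "\<epsilon> / (L + 1) > 0" using assms by simp
  obtain d where d: "d > 0"
    "\<And>s t. s \<in> {0..L'} \<Longrightarrow> t \<in> {0..L'} \<Longrightarrow> \<bar>s - t\<bar> < d \<Longrightarrow> wnorm (f s \<ominus>\<^bsub>S\<^esub> f t) \<le> \<epsilon> / (L + 1)"
    using wnorm_uniformly_continuous[OF fc e, of L'] by blast
  \<comment> \<open>Half of \<open>d\<close>, because tags of overlapping cells may be almost 2
    \<delta> apart; the cap 1 is required by the exponential tail estimate.\<close>
  define \<delta> where "\<delta> = min 1 (d / 2)"
  have "fnorm (riemann_sum P S f q \<ominus>\<^bsub>S\<^esub> riemann_sum P S f p) \<le> \<epsilon> + 3 * (exp (- L) - exp (- L'))"
    if p: "p tagged_division_of {0..L}" and q: "q tagged_division_of {0..L'}"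
      and mp: "\<forall>(x, K)\<in>p. measure lborel K < \<delta>" and mq: "\<forall>(x, K)\<in>q. measure lborel K < \<delta>" for p q
  proof -
    have "fnorm (riemann_sum P S f q \<ominus>\<^bsub>S\<^esub> riemann_sum P S f p) \<le> wnorm (riemann_sum P S f q \<ominus>\<^bsub>S\<^esub> riemann_sum P S f p)"
      using wnorm_riemann_sum_le(1)[OF p] wnorm_riemann_sum_le(1)[OF q] wnorm_continuousD(1)[OF fc]
      by (intro fnorm_le_wnorm wL1_minus) auto
    also have "\<dots> \<le> \<epsilon> / (L + 1) * L + 3 * (exp (- L) - exp (- L'))"
    proof (rule wnorm_riemann_sum_diff_le[OF p q L, where \<delta>=\<delta>])
      show "wnorm (f s \<ominus>\<^bsub>S\<^esub> f t) \<le> \<epsilon> / (L + 1)" if "s \<in> {0..L'}" "t \<in> {0..L'}" "\<bar>s - t\<bar> < 2 * \<delta>" for s t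
        using that by (intro d(2)) (auto simp: \<delta>_def)
    qed (use mp mq fb wnorm_continuousD(1)[OF fc] in \<open>auto simp: \<delta>_def\<close>)
    also have "\<epsilon> / (L + 1) * L \<le> \<epsilon>" using assms by (simp add: field_simps)
    finally show ?thesis by simp
  qed
  then show ?thesis using that[of \<delta>] d(1) by (auto simp: \<delta>_def)
qed

text \<open>Completeness speaks of sequences, so divisions of mesh below 1 / (n + 1) supply the
  limit; the Cauchy estimate, uniform over fine divisions, then carries it to the whole
  filter.\<close>

lemma riemann_integral_exists:
  assumes comp: "eps_lambda_complete P S nrm" and f: "damped f" and L: "0 \<le> L"
  shows "limitin (eps_lambda_topology P S nrm) (riemann_sum P S f) (riemann_integral P S nrm f 0 L)
    (riemann_filter 0 L)"
proof -
  let ?R = "riemann_sum P S f"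
  have close: "\<exists>\<delta>>0. \<forall>p q. p tagged_division_of {0..L} \<longrightarrow> q tagged_division_of {0..L} \<longrightarrow>
       (\<forall>(x, K)\<in>p. measure lborel K < \<delta>) \<longrightarrow> (\<forall>(x, K)\<in>q. measure lborel K < \<delta>) \<longrightarrow>
       fnorm (?R q \<ominus>\<^bsub>S\<^esub> ?R p) < \<epsilon>" if pos: "\<epsilon> > 0" for \<epsilon>
  proof -
    have e: "\<epsilon> / 2 > 0" using pos by simp
    obtain \<delta> where \<delta>: "\<delta> > 0"
      "\<And>p q. p tagged_division_of {0..L} \<Longrightarrow> q tagged_division_of {0..L} \<Longrightarrow>
       (\<forall>(x, K)\<in>p. measure lborel K < \<delta>) \<Longrightarrow> (\<forall>(x, K)\<in>q. measure lborel K < \<delta>) \<Longrightarrow>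
       fnorm (?R q \<ominus>\<^bsub>S\<^esub> ?R p) \<le> \<epsilon> / 2 + 3 * (exp (- L) - exp (- L))"
      using riemann_sums_close[OF f L order_refl e] by blast
    show ?thesis
    proof (intro exI[of _ \<delta>] conjI allI impI \<delta>(1))
      fix p q
      assume "p tagged_division_of {0..L}" "q tagged_division_of {0..L}"
        "\<forall>(x, K)\<in>p. measure lborel K < \<delta>" "\<forall>(x, K)\<in>q. measure lborel K < \<delta>"
      from \<delta>(2)[OF this] show "fnorm (?R q \<ominus>\<^bsub>S\<^esub> ?R p) < \<epsilon>" using pos by simp
    qed
  qed
  have Rc: "?R p \<in> carrier S" if "p tagged_division_of {0..L}" for p
    using riemann_sum_closed[OF that] f wnorm_continuousD(2) by (auto simp: damped_def)
  have "\<forall>n. \<exists>p. p tagged_division_of {0..L} \<and> (\<forall>(x, K)\<in>p. measure lborel K < 1 / real (Suc n))"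
  proof
    fix n
    obtain p where "p tagged_division_of {0..L}" "\<And>u k. (u, k) \<in> p \<Longrightarrow> measure lborel k < 1 / real (Suc n)"
      using tagged_division_fine_exists[of "1 / real (Suc n)" 0 L] by auto
    then show "\<exists>p. p tagged_division_of {0..L} \<and> (\<forall>(x, K)\<in>p. measure lborel K < 1 / real (Suc n))" by auto
  qed
  from choice[OF this] obtain q where q: "\<And>n. q n tagged_division_of {0..L}"
    "\<And>n. \<forall>(x, K)\<in>q n. measure lborel K < 1 / real (Suc n)" by blast
  have fine: "\<exists>N. \<forall>n\<ge>N. \<forall>(x, K)\<in>q n. measure lborel K < \<delta>" if "\<delta> > 0" for \<delta>
  proof -
    obtain N where N: "1 / real (Suc N) < \<delta>" using \<open>\<delta> > 0\<close> nat_approx_posE by blast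
    have "\<forall>(x, K)\<in>q n. measure lborel K < \<delta>" if "n \<ge> N" for n
    proof -
      have "1 / real (Suc n) \<le> 1 / real (Suc N)" using that by (simp add: frac_le)
      then show ?thesis using q(2)[of n] N by fastforce
    qed
    then show ?thesis by blast
  qed
  obtain l where l: "limitin (eps_lambda_topology P S nrm) (\<lambda>n. ?R (q n)) l sequentially"
  proof (rule fnorm_CauchyE[OF comp])
    fix \<epsilon> :: real assume "\<epsilon> > 0"
    then show "\<exists>N. \<forall>m\<ge>N. \<forall>n\<ge>N. fnorm (?R (q m) \<ominus>\<^bsub>S\<^esub> ?R (q n)) < \<epsilon>"
      using close[of \<epsilon>] fine q(1) by meson
  qed (use Rc q in auto)
  then have lc: "l \<in> carrier S" by (simp add: limitin_eps_lambda)
  have lim: "limitin (eps_lambda_topology P S nrm) ?R l (riemann_filter 0 L)"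
    unfolding limitin_eps_lambda
  proof (intro conjI allI impI lc)
    fix \<epsilon> :: real assume "\<epsilon> > 0"
    then obtain \<delta> where \<delta>: "\<delta> > 0" "\<And>p q. p tagged_division_of {0..L} \<Longrightarrow> q tagged_division_of {0..L} \<Longrightarrow>
       (\<forall>(x, K)\<in>p. measure lborel K < \<delta>) \<Longrightarrow> (\<forall>(x, K)\<in>q. measure lborel K < \<delta>) \<Longrightarrow>
       fnorm (?R q \<ominus>\<^bsub>S\<^esub> ?R p) < \<epsilon> / 2" using close[of "\<epsilon> / 2"] by (metis half_gt_zero)
    have "eventually (\<lambda>n. fnorm (?R (q n) \<ominus>\<^bsub>S\<^esub> l) < \<epsilon> / 2) sequentially"
      using \<open>\<epsilon> > 0\<close> by (intro eventually_fnorm_less[OF l]) simp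
    moreover have "eventually (\<lambda>n. \<forall>(x, K)\<in>q n. measure lborel K < \<delta>) sequentially"
      using fine[OF \<delta>(1)] by (auto simp: eventually_sequentially)
    ultimately have "eventually (\<lambda>n. fnorm (?R (q n) \<ominus>\<^bsub>S\<^esub> l) < \<epsilon> / 2 \<and> (\<forall>(x, K)\<in>q n. measure lborel K < \<delta>)) sequentially"
      by (rule eventually_conj)
    then obtain n where n: "fnorm (?R (q n) \<ominus>\<^bsub>S\<^esub> l) < \<epsilon> / 2" "\<forall>(x, K)\<in>q n. measure lborel K < \<delta>"
      by (auto simp: eventually_sequentially)
    have "?R p \<in> carrier S \<and> fnorm (?R p \<ominus>\<^bsub>S\<^esub> l) < \<epsilon>"
      if p: "p tagged_division_of {0..L}" "\<forall>(x, K)\<in>p. measure lborel K < \<delta>" for p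
      using fnorm_triangle_minus[OF Rc[OF p(1)] Rc[OF q(1)] lc, of n] \<delta>(2)[OF q(1) p(1) n(2) p(2)] n(1) Rc[OF p(1)] by auto
    then show "eventually (\<lambda>p. ?R p \<in> carrier S \<and> fnorm (?R p \<ominus>\<^bsub>S\<^esub> l) < \<epsilon>) (riemann_filter 0 L)"
      unfolding eventually_riemann_filter using \<delta>(1) by blast
  qed
  then show ?thesis unfolding riemann_integral_def
    by (rule theI[where a=l]) (erule limitin_unique[OF _ lim riemann_filter_neq_bot])
qed

lemma eventually_tagged_division: "eventually (\<lambda>p. p tagged_division_of {a..b}) (riemann_filter a b)"
  unfolding eventually_riemann_filter by (auto intro: exI[of _ 1])

lemma eventually_mesh: "\<delta> > 0 \<Longrightarrow> eventually (\<lambda>p. \<forall>(x, K)\<in>p. measure lborel K < \<delta>) (riemann_filter a b)"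
  unfolding eventually_riemann_filter by blast

text \<open>The limit of \<open>riemann_sums_close\<close> as both meshes shrink. The constant 3
  stems from e \<le> 3 in the estimate of exponential Riemann sums.\<close>

lemma riemann_integral_diff:
  assumes comp: "eps_lambda_complete P S nrm" and f: "damped f" and L: "0 \<le> L" "L \<le> L'"
  shows "fnorm (riemann_integral P S nrm f 0 L' \<ominus>\<^bsub>S\<^esub> riemann_integral P S nrm f 0 L) \<le> 3 * exp (- L)"
proof (rule field_le_epsilon)
  fix \<epsilon> :: real assume "\<epsilon> > 0"
  let ?R = "riemann_sum P S f" and ?I = "riemann_integral P S nrm f 0"
  have \<epsilon>: "\<epsilon> / 3 > 0" using \<open>\<epsilon> > 0\<close> by simp
  obtain \<delta> where \<delta>: "\<delta> > 0"
      "\<And>p q. p tagged_division_of {0..L} \<Longrightarrow> q tagged_division_of {0..L'} \<Longrightarrow>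
       (\<forall>(x, K)\<in>p. measure lborel K < \<delta>) \<Longrightarrow> (\<forall>(x, K)\<in>q. measure lborel K < \<delta>) \<Longrightarrow>
       fnorm (?R q \<ominus>\<^bsub>S\<^esub> ?R p) \<le> \<epsilon> / 3 + 3 * (exp (- L) - exp (- L'))"
    using riemann_sums_close[OF f L \<epsilon>] by metis
  have ex: "\<exists>p. p tagged_division_of {0..M} \<and> (\<forall>(x, K)\<in>p. measure lborel K < \<delta>) \<and> ?R p \<in> carrier S
      \<and> fnorm (?R p \<ominus>\<^bsub>S\<^esub> ?I M) < \<epsilon> / 3" and Ic: "?I M \<in> carrier S" if "0 \<le> M" for M
  proof -
    note lim = riemann_integral_exists[OF comp f that]
    show "?I M \<in> carrier S" using lim by (simp add: limitin_eps_lambda)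
    have "eventually (\<lambda>p. p tagged_division_of {0..M} \<and> (\<forall>(x, K)\<in>p. measure lborel K < \<delta>) \<and> ?R p \<in> carrier S
      \<and> fnorm (?R p \<ominus>\<^bsub>S\<^esub> ?I M) < \<epsilon> / 3) (riemann_filter 0 M)"
    proof (intro eventually_conj eventually_tagged_division eventually_mesh \<delta>(1) eventually_fnorm_less[OF lim] \<epsilon>)
      show "eventually (\<lambda>p. ?R p \<in> carrier S) (riemann_filter 0 M)"
        using lim \<epsilon> unfolding limitin_eps_lambda by (blast intro: eventually_mono)
    qed
    then show "\<exists>p. p tagged_division_of {0..M} \<and> (\<forall>(x, K)\<in>p. measure lborel K < \<delta>) \<and> ?R p \<in> carrier S
      \<and> fnorm (?R p \<ominus>\<^bsub>S\<^esub> ?I M) < \<epsilon> / 3" using eventually_happens riemann_filter_neq_bot by blast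
  qed
  obtain p where p: "p tagged_division_of {0..L}" "\<forall>(x, K)\<in>p. measure lborel K < \<delta>" "?R p \<in> carrier S" "fnorm (?R p \<ominus>\<^bsub>S\<^esub> ?I L) < \<epsilon> / 3"
    using ex[of L] L by blast
  obtain q where q: "q tagged_division_of {0..L'}" "\<forall>(x, K)\<in>q. measure lborel K < \<delta>" "?R q \<in> carrier S" "fnorm (?R q \<ominus>\<^bsub>S\<^esub> ?I L') < \<epsilon> / 3"
    using ex[of L'] L by auto
  have I: "?I L \<in> carrier S" "?I L' \<in> carrier S" using Ic L by auto
  have "fnorm (?I L' \<ominus>\<^bsub>S\<^esub> ?I L) \<le> fnorm (?I L' \<ominus>\<^bsub>S\<^esub> ?R q) + fnorm (?R q \<ominus>\<^bsub>S\<^esub> ?I L)"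
    by (intro fnorm_triangle_minus I q)
  also have "\<dots> \<le> fnorm (?I L' \<ominus>\<^bsub>S\<^esub> ?R q) + (fnorm (?R q \<ominus>\<^bsub>S\<^esub> ?R p) + fnorm (?R p \<ominus>\<^bsub>S\<^esub> ?I L))"
    by (intro add_left_mono fnorm_triangle_minus I p q)
  also have "\<dots> \<le> \<epsilon> / 3 + (\<epsilon> / 3 + 3 * (exp (- L) - exp (- L')) + \<epsilon> / 3)"
    using \<delta>(2)[OF p(1) q(1) p(2) q(2)] p(4) q(4) fnorm_minus_commute[OF I(2) q(3)] by auto
  also have "\<dots> \<le> 3 * exp (- L) + \<epsilon>" by simp
  finally show "fnorm (?I L' \<ominus>\<^bsub>S\<^esub> ?I L) \<le> 3 * exp (- L) + \<epsilon>" .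
qed

text \<open>Integer upper limits give a Cauchy sequence; the tail bound 3 * exp (- L) extends its
  limit to real \<open>L\<close>.\<close>

lemma improper_integral_exists:
  assumes comp: "eps_lambda_complete P S nrm" and f: "damped f"
  shows "limitin (eps_lambda_topology P S nrm) (riemann_integral P S nrm f 0) (improper_integral P S nrm f) at_top"
proof -
  let ?I = "riemann_integral P S nrm f 0"
  have Ic: "?I M \<in> carrier S" if "0 \<le> M" for M
    using riemann_integral_exists[OF comp f that] by (simp add: limitin_eps_lambda)
  have tail: "\<exists>N. \<forall>L\<ge>real N. \<forall>L'\<ge>real N. fnorm (?I L' \<ominus>\<^bsub>S\<^esub> ?I L) < \<epsilon>" if "\<epsilon> > 0" for \<epsilon>
  proof -
    have "((\<lambda>L::real. 3 * exp (- L)) \<longlongrightarrow> 0) at_top" by real_asymp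
    then have "eventually (\<lambda>L::real. 3 * exp (- L) < \<epsilon>) at_top" using that by (rule order_tendstoD)
    then obtain L0 where L0: "\<And>L. L \<ge> L0 \<Longrightarrow> 3 * exp (- L) < \<epsilon>" by (auto simp: eventually_at_top_linorder)
    obtain N where N: "real N \<ge> L0" using real_arch_simple by blast
    have "fnorm (?I L' \<ominus>\<^bsub>S\<^esub> ?I L) < \<epsilon>" if "L \<ge> real N" "L' \<ge> real N" for L L'
    proof -
      have pos: "0 \<le> L" "0 \<le> L'" using that of_nat_0_le_iff order_trans by blast+
      show ?thesis
      proof (cases "L \<le> L'")
        case True
        then show ?thesis using riemann_integral_diff[OF comp f pos(1) True] L0[of L] N that by simp
      next
        case False
        then have "fnorm (?I L \<ominus>\<^bsub>S\<^esub> ?I L') < \<epsilon>"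
          using riemann_integral_diff[OF comp f pos(2), of L] L0[of L'] N that by simp
        then show ?thesis using fnorm_minus_commute[OF Ic[OF pos(1)] Ic[OF pos(2)]] by simp
      qed
    qed
    then show ?thesis by blast
  qed
  obtain l where l: "limitin (eps_lambda_topology P S nrm) (\<lambda>n. ?I (real n)) l sequentially"
  proof (rule fnorm_CauchyE[OF comp])
    fix \<epsilon> :: real assume "\<epsilon> > 0"
    then show "\<exists>N. \<forall>m\<ge>N. \<forall>n\<ge>N. fnorm (?I (real m) \<ominus>\<^bsub>S\<^esub> ?I (real n)) < \<epsilon>"
      using tail[of \<epsilon>] by (meson of_nat_le_iff)
  qed (use Ic in auto)
  then have lc: "l \<in> carrier S" by (simp add: limitin_eps_lambda)
  have lim: "limitin (eps_lambda_topology P S nrm) ?I l at_top"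
    unfolding limitin_eps_lambda
  proof (intro conjI allI impI lc)
    fix \<epsilon> :: real assume "\<epsilon> > 0"
    then obtain N where N: "\<And>L L'. L \<ge> real N \<Longrightarrow> L' \<ge> real N \<Longrightarrow> fnorm (?I L' \<ominus>\<^bsub>S\<^esub> ?I L) < \<epsilon> / 2"
      using tail[of "\<epsilon> / 2"] by auto
    have "eventually (\<lambda>n. fnorm (?I (real n) \<ominus>\<^bsub>S\<^esub> l) < \<epsilon> / 2) sequentially"
      using \<open>\<epsilon> > 0\<close> by (intro eventually_fnorm_less[OF l]) simp
    then have "eventually (\<lambda>n. fnorm (?I (real n) \<ominus>\<^bsub>S\<^esub> l) < \<epsilon> / 2 \<and> n \<ge> N) sequentially"
      by (intro eventually_conj eventually_ge_at_top)
    then obtain n where n: "fnorm (?I (real n) \<ominus>\<^bsub>S\<^esub> l) < \<epsilon> / 2" "n \<ge> N"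
      by (auto simp: eventually_sequentially)
    have "?I L \<in> carrier S \<and> fnorm (?I L \<ominus>\<^bsub>S\<^esub> l) < \<epsilon>" if "L \<ge> real N" for L
    proof -
      have "0 \<le> L" using that of_nat_0_le_iff order_trans by blast
      then have c: "?I L \<in> carrier S" "?I (real n) \<in> carrier S" using Ic by auto
      show ?thesis using fnorm_triangle_minus[OF c lc] N[of "real n" L] that n c by auto
    qed
    then show "eventually (\<lambda>L. ?I L \<in> carrier S \<and> fnorm (?I L \<ominus>\<^bsub>S\<^esub> l) < \<epsilon>) at_top"
      by (auto simp: eventually_at_top_linorder)
  qed
  then show ?thesis unfolding improper_integral_def
    by (rule theI[where a=l]) (erule limitin_unique[OF _ lim trivial_limit_at_top_linorder])
qed

text \<open>The limit is an iterated one: the admissible mesh may depend on \<open>L\<close>.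
  \<open>negligible_kernel\<close> has the same shape, so equal integrals translate into it
  directly.\<close>

lemma riemann_sums_tendsto_improper_integral:
  assumes comp: "eps_lambda_complete P S nrm" and f: "damped f" and "\<epsilon> > 0"
  shows "eventually (\<lambda>L. eventually (\<lambda>p. fnorm (riemann_sum P S f p \<ominus>\<^bsub>S\<^esub> improper_integral P S nrm f) < \<epsilon>)
    (riemann_filter 0 L)) at_top"
proof -
  let ?R = "riemann_sum P S f" and ?I = "riemann_integral P S nrm f 0" and ?J = "improper_integral P S nrm f"
  have \<epsilon>: "\<epsilon> / 2 > 0" using assms by simp
  note J = improper_integral_exists[OF comp f, unfolded limitin_eps_lambda]
  then have Jc: "?J \<in> carrier S" by blast
  have "eventually (\<lambda>L. ?I L \<in> carrier S \<and> fnorm (?I L \<ominus>\<^bsub>S\<^esub> ?J) < \<epsilon> / 2) at_top"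
    using J \<epsilon> by blast
  then show ?thesis using eventually_ge_at_top[of 0]
  proof eventually_elim
    case (elim L)
    have "eventually (\<lambda>p. ?R p \<in> carrier S \<and> fnorm (?R p \<ominus>\<^bsub>S\<^esub> ?I L) < \<epsilon> / 2) (riemann_filter 0 L)"
      using riemann_integral_exists[OF comp f elim(2), unfolded limitin_eps_lambda] \<epsilon> by blast
    then show ?case
    proof eventually_elim
      case (elim p)
      then show ?case using fnorm_triangle_minus[of "?R p" "?I L" ?J] Jc \<open>?I L \<in> carrier S \<and> _\<close> by auto
    qed
  qed
qed

end

section \<open>Kernels annihilating a function\<close>

context weighted_random_normed_module
begin

text \<open>A substitute for \<open>\<integral>\<^sub>0\<^sup>\<infinity> \<phi> v = 0\<close> that does not presuppose existence of the integral.\<close>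

definition negligible_kernel :: "(real \<Rightarrow> 's) \<Rightarrow> (real \<Rightarrow> real) \<Rightarrow> bool" where
  "negligible_kernel v \<phi> \<longleftrightarrow> (\<forall>\<epsilon>>0. eventually (\<lambda>L. eventually
     (\<lambda>p. fnorm (riemann_sum P S (\<lambda>t. cst (\<phi> t) \<odot>\<^bsub>S\<^esub> v t) p) < \<epsilon>) (riemann_filter 0 L)) at_top)"

lemma negligible_kernelD:
  assumes "negligible_kernel v \<phi>" "\<epsilon> > 0"
  shows "eventually (\<lambda>L. eventually
     (\<lambda>p. fnorm (riemann_sum P S (\<lambda>t. cst (\<phi> t) \<odot>\<^bsub>S\<^esub> v t) p) < \<epsilon>) (riemann_filter 0 L)) at_top"
  using assms by (simp add: negligible_kernel_def)

lemma negligible_kernel_add: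
  assumes v: "\<And>t. 0 \<le> t \<Longrightarrow> v t \<in> carrier S"
    and "negligible_kernel v \<phi>" "negligible_kernel v \<psi>"
  shows "negligible_kernel v (\<lambda>t. \<phi> t + \<psi> t)"
  unfolding negligible_kernel_def
proof (intro allI impI)
  fix \<epsilon> :: real assume "\<epsilon> > 0"
  then have e: "\<epsilon> / 2 > 0" by simp
  show "eventually (\<lambda>L. eventually
     (\<lambda>p. fnorm (riemann_sum P S (\<lambda>t. cst (\<phi> t + \<psi> t) \<odot>\<^bsub>S\<^esub> v t) p) < \<epsilon>) (riemann_filter 0 L)) at_top"
    using negligible_kernelD[OF assms(2) e] negligible_kernelD[OF assms(3) e]
  proof eventually_elim
    case (elim L)
    show ?case using elim eventually_tagged_division[of 0 L]
    proof eventually_elim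
      case (elim p)
      note p = elim(3)
      have "riemann_sum P S (\<lambda>t. cst (\<phi> t + \<psi> t) \<odot>\<^bsub>S\<^esub> v t) p
          = riemann_sum P S (\<lambda>t. cst (\<phi> t) \<odot>\<^bsub>S\<^esub> v t \<oplus>\<^bsub>S\<^esub> cst (\<psi> t) \<odot>\<^bsub>S\<^esub> v t) p"
        using v by (intro riemann_sum_cong[OF p]) (auto simp: cst_add smult_l_distr)
      also have "\<dots> = riemann_sum P S (\<lambda>t. cst (\<phi> t) \<odot>\<^bsub>S\<^esub> v t) p \<oplus>\<^bsub>S\<^esub> riemann_sum P S (\<lambda>t. cst (\<psi> t) \<odot>\<^bsub>S\<^esub> v t) p"
        using v by (intro riemann_sum_add[OF p]) auto
      finally show ?case
        using elim(1,2) v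
          fnorm_triangle[OF riemann_sum_closed[OF p, of "\<lambda>t. cst (\<phi> t) \<odot>\<^bsub>S\<^esub> v t"]
            riemann_sum_closed[OF p, of "\<lambda>t. cst (\<psi> t) \<odot>\<^bsub>S\<^esub> v t"]] by simp
    qed
  qed
qed

lemma negligible_kernel_scale:
  assumes v: "\<And>t. 0 \<le> t \<Longrightarrow> v t \<in> carrier S" and "negligible_kernel v \<phi>"
  shows "negligible_kernel v (\<lambda>t. r * \<phi> t)"
  unfolding negligible_kernel_def
proof (intro allI impI)
  fix \<epsilon> :: real assume "\<epsilon> > 0"
  then have e: "\<epsilon> / (1 + \<bar>r\<bar>) > 0" by simp
  show "eventually (\<lambda>L. eventually
     (\<lambda>p. fnorm (riemann_sum P S (\<lambda>t. cst (r * \<phi> t) \<odot>\<^bsub>S\<^esub> v t) p) < \<epsilon>) (riemann_filter 0 L)) at_top"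
    using negligible_kernelD[OF assms(2) e]
  proof eventually_elim
    case (elim L)
    show ?case using elim eventually_tagged_division[of 0 L]
    proof eventually_elim
      case (elim p)
      note p = elim(2)
      let ?R = "riemann_sum P S (\<lambda>t. cst (\<phi> t) \<odot>\<^bsub>S\<^esub> v t) p"
      have "riemann_sum P S (\<lambda>t. cst (r * \<phi> t) \<odot>\<^bsub>S\<^esub> v t) p
          = riemann_sum P S (\<lambda>t. cst r \<odot>\<^bsub>S\<^esub> (cst (\<phi> t) \<odot>\<^bsub>S\<^esub> v t)) p"
        using v by (intro riemann_sum_cong[OF p]) (auto simp: cst_mult smult_assoc1)
      also have "\<dots> = cst r \<odot>\<^bsub>S\<^esub> ?R"
        using v by (intro riemann_sum_smult[OF p]) auto
      finally have "fnorm (riemann_sum P S (\<lambda>t. cst (r * \<phi> t) \<odot>\<^bsub>S\<^esub> v t) p) \<le> (1 + \<bar>r\<bar>) * fnorm ?R"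
        using v fnorm_cst_le[OF riemann_sum_closed[OF p, of "\<lambda>t. cst (\<phi> t) \<odot>\<^bsub>S\<^esub> v t"]] by simp
      also have "\<dots> < \<epsilon>" using elim(1) by (simp add: field_simps)
      finally show ?case .
    qed
  qed
qed

lemma negligible_kernel_sum:
  assumes v: "\<And>t. 0 \<le> t \<Longrightarrow> v t \<in> carrier S" and "\<And>i::nat. negligible_kernel v (\<phi> i)"
  shows "negligible_kernel v (\<lambda>t. \<Sum>i\<le>n. \<phi> i t)"
proof (induction n)
  case 0
  show ?case using assms(2)[of 0] by simp
next
  case (Suc n)
  show ?case using negligible_kernel_add[OF v Suc assms(2)[of "Suc n"]] by simp
qed

text \<open>The factor exp (- t) stays outside the approximation: a uniform error of the polynomial
  then produces an error proportional to exp (- t), whose Riemann sums are bounded independently of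
  \<open>L\<close>.\<close>

lemma negligible_kernel_continuous:
  assumes v: "\<And>t. 0 \<le> t \<Longrightarrow> v t \<in> wL1" and v2: "\<And>t. 0 \<le> t \<Longrightarrow> wnorm (v t) \<le> 2"
    and neg: "\<And>n::nat. n \<ge> 1 \<Longrightarrow> negligible_kernel v (\<lambda>t. exp (- (real n * t)))"
    and b: "continuous_on {0..1} b"
  shows "negligible_kernel v (\<lambda>t. exp (- t) * b (exp (- t)))"
  unfolding negligible_kernel_def
proof (intro allI impI)
  fix \<epsilon> :: real assume "\<epsilon> > 0"
  \<comment> \<open>The error \<epsilon> / 12 is multiplied by 2, the bound for \<open>v\<close>,
    and by 3, the bound for Riemann sums of exp (- t), which gives \<epsilon> / 2.\<close>
  then have e: "\<epsilon> / 2 > 0" "\<epsilon> / 12 > 0" by simp_all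
  have vc: "v t \<in> carrier S" if "0 \<le> t" for t using v[OF that] wL1_carrier by simp
  obtain q where q: "real_polynomial_function q" "\<And>x. x \<in> {0..1} \<Longrightarrow> \<bar>b x - q x\<bar> < \<epsilon> / 12"
    using Stone_Weierstrass_real_polynomial_function[OF compact_Icc b e(2)] by blast
  obtain a n where an: "q = (\<lambda>x. \<Sum>i\<le>n. a i * x ^ i)"
    using q(1) unfolding real_polynomial_function_iff_sum by blast
  \<comment> \<open>The monomial of degree i becomes the exponential of index i + 1, so indices from
    1 on already yield all polynomials, the constants included.\<close>
  have E: "exp (- (real (Suc i) * t)) = exp (- t) * exp (- t) ^ i" for i t
    by (simp flip: exp_of_nat_mult exp_add add: algebra_simps)
  have "negligible_kernel v (\<lambda>t. \<Sum>i\<le>n. a i * exp (- (real (Suc i) * t)))"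
    by (intro negligible_kernel_sum negligible_kernel_scale neg vc) auto
  also have "(\<lambda>t. \<Sum>i\<le>n. a i * exp (- (real (Suc i) * t))) = (\<lambda>t. exp (- t) * q (exp (- t)))"
    unfolding an sum_distrib_left E by (simp add: mult.left_commute)
  finally have nq: "negligible_kernel v (\<lambda>t. exp (- t) * q (exp (- t)))" .
  show "eventually (\<lambda>L. eventually
     (\<lambda>p. fnorm (riemann_sum P S (\<lambda>t. cst (exp (- t) * b (exp (- t))) \<odot>\<^bsub>S\<^esub> v t) p) < \<epsilon>) (riemann_filter 0 L)) at_top"
    using negligible_kernelD[OF nq e(1)] eventually_ge_at_top[of 0]
  proof eventually_elim
    case (elim L)
    show ?case using elim(1) eventually_tagged_division[of 0 L] eventually_mesh[of 1 0 L, OF zero_less_one]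
    proof eventually_elim
      case (elim p)
      note p = elim(2)
      let ?d = "\<lambda>t. exp (- t) * (b (exp (- t)) - q (exp (- t)))"
      let ?Rq = "riemann_sum P S (\<lambda>t. cst (exp (- t) * q (exp (- t))) \<odot>\<^bsub>S\<^esub> v t) p"
      let ?Rd = "riemann_sum P S (\<lambda>t. cst (?d t) \<odot>\<^bsub>S\<^esub> v t) p"
      have RdV: "?Rd \<in> wL1" using v by (intro wnorm_riemann_sum_le[OF p]) auto
      have Rqc: "?Rq \<in> carrier S" using vc by (intro riemann_sum_closed[OF p]) auto
      have "riemann_sum P S (\<lambda>t. cst (exp (- t) * b (exp (- t))) \<odot>\<^bsub>S\<^esub> v t) p
        = riemann_sum P S (\<lambda>t. cst (exp (- t) * q (exp (- t))) \<odot>\<^bsub>S\<^esub> v t \<oplus>\<^bsub>S\<^esub> cst (?d t) \<odot>\<^bsub>S\<^esub> v t) p"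
        using vc by (intro riemann_sum_cong[OF p]) (auto simp flip: cst_add smult_l_distr simp: algebra_simps)
      also have "\<dots> = ?Rq \<oplus>\<^bsub>S\<^esub> ?Rd"
        using vc by (intro riemann_sum_add[OF p]) auto
      finally have "fnorm (riemann_sum P S (\<lambda>t. cst (exp (- t) * b (exp (- t))) \<odot>\<^bsub>S\<^esub> v t) p) \<le> fnorm ?Rq + fnorm ?Rd"
        using fnorm_triangle[OF Rqc wL1_carrier[OF RdV]] by simp
      moreover have "fnorm ?Rd \<le> \<epsilon> / 2"
      proof -
        have "fnorm ?Rd \<le> wnorm ?Rd" by (rule fnorm_le_wnorm[OF RdV])
        also have "\<dots> \<le> (\<Sum>(t, k)\<in>p. measure lborel k * wnorm (cst (?d t) \<odot>\<^bsub>S\<^esub> v t))"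
          using v by (intro wnorm_riemann_sum_le(2)[OF p]) auto
        also have "\<dots> \<le> (\<Sum>(t, k)\<in>p. \<epsilon> / 6 * (measure lborel (k \<inter> {0..L}) * exp (- t)))"
        proof (rule sum_mono, clarify)
          fix t k assume tk: "(t, k) \<in> p"
          have t: "0 \<le> t" using tagged_division_tag[OF p tk] by simp
          have "k \<inter> {0..L} = k" using tagged_division_ofD(3)[OF p tk] by blast
          moreover have "wnorm (cst (?d t) \<odot>\<^bsub>S\<^esub> v t) \<le> (exp (- t) * (\<epsilon> / 12)) * 2"
            unfolding wnorm_cst[OF vc[OF t]] abs_mult
            using \<open>\<epsilon> > 0\<close> q(2)[of "exp (- t)"] t v2[OF t] wnorm_nonneg[OF vc[OF t]]
            by (intro mult_mono) (auto intro: less_imp_le)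
          ultimately show "measure lborel k * wnorm (cst (?d t) \<odot>\<^bsub>S\<^esub> v t) \<le> \<epsilon> / 6 * (measure lborel (k \<inter> {0..L}) * exp (- t))"
            using mult_left_mono[of "wnorm (cst (?d t) \<odot>\<^bsub>S\<^esub> v t)" "(exp (- t) * (\<epsilon> / 12)) * 2" "measure lborel k"] by (simp add: mult_ac)
        qed
        also have "\<dots> = \<epsilon> / 6 * (\<Sum>(t, k)\<in>p. measure lborel (k \<inter> {0..L}) * exp (- t))"
          by (simp add: sum_distrib_left case_prod_unfold)
        also have "\<dots> \<le> \<epsilon> / 6 * (3 * (exp (- 0) - exp (- L)))"
          using elim(3) \<open>0 \<le> L\<close> \<open>\<epsilon> > 0\<close> by (intro mult_left_mono tagged_division_exp_tail[OF p]) auto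
        also have "\<dots> \<le> \<epsilon> / 6 * 3" using \<open>\<epsilon> > 0\<close> by (intro mult_left_mono) auto
        finally show ?thesis by simp
      qed
      ultimately show ?case using elim(1) by simp
    qed
  qed
qed

lemma minus_zero_right: "x \<in> carrier S \<Longrightarrow> x \<ominus>\<^bsub>S\<^esub> \<zero>\<^bsub>S\<^esub> = x"
  using add_minus_cancel[of x "\<zero>\<^bsub>S\<^esub>"] by simp

text \<open>A kernel of mass \<open>R\<close> supported near \<open>t0\<close> has a Riemann sum
  within \<omega> * R of R times \<open>v t0\<close>, yet arbitrarily small. The lower bound \<rho>
  of \<open>R\<close> depends on no division, so the smallness can be demanded before the division
  is chosen.\<close>

lemma wnorm_continuous_eq_zero:
  assumes v: "wnorm_continuous v" and v2: "\<And>t. 0 \<le> t \<Longrightarrow> wnorm (v t) \<le> 2"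
    and neg: "\<And>n::nat. n \<ge> 1 \<Longrightarrow> negligible_kernel v (\<lambda>t. exp (- (real n * t)))"
    and t0: "0 \<le> t0"
  shows "v t0 = \<zero>\<^bsub>S\<^esub>"
proof (rule fnorm_eq_0_imp)
  note vV = wnorm_continuousD(1)[OF v] and vc = wnorm_continuousD(2)[OF v]
  show v0: "v t0 \<in> carrier S" using vc t0 by simp
  \<comment> \<open>Two errors of at most R * \<omega>, from the oscillation of \<open>v\<close> and
    from the small sum, times the factor 3 of \<open>fnorm_cst_ge\<close>.\<close>
  have "fnorm (v t0) \<le> 6 * \<omega>" if pos: "\<omega> > 0" for \<omega>
  proof -
    obtain \<delta>0 where \<delta>0: "\<delta>0 > 0" "\<And>s. 0 \<le> s \<Longrightarrow> \<bar>s - t0\<bar> < \<delta>0 \<Longrightarrow> wnorm (v s \<ominus>\<^bsub>S\<^esub> v t0) < \<omega>"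
      using wnorm_continuousD(3)[OF v t0 pos] by blast
    define \<delta> where "\<delta> = min 1 \<delta>0"
    have \<delta>: "\<delta> > 0" "\<delta> \<le> 1" "\<And>s. 0 \<le> s \<Longrightarrow> \<bar>s - t0\<bar> < \<delta> \<Longrightarrow> wnorm (v s \<ominus>\<^bsub>S\<^esub> v t0) < \<omega>"
      using \<delta>0 by (auto simp: \<delta>_def)
    define \<phi> where "\<phi> t = exp (- t) * max 0 (\<delta> - \<bar>t - t0\<bar>)" for t
    have \<phi>0: "0 \<le> \<phi> t" and \<phi>1: "\<phi> t \<le> exp (- t)" for t
      using \<delta>(2) by (auto simp: \<phi>_def mult_le_cancel_left1)
    \<comment> \<open>The tent around \<open>t0\<close> in the variable \<open>x = exp (- t)\<close>; the inner maximum lies outside its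
      support and only keeps \<open>ln\<close> away from 0.\<close>
    define b where "b x = max 0 (\<delta> - \<bar>ln (max x (exp (- t0 - \<delta>))) + t0\<bar>)" for x
    have "max x (exp (- t0 - \<delta>)) \<noteq> 0" for x :: real
      by (metis exp_gt_zero less_irrefl less_max_iff_disj)
    then have "continuous_on {0..1} b"
      unfolding b_def by (intro continuous_intros) auto
    from negligible_kernel_continuous[OF vV v2 neg this]
    have "negligible_kernel v (\<lambda>t. exp (- t) * b (exp (- t)))" by simp
    also have "(\<lambda>t. exp (- t) * b (exp (- t))) = \<phi>"
    proof
      fix t
      \<comment> \<open>For t > t0 + \<delta> the inner maximum freezes the logarithm at - t0 -
        \<delta>, where the tent is 0, as it is at t itself.\<close>
      have "max (exp (- t)) (exp (- t0 - \<delta>)) = exp (max (- t) (- t0 - \<delta>))" by (auto simp: max_def)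
      then show "exp (- t) * b (exp (- t)) = \<phi> t" using \<delta>(1) by (auto simp: b_def \<phi>_def max_def)
    qed
    finally have neg\<phi>: "negligible_kernel v \<phi>" .
    \<comment> \<open>The interval from t0 + \<delta> / 8 to t0 + 3 \<delta> / 8 has length \<delta>
      / 4. Cells of mesh below \<delta> / 8 that meet it have tags between t0 and t0 + \<delta> / 2,
      where the tent is at least \<delta> / 2 and the exponential at least exp (- t0 - 1). Staying
      to the right of \<open>t0\<close> covers t0 = 0.\<close>
    define \<rho> where "\<rho> = exp (- t0 - 1) * (\<delta> / 2) * (\<delta> / 4)"
    have \<rho>: "\<rho> > 0" using \<delta> by (simp add: \<rho>_def)
    have "\<rho> * \<omega> > 0" "\<delta> / 8 > 0" using \<rho> pos \<delta> by simp_all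
    have "eventually (\<lambda>L. eventually (\<lambda>p. p tagged_division_of {0..L} \<and> (\<forall>(x, K)\<in>p. measure lborel K < \<delta> / 8)
        \<and> fnorm (riemann_sum P S (\<lambda>t. cst (\<phi> t) \<odot>\<^bsub>S\<^esub> v t) p) < \<rho> * \<omega>) (riemann_filter 0 L)) at_top"
      using negligible_kernelD[OF neg\<phi> \<open>\<rho> * \<omega> > 0\<close>]
      by eventually_elim (intro eventually_conj eventually_tagged_division eventually_mesh \<open>\<delta> / 8 > 0\<close>)
    then have "eventually (\<lambda>L. eventually (\<lambda>p. p tagged_division_of {0..L} \<and> (\<forall>(x, K)\<in>p. measure lborel K < \<delta> / 8)
        \<and> fnorm (riemann_sum P S (\<lambda>t. cst (\<phi> t) \<odot>\<^bsub>S\<^esub> v t) p) < \<rho> * \<omega>) (riemann_filter 0 L) \<and> L \<ge> t0 + 1) at_top"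
      \<comment> \<open>With L \<ge> t0 + 1 and \<delta> \<le> 1 the interval that bounds the mass
        from below lies inside {0..L}.\<close>
      by (intro eventually_conj eventually_ge_at_top)
    then obtain L where L: "eventually (\<lambda>p. p tagged_division_of {0..L} \<and> (\<forall>(x, K)\<in>p. measure lborel K < \<delta> / 8)
        \<and> fnorm (riemann_sum P S (\<lambda>t. cst (\<phi> t) \<odot>\<^bsub>S\<^esub> v t) p) < \<rho> * \<omega>) (riemann_filter 0 L)" "L \<ge> t0 + 1"
      using eventually_happens trivial_limit_at_top_linorder by blast
    then obtain p where p: "p tagged_division_of {0..L}" and mesh: "\<forall>(x, K)\<in>p. measure lborel K < \<delta> / 8"
      and small: "fnorm (riemann_sum P S (\<lambda>t. cst (\<phi> t) \<odot>\<^bsub>S\<^esub> v t) p) < \<rho> * \<omega>"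
      using eventually_happens riemann_filter_neq_bot by blast
    have Kint: "k \<inter> {0..L} = k" if "(t, k) \<in> p" for t k using tagged_division_ofD(3)[OF p that] by blast
    define R where "R = (\<Sum>(t, k)\<in>p. measure lborel k * \<phi> t)"
    \<comment> \<open>The tent has height at most 1, so exp (- t) dominates the kernel; the bound 3
      is what \<open>fnorm_cst_ge\<close> requires.\<close>
    have R3: "R \<le> 3"
    proof -
      have "R \<le> (\<Sum>(t, k)\<in>p. measure lborel (k \<inter> {0..L}) * exp (- t))"
        unfolding R_def using \<phi>1 Kint by (intro sum_mono) (auto intro!: mult_left_mono)
      also have "\<dots> \<le> 3 * (exp (- 0) - exp (- L))"
        using mesh \<delta>(2) L(2) t0 by (intro tagged_division_exp_tail[OF p]) fastforce+
      finally show ?thesis by (simp add: algebra_simps) (smt (verit) exp_gt_zero)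
    qed
    have R\<rho>: "\<rho> \<le> R"
    proof -
      let ?A = "{t0 + \<delta> / 8..t0 + 3 * \<delta> / 8}"
      have "\<rho> = exp (- t0 - 1) * (\<delta> / 2) * (\<Sum>(t, k)\<in>p. measure lborel (k \<inter> ?A))"
        using sum_measure_Int_tagged_division[OF p, of "t0 + \<delta> / 8" "t0 + 3 * \<delta> / 8"] \<delta> t0 L(2)
        by (simp add: \<rho>_def)
      also have "\<dots> = (\<Sum>(t, k)\<in>p. measure lborel (k \<inter> ?A) * (exp (- t0 - 1) * (\<delta> / 2)))"
        by (simp add: sum_distrib_left case_prod_unfold mult_ac)
      also have "\<dots> \<le> R"
        unfolding R_def
      proof (rule sum_mono, clarify)
        fix t k assume tk: "(t, k) \<in> p"
        obtain u w where k: "k = {u..w}" "u \<le> t" "t \<le> w" using tagged_division_realE[OF p tk] by metis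
        have wu: "w - u < \<delta> / 8" using mesh tk k by fastforce
        show "measure lborel (k \<inter> ?A) * (exp (- t0 - 1) * (\<delta> / 2)) \<le> measure lborel k * \<phi> t"
        proof (cases "k \<inter> ?A = {}")
          case True
          then show ?thesis using \<phi>0[of t] by simp
        next
          case False
          then obtain z where "z \<in> k" "z \<in> ?A" by blast
          then have t: "t0 \<le> t" "t \<le> t0 + \<delta> / 2" using k wu by auto
          have "exp (- t0 - 1) * (\<delta> / 2) \<le> \<phi> t"
            unfolding \<phi>_def using t \<delta> by (intro mult_mono) auto
          moreover have "measure lborel (k \<inter> ?A) \<le> measure lborel k"
            using k by (auto simp: content_real_if)
          ultimately show ?thesis using \<delta> by (intro mult_mono) auto
        qed
      qed
      finally show ?thesis .
    qed
    let ?D = "\<lambda>t. cst (\<phi> t) \<odot>\<^bsub>S\<^esub> (v t \<ominus>\<^bsub>S\<^esub> v t0)"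
    let ?RD = "riemann_sum P S ?D p" and ?Rv = "riemann_sum P S (\<lambda>t. cst (\<phi> t) \<odot>\<^bsub>S\<^esub> v t) p"
    have DV: "?D t \<in> wL1" if "0 \<le> t" for t using vV that t0 by simp
    have RDV: "?RD \<in> wL1" by (rule wnorm_riemann_sum_le(1)[OF p DV])
    have "wnorm ?RD \<le> (\<Sum>(t, k)\<in>p. measure lborel k * wnorm (?D t))"
      by (rule wnorm_riemann_sum_le(2)[OF p DV])
    also have "\<dots> \<le> (\<Sum>(t, k)\<in>p. \<omega> * (measure lborel k * \<phi> t))"
    proof (rule sum_mono, clarify)
      fix t k assume tk: "(t, k) \<in> p"
      have t: "0 \<le> t" using tagged_division_tag[OF p tk] by simp
      have "\<phi> t * wnorm (v t \<ominus>\<^bsub>S\<^esub> v t0) \<le> \<phi> t * \<omega>"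
      proof (cases "\<bar>t - t0\<bar> < \<delta>")
        case True
        then show ?thesis using \<delta>(3)[OF t] \<phi>0 by (intro mult_left_mono) (auto intro: less_imp_le)
      next
        case False
        then have "\<phi> t = 0" by (simp add: \<phi>_def)
        then show ?thesis by simp
      qed
      then have "wnorm (?D t) \<le> \<phi> t * \<omega>" using \<phi>0[of t] vc t v0 by (simp add: wnorm_cst)
      then show "measure lborel k * wnorm (?D t) \<le> \<omega> * (measure lborel k * \<phi> t)"
        using mult_left_mono[of "wnorm (?D t)" "\<phi> t * \<omega>" "measure lborel k"] by (simp add: mult_ac)
    qed
    also have "\<dots> = \<omega> * R" by (simp add: R_def sum_distrib_left case_prod_unfold)
    finally have "fnorm ?RD \<le> \<omega> * R" using fnorm_le_wnorm[OF RDV] by simp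
    have "?RD = riemann_sum P S (\<lambda>t. cst (\<phi> t) \<odot>\<^bsub>S\<^esub> v t \<ominus>\<^bsub>S\<^esub> cst (\<phi> t) \<odot>\<^bsub>S\<^esub> v t0) p"
      using vc v0 by (intro riemann_sum_cong[OF p]) (auto simp: cst_smult_minus)
    also have "\<dots> = ?Rv \<ominus>\<^bsub>S\<^esub> cst R \<odot>\<^bsub>S\<^esub> v t0"
      unfolding R_def riemann_sum_const[OF p v0, symmetric]
      using vc v0 by (intro riemann_sum_minus[OF p]) auto
    finally have RD: "?RD = ?Rv \<ominus>\<^bsub>S\<^esub> cst R \<odot>\<^bsub>S\<^esub> v t0" .
    have c: "?Rv \<in> carrier S" "cst R \<odot>\<^bsub>S\<^esub> v t0 \<in> carrier S"
      using vc v0 by (auto intro!: riemann_sum_closed[OF p])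
    have "R / 3 * fnorm (v t0) \<le> fnorm (cst R \<odot>\<^bsub>S\<^esub> v t0)"
      using R\<rho> \<rho> R3 by (intro fnorm_cst_ge v0) auto
    also have "\<dots> = fnorm (cst R \<odot>\<^bsub>S\<^esub> v t0 \<ominus>\<^bsub>S\<^esub> \<zero>\<^bsub>S\<^esub>)" using c by (simp add: minus_zero_right)
    also have "\<dots> \<le> fnorm (cst R \<odot>\<^bsub>S\<^esub> v t0 \<ominus>\<^bsub>S\<^esub> ?Rv) + fnorm (?Rv \<ominus>\<^bsub>S\<^esub> \<zero>\<^bsub>S\<^esub>)"
      using c by (intro fnorm_triangle_minus) auto
    also have "\<dots> \<le> \<omega> * R + \<rho> * \<omega>"
      using c small \<open>fnorm ?RD \<le> \<omega> * R\<close> fnorm_minus_commute[OF c] by (simp add: RD minus_zero_right)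
    also have "\<dots> \<le> \<omega> * R + R * \<omega>" using R\<rho> pos by (intro add_left_mono mult_right_mono) auto
    finally have "R * fnorm (v t0) \<le> R * (6 * \<omega>)" by (simp add: algebra_simps)
    then show ?thesis using R\<rho> \<rho> by simp
  qed
  \<comment> \<open>With this \<omega> the estimate reads that \<open>fnorm (v t0)\<close> is at
    most half of itself.\<close>
  from this[of "fnorm (v t0) / 12"] have "\<not> fnorm (v t0) > 0" by auto
  then show "fnorm (v t0) = 0" using fnorm_nonneg[OF v0] by simp
qed

end

section \<open>Exponential discounting\<close>

text \<open>The join is a chosen least upper bound, which says something only if one exists; the
  class of the pointwise maximum is one. The inequality then allows points eta above the join to be
  constructed pointwise.\<close>

lemma L0_join_le_max:
  fixes X Y :: "('w \<Rightarrow> real) set"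
  assumes "X \<in> carrier (L0 P)" "Y \<in> carrier (L0 P)"
  shows "AE w in P. L0_rep (X \<squnion>\<^bsub>L0_order P\<^esub> Y) w \<le> max (L0_rep X w) (L0_rep Y w)"
proof -
  note [measurable] = L0_rep_measurable(2)[OF assms(1)] L0_rep_measurable(2)[OF assms(2)]
  define Z where "Z = L0_class P (\<lambda>w. max (L0_rep X w) (L0_rep Y w))"
  have Z: "Z \<in> carrier (L0 P)" "AE w in P. L0_rep Z w = max (L0_rep X w) (L0_rep Y w)"
    unfolding Z_def by (rule L0_rep_class; measurable)+
  have U: "Z \<in> Upper (L0_order P) {X, Y}"
    using Z by (auto simp: Upper_def L0_order_def elim: eventually_mono)
  moreover have "AE w in P. L0_rep Z w \<le> L0_rep U w" if "U \<in> Upper (L0_order P) {X, Y}" for U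
  proof -
    have "AE w in P. L0_rep X w \<le> L0_rep U w" "AE w in P. L0_rep Y w \<le> L0_rep U w"
      using that assms by (auto simp: Upper_def L0_order_def)
    then show ?thesis using Z(2) by eventually_elim simp
  qed
  ultimately have "least (L0_order P) Z (Upper (L0_order P) {X, Y})"
    by (auto simp: least_def L0_order_def Upper_def)
  then have "least (L0_order P) (X \<squnion>\<^bsub>L0_order P\<^esub> Y) (Upper (L0_order P) {X, Y})"
    unfolding join_def sup_def by (rule someI)
  then have "AE w in P. L0_rep (X \<squnion>\<^bsub>L0_order P\<^esub> Y) w \<le> L0_rep Z w"
    using U by (simp add: least_def L0_order_def)
  then show ?thesis using Z(2) by eventually_elim simp
qed

context weighted_random_normed_module
begin

lemma continuous_map_carrier:
  assumes "continuous_map (top_of_set A) (eps_lambda_topology P S nrm) h" "s \<in> A"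
  shows "h s \<in> carrier S"
  using assms by (auto simp: continuous_map_def eps_lambda_topology_eq)

abbreviation discount :: "('w \<Rightarrow> real) set \<Rightarrow> (real \<Rightarrow> 's) \<Rightarrow> real \<Rightarrow> 's" where
  "discount Y h s \<equiv> L0_exp P (- s) Y \<odot>\<^bsub>S\<^esub> h s"

lemma rnorm_L0_exp:
  assumes "Y \<in> carrier (L0 P)" "x \<in> carrier S"
  shows "AE w in P. rnorm (L0_exp P s Y \<odot>\<^bsub>S\<^esub> x) w = exp (s * L0_rep Y w) * rnorm x w"
  using rnorm_smult[OF L0_exp(1)[OF assms(1)] assms(2), of s] L0_exp(2)[OF assms(1), of s, where 'k='k]
  by eventually_elim simp

text \<open>Dominated convergence: the exponentials converge at every sample point, and the
  truncation supplies the dominating constant 1 although the random factor may be unbounded.\<close>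

lemma fnorm_scaled_tendsto:
  assumes Y: "Y \<in> carrier (L0 P)" and x: "x \<in> carrier S" and "\<epsilon> > 0"
  obtains \<delta> where "\<delta> > 0" "\<And>s. \<bar>s - t\<bar> < \<delta> \<Longrightarrow>
    fnorm (L0_exp P (- s) Y \<odot>\<^bsub>S\<^esub> x \<ominus>\<^bsub>S\<^esub> L0_exp P (- t) Y \<odot>\<^bsub>S\<^esub> x) < \<epsilon>"
proof -
  let ?y = "L0_rep Y"
  note [measurable] = L0_rep_measurable(2)[OF Y] rnorm_measurable[OF x]
  let ?F = "\<lambda>s w. min 1 (wt w * (\<bar>exp (- s * ?y w) - exp (- t * ?y w)\<bar> * rnorm x w))"
  have fnorm: "fnorm (L0_exp P (- s) Y \<odot>\<^bsub>S\<^esub> x \<ominus>\<^bsub>S\<^esub> L0_exp P (- t) Y \<odot>\<^bsub>S\<^esub> x) = (\<integral>w. ?F s w \<partial>P)" for s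
  proof -
    let ?E = "\<lambda>s. L0_exp P (- s) Y :: ('w \<Rightarrow> 'k) set"
    \<comment> \<open>Writing the difference as one scalar times \<open>x\<close> yields its norm
      exactly, through \<open>rnorm_smult\<close>, rather than a triangle estimate.\<close>
    let ?Z = "?E s \<oplus>\<^bsub>L0 P\<^esub> cst (- 1) \<otimes>\<^bsub>L0 P\<^esub> ?E t"
    have E: "?E s \<in> carrier (L0 P)" for s by (rule L0_exp(1)[OF Y])
    have m: "cst (- 1) \<otimes>\<^bsub>L0 P\<^esub> ?E t \<in> carrier (L0 P)" using E by simp
    have "?E s \<odot>\<^bsub>S\<^esub> x \<ominus>\<^bsub>S\<^esub> ?E t \<odot>\<^bsub>S\<^esub> x = ?E s \<odot>\<^bsub>S\<^esub> x \<oplus>\<^bsub>S\<^esub> cst (- 1) \<odot>\<^bsub>S\<^esub> (?E t \<odot>\<^bsub>S\<^esub> x)"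
      using x E by (simp add: cst_minus_one_smult M.minus_eq)
    also have "\<dots> = ?Z \<odot>\<^bsub>S\<^esub> x" using x E m by (simp add: smult_l_distr smult_assoc1)
    finally have *: "?E s \<odot>\<^bsub>S\<^esub> x \<ominus>\<^bsub>S\<^esub> ?E t \<odot>\<^bsub>S\<^esub> x = ?Z \<odot>\<^bsub>S\<^esub> x" .
    have Z: "?Z \<in> carrier (L0 P)" using E m by simp
    have "AE w in P. L0_rep ?Z w = of_real (exp (- s * ?y w) - exp (- t * ?y w))"
      using L0_rep_add[OF E m, of s] L0_rep_mult[OF L0_const_carrier E, of "-1" t]
        L0_rep_const[of P "-1", where 'k='k] L0_exp(2)[OF Y, of "- s", where 'k='k] L0_exp(2)[OF Y, of "- t", where 'k='k]
      by eventually_elim simp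
    then have "AE w in P. rnorm (?Z \<odot>\<^bsub>S\<^esub> x) w = \<bar>exp (- s * ?y w) - exp (- t * ?y w)\<bar> * rnorm x w"
      using rnorm_smult[OF Z x] by eventually_elim (simp del: of_real_diff)
    then have "AE w in P. min 1 (wt w * rnorm (?Z \<odot>\<^bsub>S\<^esub> x) w) = ?F s w"
      by eventually_elim simp
    moreover have [measurable]: "rnorm (?Z \<odot>\<^bsub>S\<^esub> x) \<in> borel_measurable P"
      by (rule rnorm_measurable[OF smult_closed[OF Z x]])
    ultimately show ?thesis unfolding * fnorm_def by (intro integral_cong_AE) auto
  qed
  have "((\<lambda>s. \<integral>w. ?F s w \<partial>P) \<longlongrightarrow> (\<integral>w. ?F t w \<partial>P)) (at t)"
    unfolding tendsto_at_iff_sequentially comp_def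
  proof (intro allI impI)
    fix X :: "nat \<Rightarrow> real" assume X: "X \<longlonglongrightarrow> t"
    show "(\<lambda>i. \<integral>w. ?F (X i) w \<partial>P) \<longlonglongrightarrow> (\<integral>w. ?F t w \<partial>P)"
    proof (rule integral_dominated_convergence[where w="\<lambda>_. 1"])
      show "AE w in P. (\<lambda>i. ?F (X i) w) \<longlonglongrightarrow> ?F t w"
        using X by (intro AE_I2 tendsto_intros)
      show "AE w in P. norm (?F (X i) w) \<le> 1" for i
        using rnorm_nonneg[OF x]
      proof eventually_elim
        case (elim w)
        have "0 \<le> wt w * (\<bar>exp (- X i * ?y w) - exp (- t * ?y w)\<bar> * rnorm x w)"
          using elim wt_pos[of w] by simp
        then show ?case by (simp add: min_def)
      qed
    qed auto
  qed
  then have "eventually (\<lambda>s. (\<integral>w. ?F s w \<partial>P) < \<epsilon>) (at t)"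
    by (rule order_tendstoD) (use assms(3) in simp)
  then obtain \<delta> where \<delta>: "\<delta> > 0" "\<And>s. s \<noteq> t \<Longrightarrow> \<bar>s - t\<bar> < \<delta> \<Longrightarrow> (\<integral>w. ?F s w \<partial>P) < \<epsilon>"
    unfolding eventually_at dist_real_def by auto
  \<comment> \<open>The limit at \<open>t\<close> leaves out s = t, where the integrand is
    0.\<close>
  have "(\<integral>w. ?F s w \<partial>P) < \<epsilon>" if "\<bar>s - t\<bar> < \<delta>" for s
    using \<delta>(2)[OF _ that] assms(3) by (cases "s = t") auto
  then show ?thesis using that[OF \<delta>(1)] by (simp add: fnorm)
qed

text \<open>The increment is split into a change of \<open>h\<close> under a fixed exponential and a
  change of the exponential at fixed \<open>h t\<close>. The first is controlled by continuity of
  \<open>h\<close> under a larger weight. The pointwise bound finally upgrades \<open>fnorm\<close>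
  to \<open>wnorm\<close>.\<close>

lemma wnorm_continuous_discount:
  assumes h: "continuous_map (top_of_set {0..}) (eps_lambda_topology P S nrm) h"
    and Y: "Y \<in> carrier (L0 P)"
    and bound: "\<And>s. 0 \<le> s \<Longrightarrow> AE w in P. wt w * rnorm (discount Y h s) w \<le> 1"
  shows "wnorm_continuous (discount Y h)"
  unfolding wnorm_continuous_def
proof (intro conjI allI impI)
  have hc: "h s \<in> carrier S" if "0 \<le> s" for s
    using continuous_map_carrier[OF h] that by simp
  have E: "(L0_exp P s Y :: ('w \<Rightarrow> 'k) set) \<in> carrier (L0 P)" for s by (rule L0_exp(1)[OF Y])
  have gc: "discount Y h s \<in> carrier S" if "0 \<le> s" for s using hc[OF that] E by simp
  show "discount Y h s \<in> wL1" if "0 \<le> s" for s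
    by (rule bounded_wL1(1)[OF gc[OF that] bound[OF that]])
  fix t \<epsilon> :: real assume t: "0 \<le> t" and "\<epsilon> > 0"
  \<comment> \<open>Two parts of the increment, and a factor 2 from
    \<open>wnorm_le_2_fnorm\<close>.\<close>
  then have e: "\<epsilon> / 4 > 0" by simp
  let ?y = "L0_rep Y"
  note [measurable] = L0_rep_measurable(2)[OF Y]
  \<comment> \<open>The extra factor dominates exp (- s Y) for 0 \<le> s \<le> t + 1; this is why s
    is kept within distance 1 of t.\<close>
  define wt' where "wt' w = wt w * exp (\<bar>?y w\<bar> * (t + 1))" for w
  interpret W': weighted_random_normed_module P S nrm wt'
  proof
    show "wt' \<in> borel_measurable P" unfolding wt'_def by measurable
    show "0 < wt' w" for w by (simp add: wt'_def wt_pos)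
  qed
  obtain \<delta>1 where \<delta>1: "\<delta>1 > 0" "\<And>s. s \<in> {0..} \<Longrightarrow> \<bar>s - t\<bar> < \<delta>1 \<Longrightarrow> W'.fnorm (h s \<ominus>\<^bsub>S\<^esub> h t) < \<epsilon> / 4"
    using W'.continuous_map_eps_lambda[OF h _ e, of t] t by auto
  obtain \<delta>2 where \<delta>2: "\<delta>2 > 0" "\<And>s. \<bar>s - t\<bar> < \<delta>2 \<Longrightarrow>
    fnorm (L0_exp P (- s) Y \<odot>\<^bsub>S\<^esub> h t \<ominus>\<^bsub>S\<^esub> L0_exp P (- t) Y \<odot>\<^bsub>S\<^esub> h t) < \<epsilon> / 4"
    using fnorm_scaled_tendsto[OF Y hc[OF t] e] by blast
  have "wnorm (discount Y h s \<ominus>\<^bsub>S\<^esub> discount Y h t) < \<epsilon>" if s: "0 \<le> s" "\<bar>s - t\<bar> < min 1 (min \<delta>1 \<delta>2)" for s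
  proof -
    have D: "h s \<ominus>\<^bsub>S\<^esub> h t \<in> carrier S" using hc s t by simp
    note [measurable] = rnorm_measurable[OF D]
    have eq: "discount Y h s \<ominus>\<^bsub>S\<^esub> L0_exp P (- s) Y \<odot>\<^bsub>S\<^esub> h t = L0_exp P (- s) Y \<odot>\<^bsub>S\<^esub> (h s \<ominus>\<^bsub>S\<^esub> h t)"
      using hc s t E by (simp add: M.minus_eq smult_r_distr smult_r_minus)
    have "fnorm (L0_exp P (- s) Y \<odot>\<^bsub>S\<^esub> (h s \<ominus>\<^bsub>S\<^esub> h t)) \<le> W'.fnorm (h s \<ominus>\<^bsub>S\<^esub> h t)"
      unfolding fnorm_def W'.fnorm_def
    proof (rule integral_mono_AE[OF integrable_fnorm W'.integrable_fnorm[OF D]])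
      show "AE w in P. min 1 (wt w * rnorm (L0_exp P (- s) Y \<odot>\<^bsub>S\<^esub> (h s \<ominus>\<^bsub>S\<^esub> h t)) w) \<le> min 1 (wt' w * rnorm (h s \<ominus>\<^bsub>S\<^esub> h t) w)"
        using rnorm_L0_exp[OF Y D, of "- s"] rnorm_nonneg[OF D]
      proof eventually_elim
        case (elim w)
        have "- s * ?y w \<le> s * \<bar>?y w\<bar>" using s mult_left_mono[of "- ?y w" "\<bar>?y w\<bar>" s] by simp
        also have "\<dots> \<le> \<bar>?y w\<bar> * (t + 1)" using s by (subst mult.commute) (intro mult_left_mono, auto)
        finally have "wt w * exp (- s * ?y w) * rnorm (h s \<ominus>\<^bsub>S\<^esub> h t) w \<le> wt' w * rnorm (h s \<ominus>\<^bsub>S\<^esub> h t) w"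
          unfolding wt'_def using elim wt_pos[of w] by (intro mult_right_mono mult_left_mono) auto
        then show ?case using elim by (simp add: mult.assoc)
      qed
    qed (use D E in simp)
    also have "\<dots> < \<epsilon> / 4" using \<delta>1(2)[of s] s by simp
    finally have 1: "fnorm (discount Y h s \<ominus>\<^bsub>S\<^esub> L0_exp P (- s) Y \<odot>\<^bsub>S\<^esub> h t) < \<epsilon> / 4" by (simp add: eq)
    have "fnorm (discount Y h s \<ominus>\<^bsub>S\<^esub> discount Y h t)
        \<le> fnorm (discount Y h s \<ominus>\<^bsub>S\<^esub> L0_exp P (- s) Y \<odot>\<^bsub>S\<^esub> h t)
          + fnorm (L0_exp P (- s) Y \<odot>\<^bsub>S\<^esub> h t \<ominus>\<^bsub>S\<^esub> discount Y h t)"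
      using gc s t hc E by (intro fnorm_triangle_minus) auto
    also have "\<dots> < \<epsilon> / 2" using 1 \<delta>2(2)[of s] s by simp
    finally have fnorm: "fnorm (discount Y h s \<ominus>\<^bsub>S\<^esub> discount Y h t) < \<epsilon> / 2" .
    have "AE w in P. wt w * rnorm (discount Y h s \<ominus>\<^bsub>S\<^esub> discount Y h t) w \<le> 2"
      using wt_rnorm_triangle[OF gc[OF s(1)] M.a_inv_closed[OF gc[OF t]]] rnorm_minus[OF gc[OF t]] bound[OF s(1)] bound[OF t]
      by eventually_elim (simp add: M.minus_eq)
    then have "wnorm (discount Y h s \<ominus>\<^bsub>S\<^esub> discount Y h t) \<le> 2 * fnorm (discount Y h s \<ominus>\<^bsub>S\<^esub> discount Y h t)"
      using gc s t by (intro wnorm_le_2_fnorm) auto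
    then show ?thesis using fnorm by simp
  qed
  then show "\<exists>\<delta>>0. \<forall>s\<ge>0. \<bar>s - t\<bar> < \<delta> \<longrightarrow> wnorm (discount Y h s \<ominus>\<^bsub>S\<^esub> discount Y h t) < \<epsilon>"
    using \<delta>1(1) \<delta>2(1) by (intro exI[of _ "min 1 (min \<delta>1 \<delta>2)"]) auto
qed

text \<open>The weight absorbs \<open>M\<close>, and the exponents combine to s times \<xi> - Y, at
  most - c s. The use with c = 0 gives boundedness, the use with c = n damping.\<close>

lemma discount_bound:
  assumes x: "x \<in> carrier S" and s: "0 \<le> s" and Y: "Y \<in> carrier (L0 P)"
    and M: "M \<in> carrier (L0 P)" "AE w in P. wt w * L0_rep M w \<le> 1"
    and \<xi>: "\<xi> \<in> carrier (L0 P)" "AE w in P. L0_rep \<xi> w + c \<le> L0_rep Y w"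
    and bound: "nrm x \<sqsubseteq>\<^bsub>L0_order P\<^esub> M \<otimes>\<^bsub>L0 P\<^esub> L0_exp P s \<xi>"
  shows "AE w in P. wt w * rnorm (L0_exp P (- s) Y \<odot>\<^bsub>S\<^esub> x) w \<le> exp (- (c * s))"
proof -
  have "AE w in P. rnorm x w \<le> L0_rep (M \<otimes>\<^bsub>L0 P\<^esub> L0_exp P s \<xi>) w"
    using bound by (simp add: L0_order_def rnorm_def)
  moreover have "AE w in P. L0_rep (M \<otimes>\<^bsub>L0 P\<^esub> L0_exp P s \<xi>) w = L0_rep M w * L0_rep (L0_exp P s \<xi>) w"
    by (rule L0_rep_mult[OF M(1) L0_exp(1)[OF \<xi>(1)]])
  moreover have "AE w in P. L0_rep (L0_exp P s \<xi>) w = exp (s * L0_rep \<xi> w)"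
    using L0_exp(2)[OF \<xi>(1), of s, where 'k=real] by simp
  ultimately show ?thesis using rnorm_L0_exp[OF Y x, of "- s"] M(2) \<xi>(2) 
  proof eventually_elim
    case (elim w)
    have "wt w * rnorm (L0_exp P (- s) Y \<odot>\<^bsub>S\<^esub> x) w \<le> wt w * (exp (- s * L0_rep Y w) * (L0_rep M w * exp (s * L0_rep \<xi> w)))"
      using elim wt_pos[of w] by (auto intro!: mult_left_mono)
    also have "\<dots> = (wt w * L0_rep M w) * exp (s * (L0_rep \<xi> w - L0_rep Y w))"
      by (simp add: mult_ac algebra_simps flip: exp_add)
    also have "\<dots> \<le> 1 * exp (s * (- c))"
    proof (intro mult_mono elim)
      have "s * (L0_rep \<xi> w - L0_rep Y w) \<le> s * (- c)" using elim s by (intro mult_left_mono) auto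
      then show "exp (s * (L0_rep \<xi> w - L0_rep Y w)) \<le> exp (s * (- c))" by simp
    qed auto
    finally show ?case by (simp add: mult.commute)
  qed
qed

end

context weighted_random_normed_module
begin

lemma wnorm_continuous_minus:
  assumes f: "wnorm_continuous f" and g: "wnorm_continuous g"
  shows "wnorm_continuous (\<lambda>t. f t \<ominus>\<^bsub>S\<^esub> g t)"
  unfolding wnorm_continuous_def
proof (intro conjI allI impI)
  note fV = wnorm_continuousD(1)[OF f] and gV = wnorm_continuousD(1)[OF g]
    and fc = wnorm_continuousD(2)[OF f] and gc = wnorm_continuousD(2)[OF g]
  show "f t \<ominus>\<^bsub>S\<^esub> g t \<in> wL1" if "0 \<le> t" for t using fV gV that by simp
  fix t \<epsilon> :: real assume t: "0 \<le> t" and "\<epsilon> > 0"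
  then have e: "\<epsilon> / 2 > 0" by simp
  obtain d1 where d1: "d1 > 0" "\<forall>s\<ge>0. \<bar>s - t\<bar> < d1 \<longrightarrow> wnorm (f s \<ominus>\<^bsub>S\<^esub> f t) < \<epsilon> / 2"
    using wnorm_continuousD(3)[OF f t e] by blast
  obtain d2 where d2: "d2 > 0" "\<forall>s\<ge>0. \<bar>s - t\<bar> < d2 \<longrightarrow> wnorm (g s \<ominus>\<^bsub>S\<^esub> g t) < \<epsilon> / 2"
    using wnorm_continuousD(3)[OF g t e] by blast
  have "wnorm ((f s \<ominus>\<^bsub>S\<^esub> g s) \<ominus>\<^bsub>S\<^esub> (f t \<ominus>\<^bsub>S\<^esub> g t)) < \<epsilon>" if s: "0 \<le> s" "\<bar>s - t\<bar> < min d1 d2" for s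
  proof -
    have "(f s \<ominus>\<^bsub>S\<^esub> g s) \<ominus>\<^bsub>S\<^esub> (f t \<ominus>\<^bsub>S\<^esub> g t) = (f s \<ominus>\<^bsub>S\<^esub> f t) \<oplus>\<^bsub>S\<^esub> (g t \<ominus>\<^bsub>S\<^esub> g s)"
      using fc[OF s(1)] fc[OF t] gc[OF s(1)] gc[OF t] by (simp add: M.minus_eq M.minus_add M.a_ac)
    also have "wnorm \<dots> \<le> wnorm (f s \<ominus>\<^bsub>S\<^esub> f t) + wnorm (g t \<ominus>\<^bsub>S\<^esub> g s)"
      using fV gV s t by (intro wnorm_triangle) auto
    also have "\<dots> < \<epsilon>" using d1(2)[rule_format, of s] d2(2)[rule_format, of s] s wnorm_minus_commute[OF gc[OF t] gc[OF s(1)]] by simp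
    finally show ?thesis .
  qed
  then show "\<exists>\<delta>>0. \<forall>s\<ge>0. \<bar>s - t\<bar> < \<delta> \<longrightarrow> wnorm ((f s \<ominus>\<^bsub>S\<^esub> g s) \<ominus>\<^bsub>S\<^esub> (f t \<ominus>\<^bsub>S\<^esub> g t)) < \<epsilon>"
    using d1(1) d2(1) by (intro exI[of _ "min d1 d2"]) auto
qed

text \<open>The Riemann sums of \<open>f1\<close> and \<open>f2\<close> approach the same element,
  so those of the difference approach zero; from here on only sums occur.\<close>

lemma negligible_kernel_of_equal_integrals:
  assumes comp: "eps_lambda_complete P S nrm"
    and f: "damped f1" "damped f2"
    and eq: "improper_integral P S nrm f1 = improper_integral P S nrm f2"
    and v: "\<And>t. 0 \<le> t \<Longrightarrow> cst (\<phi> t) \<odot>\<^bsub>S\<^esub> v t = f1 t \<ominus>\<^bsub>S\<^esub> f2 t"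
  shows "negligible_kernel v \<phi>"
  unfolding negligible_kernel_def
proof (intro allI impI)
  fix \<epsilon> :: real assume "\<epsilon> > 0"
  then have e: "\<epsilon> / 2 > 0" by simp
  let ?J = "improper_integral P S nrm f1" and ?R = "riemann_sum P S"
  have J: "?J \<in> carrier S" using improper_integral_exists[OF comp f(1)] by (simp add: limitin_eps_lambda)
  have fc: "f1 t \<in> carrier S" "f2 t \<in> carrier S" if "0 \<le> t" for t
    using f that wnorm_continuousD(2) by (auto simp: damped_def)
  show "eventually (\<lambda>L. eventually
     (\<lambda>p. fnorm (?R (\<lambda>t. cst (\<phi> t) \<odot>\<^bsub>S\<^esub> v t) p) < \<epsilon>) (riemann_filter 0 L)) at_top"
    using riemann_sums_tendsto_improper_integral[OF comp f(1) e]
      riemann_sums_tendsto_improper_integral[OF comp f(2) e, folded eq]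
  proof eventually_elim
    case (elim L)
    show ?case using elim eventually_tagged_division[of 0 L]
    proof eventually_elim
      case (elim p)
      note p = elim(3)
      have R: "?R f1 p \<in> carrier S" "?R f2 p \<in> carrier S"
        using fc by (auto intro!: riemann_sum_closed[OF p])
      have "?R (\<lambda>t. cst (\<phi> t) \<odot>\<^bsub>S\<^esub> v t) p = ?R (\<lambda>t. f1 t \<ominus>\<^bsub>S\<^esub> f2 t) p"
        using fc v by (intro riemann_sum_cong[OF p]) auto
      also have "\<dots> = ?R f1 p \<ominus>\<^bsub>S\<^esub> ?R f2 p" using fc by (intro riemann_sum_minus[OF p])
      finally show ?case
        using elim(1,2) fnorm_triangle_minus[OF R(1) J R(2)] fnorm_minus_commute[OF J R(2)] by simp
    qed
  qed
qed

end

section \<open>Uniqueness from the values of the transform at the points xi + n\<close>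

theorem corollary3p1:
  fixes P :: "'w measure"
    and S :: "(('w \<Rightarrow> 'k::{real_normed_field, euclidean_space}) set, 's) module"
    and nrm :: "'s \<Rightarrow> ('w \<Rightarrow> real) set"
    and h1 h2 :: "real \<Rightarrow> 's"
    and M1 M2 \<xi>1 \<xi>2 :: "('w \<Rightarrow> real) set"
  assumes "random_normed_module P S nrm"
    and "eps_lambda_complete P S nrm"
    and "continuous_map (top_of_set {0..}) (eps_lambda_topology P S nrm) h1"
    and "continuous_map (top_of_set {0..}) (eps_lambda_topology P S nrm) h2"
    and "M1 \<in> L0_plus P" and "M2 \<in> L0_plus P"
    and "\<xi>1 \<in> carrier (L0 P)" and "\<xi>2 \<in> carrier (L0 P)"
    and "\<And>s. s \<ge> 0 \<Longrightarrow> nrm (h1 s) \<sqsubseteq>\<^bsub>L0_order P\<^esub> M1 \<otimes>\<^bsub>L0 P\<^esub> L0_exp P s \<xi>1"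
    and "\<And>s. s \<ge> 0 \<Longrightarrow> nrm (h2 s) \<sqsubseteq>\<^bsub>L0_order P\<^esub> M2 \<otimes>\<^bsub>L0 P\<^esub> L0_exp P s \<xi>2"
    and "\<And>\<eta>. \<eta> \<in> carrier (L0 P) \<Longrightarrow> L0_less P (\<xi>1 \<squnion>\<^bsub>L0_order P\<^esub> \<xi>2) \<eta> \<Longrightarrow>
           laplace_transform P S nrm h1 \<eta> = laplace_transform P S nrm h2 \<eta>"
  shows "\<forall>s\<ge>0. h1 s = h2 s"
proof (intro allI impI)
  fix t0 :: real assume t0: "t0 \<ge> 0"
  interpret random_normed_module P S nrm by fact
  have M: "M1 \<in> carrier (L0 P)" "M2 \<in> carrier (L0 P)" using assms(5,6) by (auto simp: L0_plus_def)
  note [measurable] = L0_rep_measurable(2)[OF M(1)] L0_rep_measurable(2)[OF M(2)]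
    L0_rep_measurable(2)[OF assms(7)] L0_rep_measurable(2)[OF assms(8)]
  \<comment> \<open>Representatives of \<open>M1\<close> and \<open>M2\<close> are nonnegative only
    almost everywhere, whereas the weight must be positive at every point; hence the absolute
    values.\<close>
  define wt where "wt w = 1 / (1 + \<bar>L0_rep M1 w\<bar> + \<bar>L0_rep M2 w\<bar>)" for w
  interpret weighted_random_normed_module P S nrm wt
  proof
    show "wt \<in> borel_measurable P" unfolding wt_def by measurable
    show "0 < wt w" for w by (simp add: wt_def add_pos_nonneg)
  qed
  have wM: "AE w in P. wt w * L0_rep M1 w \<le> 1" "AE w in P. wt w * L0_rep M2 w \<le> 1"
    by (auto simp: wt_def add_pos_nonneg divide_le_eq)
  \<comment> \<open>The pointwise maximum stands in for the join; it dominates \<xi>1 and \<xi>2 at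
    every sample point.\<close>
  define \<xi> where "\<xi> w = max (L0_rep \<xi>1 w) (L0_rep \<xi>2 w)" for w
  \<comment> \<open>The shift 0 serves only to normalize \<open>h1\<close> and \<open>h2\<close>;
    the hypothesis, with its strict inequality, is used at the shifts n \<ge> 1.\<close>
  define \<eta> where "\<eta> c = L0_class P (\<lambda>w. \<xi> w + c)" for c :: real
  have [measurable]: "\<xi> \<in> borel_measurable P" unfolding \<xi>_def by measurable
  have \<eta>: "\<eta> c \<in> carrier (L0 P)" "AE w in P. L0_rep (\<eta> c) w = \<xi> w + c" for c
    unfolding \<eta>_def by (rule L0_rep_class; measurable)+
  have hc: "h1 s \<in> carrier S" "h2 s \<in> carrier S" if "0 \<le> s" for s
    using continuous_map_carrier[OF assms(3)] continuous_map_carrier[OF assms(4)] that by auto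
  have \<xi>\<eta>: "AE w in P. L0_rep \<xi>1 w + c \<le> L0_rep (\<eta> c) w" "AE w in P. L0_rep \<xi>2 w + c \<le> L0_rep (\<eta> c) w" for c
    using \<eta>(2)[of c] by (eventually_elim, simp add: \<xi>_def)+
  have bound: "AE w in P. wt w * rnorm (discount (\<eta> c) h1 s) w \<le> exp (- (c * s))"
    "AE w in P. wt w * rnorm (discount (\<eta> c) h2 s) w \<le> exp (- (c * s))" if "0 \<le> s" for c s
    by (rule discount_bound[OF hc(1)[OF that] that \<eta>(1) M(1) wM(1) assms(7) \<xi>\<eta>(1) assms(9)[OF that]])
      (rule discount_bound[OF hc(2)[OF that] that \<eta>(1) M(2) wM(2) assms(8) \<xi>\<eta>(2) assms(10)[OF that]])
  have cont: "wnorm_continuous (discount (\<eta> c) h1)" "wnorm_continuous (discount (\<eta> c) h2)" if "0 \<le> c" for c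
  proof -
    have le: "exp (- (c * s)) \<le> 1" if "0 \<le> s" for s using that \<open>0 \<le> c\<close> by simp
    have "AE w in P. wt w * rnorm (discount (\<eta> c) h1 s) w \<le> 1"
      "AE w in P. wt w * rnorm (discount (\<eta> c) h2 s) w \<le> 1" if "0 \<le> s" for s
      by (rule eventually_mono[OF bound(1)[OF that, of c]], erule order_trans[OF _ le[OF that]])
        (rule eventually_mono[OF bound(2)[OF that, of c]], erule order_trans[OF _ le[OF that]])
    then show "wnorm_continuous (discount (\<eta> c) h1)" "wnorm_continuous (discount (\<eta> c) h2)"
      using wnorm_continuous_discount[OF assms(3) \<eta>(1)] wnorm_continuous_discount[OF assms(4) \<eta>(1)] by blast+
  qed
  have NNb: "wnorm (discount (\<eta> c) h1 s) \<le> exp (- (c * s))" "wnorm (discount (\<eta> c) h2 s) \<le> exp (- (c * s))"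
    if "0 \<le> s" for c s
  proof -
    have "(L0_exp P (- s) (\<eta> c) :: ('w \<Rightarrow> 'k) set) \<in> carrier (L0 P)" by (rule L0_exp(1)[OF \<eta>(1)])
    then have "discount (\<eta> c) h1 s \<in> carrier S" "discount (\<eta> c) h2 s \<in> carrier S" using hc[OF that] by auto
    then show "wnorm (discount (\<eta> c) h1 s) \<le> exp (- (c * s))" "wnorm (discount (\<eta> c) h2 s) \<le> exp (- (c * s))"
      using bounded_wL1(2) bound[OF that, of c] by blast+
  qed
  let ?v = "\<lambda>s. discount (\<eta> 0) h1 s \<ominus>\<^bsub>S\<^esub> discount (\<eta> 0) h2 s"
  have v: "wnorm_continuous ?v" using cont[of 0] by (intro wnorm_continuous_minus) auto
  have gV: "discount (\<eta> 0) h1 s \<in> wL1" "discount (\<eta> 0) h2 s \<in> wL1" if "0 \<le> s" for s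
    using wnorm_continuousD(1) cont[of 0] that by auto
  have v2: "wnorm (?v s) \<le> 2" if "0 \<le> s" for s
  proof -
    have "wnorm (?v s) \<le> wnorm (discount (\<eta> 0) h1 s \<ominus>\<^bsub>S\<^esub> \<zero>\<^bsub>S\<^esub>) + wnorm (\<zero>\<^bsub>S\<^esub> \<ominus>\<^bsub>S\<^esub> discount (\<eta> 0) h2 s)"
      using gV[OF that] by (intro wnorm_triangle_minus) auto
    also have "\<dots> = wnorm (discount (\<eta> 0) h1 s) + wnorm (discount (\<eta> 0) h2 s)"
      using gV[OF that] wnorm_minus_commute[of "\<zero>\<^bsub>S\<^esub>" "discount (\<eta> 0) h2 s"]
      by (simp add: minus_zero_right wL1_carrier)
    also have "\<dots> \<le> 2" using NNb[OF that, of 0] by simp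
    finally show ?thesis .
  qed
  have neg: "negligible_kernel ?v (\<lambda>t. exp (- (real n * t)))" if n: "n \<ge> 1" for n :: nat
  proof (rule negligible_kernel_of_equal_integrals[OF assms(2)])
    have "exp (- (real n * s)) \<le> exp (- s)" if "0 \<le> s" for s
      using mult_right_mono[of 1 "real n" s] n that by simp
    then show "damped (discount (\<eta> (real n)) h1)" "damped (discount (\<eta> (real n)) h2)"
      using cont[of "real n"] NNb[of _ "real n"] unfolding damped_def by (meson of_nat_0_le_iff order_trans)+
    have "L0_less P (\<xi>1 \<squnion>\<^bsub>L0_order P\<^esub> \<xi>2) (\<eta> (real n))"
      unfolding L0_less_def using L0_join_le_max[OF assms(7,8)] \<eta>(2)[of "real n"]
      by eventually_elim (use n in \<open>simp add: \<xi>_def\<close>)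
    from assms(11)[OF \<eta>(1) this]
    show "improper_integral P S nrm (discount (\<eta> (real n)) h1) = improper_integral P S nrm (discount (\<eta> (real n)) h2)"
      by (simp add: laplace_transform_def)
    fix s :: real assume s: "0 \<le> s"
    let ?E = "\<lambda>c. L0_exp P (- s) (\<eta> c) :: ('w \<Rightarrow> 'k) set"
    have E: "?E c \<in> carrier (L0 P)" for c by (rule L0_exp(1)[OF \<eta>(1)])
    \<comment> \<open>Splits the exponential at xi + n into the deterministic exp (- n s) and the
      random factor that is already contained in \<open>?v\<close>.\<close>
    have "?E (real n) = cst (exp (- (real n * s))) \<otimes>\<^bsub>L0 P\<^esub> ?E 0"
    proof (rule L0_eqI[OF E])
      show "AE w in P. L0_rep (?E (real n)) w = L0_rep (cst (exp (- (real n * s))) \<otimes>\<^bsub>L0 P\<^esub> ?E 0) w"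
        using L0_rep_mult[OF L0_const_carrier E, of "exp (- (real n * s))" 0]
          L0_rep_const[of P "exp (- (real n * s))", where 'k='k] \<eta>(2)[of "real n"] \<eta>(2)[of 0]
          L0_exp(2)[OF \<eta>(1), of "- s" "real n", where 'k='k] L0_exp(2)[OF \<eta>(1), of "- s" 0, where 'k='k]
        by eventually_elim (simp add: algebra_simps flip: of_real_mult exp_add)
    qed (use E in simp)
    then show "cst (exp (- (real n * s))) \<odot>\<^bsub>S\<^esub> ?v s
        = discount (\<eta> (real n)) h1 s \<ominus>\<^bsub>S\<^esub> discount (\<eta> (real n)) h2 s"
      using hc[OF s] E[of 0] by (simp add: cst_smult_minus smult_assoc1)
  qed
  have "?v t0 = \<zero>\<^bsub>S\<^esub>" by (rule wnorm_continuous_eq_zero[OF v v2 neg t0])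
  \<comment> \<open>The discounting is undone: its factor is strictly positive at every sample point
    where its formula holds, so the norm of the undiscounted difference vanishes almost
    everywhere.\<close>
  let ?E = "L0_exp P (- t0) (\<eta> 0) :: ('w \<Rightarrow> 'k) set"
  have E: "?E \<in> carrier (L0 P)" by (rule L0_exp(1)[OF \<eta>(1)])
  have D: "h1 t0 \<ominus>\<^bsub>S\<^esub> h2 t0 \<in> carrier S" using hc[OF t0] by simp
  have "?E \<odot>\<^bsub>S\<^esub> (h1 t0 \<ominus>\<^bsub>S\<^esub> h2 t0) = ?v t0"
    using hc[OF t0] E by (simp add: M.minus_eq smult_r_distr smult_r_minus)
  then have "?E \<odot>\<^bsub>S\<^esub> (h1 t0 \<ominus>\<^bsub>S\<^esub> h2 t0) = \<zero>\<^bsub>S\<^esub>" using \<open>?v t0 = _\<close> by simp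
  then have "AE w in P. rnorm \<zero>\<^bsub>S\<^esub> w = exp (- t0 * L0_rep (\<eta> 0) w) * rnorm (h1 t0 \<ominus>\<^bsub>S\<^esub> h2 t0) w"
    using rnorm_L0_exp[OF \<eta>(1) D, of "- t0" 0] by simp
  then have "AE w in P. rnorm (h1 t0 \<ominus>\<^bsub>S\<^esub> h2 t0) w = 0"
    using rnorm_zero by eventually_elim simp
  then have "h1 t0 \<ominus>\<^bsub>S\<^esub> h2 t0 = \<zero>\<^bsub>S\<^esub>" by (rule rnorm_eq_0_imp[OF D])
  then show "h1 t0 = h2 t0"
    using hc[OF t0] metr.zero[of "h1 t0" "h2 t0"] by (simp add: fdist_def fnorm_zero)
qed

end
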